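(* Let $F$ be a field and $F * A_1$, $F * A_2$ twisted group algebras of finitely generated free abelian groups $A_1,A_2$ over $F$, and suppose $\dim(F * A_i)<\mathrm{rk}(A_i)$ for $i\in\{1,2\}$. Let $d=\dim(F * A_1\otimes_F F * A_2)$. Then $$d\le\min\{\dim(F * A_1)+\mathrm{rk}(A_2),\ \dim(F * A_2)+\mathrm{rk}(A_1)\}-1.$$
   Context: A twisted group algebra $F * A$ is an $F$-algebra with $F$-basis $\{\bar a: a\in A\}$ and $\bar a_1\bar a_2=\tau(a_1,a_2)\overline{a_1a_2}$, $\tau$ a 2-cocycle with values in $F\setminus\{0\}$. The tensor product $F * A_1\otimes_F F * A_2$ is a twisted group algebra of $A_1\times A_2$. $\dim$ denotes the Krull dimension, which for these algebras coincides with the global dimension; $\mathrm{rk}$ denotes the rank of a free abelian group. *)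

theory Defs
  imports Main
begin

definition grp :: "nat \<Rightarrow> int list set" where
  "grp n = {a. length a = n}"

definition gadd :: "int list \<Rightarrow> int list \<Rightarrow> int list" where
  "gadd a b = map2 (+) a b"

definition gneg :: "int list \<Rightarrow> int list" where
  "gneg a = map uminus a"

definition cocycle :: "nat \<Rightarrow> (int list \<Rightarrow> int list \<Rightarrow> 'a::field) \<Rightarrow> bool" where
  "cocycle n \<tau> \<longleftrightarrow>
     (\<forall>a\<in>grp n. \<forall>b\<in>grp n. \<tau> a b \<noteq> 0) \<and>
     (\<forall>a\<in>grp n. \<forall>b\<in>grp n. \<forall>c\<in>grp n.
        \<tau> a b * \<tau> (gadd a b) c = \<tau> b c * \<tau> a (gadd b c))"

(* Twisted group algebra F * Z^n: finitely supported functions Z^n \<Rightarrow> F,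
   x = \<Sum> x(a) \<bar>a\<bar>, with \<bar>a\<bar> \<bar>b\<bar> = \<tau>(a,b) \<bar>ab\<bar> *)
definition tga_carrier :: "nat \<Rightarrow> (int list \<Rightarrow> 'a::field) set" where
  "tga_carrier n = {x. finite {a. x a \<noteq> 0} \<and> (\<forall>a. x a \<noteq> 0 \<longrightarrow> a \<in> grp n)}"

definition tga_mult :: "nat \<Rightarrow> (int list \<Rightarrow> int list \<Rightarrow> 'a::field)
    \<Rightarrow> (int list \<Rightarrow> 'a) \<Rightarrow> (int list \<Rightarrow> 'a) \<Rightarrow> (int list \<Rightarrow> 'a)" where
  "tga_mult n \<tau> x y = (\<lambda>c. if c \<in> grp n then
      (\<Sum>a\<in>{a. x a \<noteq> 0}. x a * y (gadd c (gneg a)) * \<tau> a (gadd c (gneg a))) else 0)"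

definition tga_right_ideals :: "nat \<Rightarrow> (int list \<Rightarrow> int list \<Rightarrow> 'a::field)
    \<Rightarrow> (int list \<Rightarrow> 'a) set set" where
  "tga_right_ideals n \<tau> = {I. I \<subseteq> tga_carrier n \<and> (\<lambda>_. 0) \<in> I \<and>
      (\<forall>x\<in>I. \<forall>y\<in>I. (\<lambda>c. x c + y c) \<in> I) \<and>
      (\<forall>x\<in>I. (\<lambda>c. - x c) \<in> I) \<and>
      (\<forall>x\<in>I. \<forall>r\<in>tga_carrier n. tga_mult n \<tau> x r \<in> I)}"

(* Deviation of a poset of sets (ordered by inclusion), on the interval [b,a].
   dev_le L b a (Suc k) means: deviation of [b,a] \<le> k;
   dev_le L b a 0 means: deviation of [b,a] = -\<infinity> (trivial interval). *)
fun dev_le :: "'b set set \<Rightarrow> 'b set \<Rightarrow> 'b set \<Rightarrow> nat \<Rightarrow> bool" where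
  "dev_le L b a 0 = (b = a)"
| "dev_le L b a (Suc k) =
     (\<forall>f :: nat \<Rightarrow> 'b set.
        (f 0 \<subseteq> a \<and> (\<forall>i. f i \<in> L \<and> b \<subseteq> f i \<and> f (Suc i) \<subseteq> f i)) \<longrightarrow>
        (\<exists>N. \<forall>i\<ge>N. dev_le L (f (Suc i)) (f i) k))"

(* (right) Krull dimension of F * Z^n = deviation of its lattice of right ideals *)
definition tga_dim :: "nat \<Rightarrow> (int list \<Rightarrow> int list \<Rightarrow> 'a::field) \<Rightarrow> nat" where
  "tga_dim n \<tau> = (LEAST k. dev_le (tga_right_ideals n \<tau>) {\<lambda>_. 0} (tga_carrier n) (Suc k))"

(* F * Z^n1 \<otimes>_F F * Z^n2 = F * (Z^n1 \<times> Z^n2) with the product cocycle;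
   Z^n1 \<times> Z^n2 identified with Z^(n1+n2) by concatenation *)
definition tensor_cocycle :: "nat \<Rightarrow> (int list \<Rightarrow> int list \<Rightarrow> 'a::field)
    \<Rightarrow> (int list \<Rightarrow> int list \<Rightarrow> 'a) \<Rightarrow> int list \<Rightarrow> int list \<Rightarrow> 'a" where
  "tensor_cocycle n1 \<tau>1 \<tau>2 a b = \<tau>1 (take n1 a) (take n1 b) * \<tau>2 (drop n1 a) (drop n1 b)"

end

theory Submission
  imports Defs Complex_Main "HOL-Library.Function_Algebras" "HOL-Library.FuncSet"
    "HOL-Computational_Algebra.Polynomial"
begin

text \<open>
  Call a subspace \<open>W\<close> of \<open>\<rat>\<^sup>n\<close> torsion if all commutators of basis elements with exponents in
  \<open>W \<inter> \<int>\<^sup>n\<close> are roots of unity. The Krull dimension of \<open>F * \<int>\<^sup>n\<close> is the largest dimension of a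
  torsion subspace (Brookes' theorem).

  Lower bound: a torsion subspace of dimension \<open>r\<close> contains \<open>r\<close> independent exponents whose basis
  elements commute, and the powers of \<open>z\<^sub>1 - 1, \<dots>, z\<^sub>r - 1\<close> for these elements yield a strictly
  decreasing chain of right ideals of order type \<open>\<omega>\<^sup>r\<close>.

  Upper bound: leading exponents turn right ideals into up-sets of \<open>\<nat>\<^sup>n\<close>, and the deviation is
  controlled by the growth of differences of up-sets. If the dimension exceeds \<open>k\<close>, then some
  proper right ideal \<open>I\<close> meets \<open>F * C\<close> nontrivially for every subspace \<open>C\<close> of codimension at most
  \<open>k\<close>. Passing to initial ideals with respect to real weights (a Groebner degeneration) keeps this
  property and lowers the rank, as long as the quotient module is infinite dimensional over \<open>F\<close>.
  The process ends with a module of finite dimension over \<open>F * W\<close>, where \<open>W\<close> has dimension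
  greater than \<open>k\<close>; the existence of such a module makes \<open>W\<close> torsion.

  For a tensor product let \<open>W\<close> be a torsion subspace of dimension \<open>dim (F * A\<^sub>1) + rk A\<^sub>2\<close>. Then
  \<open>W \<inter> A\<^sub>1\<close> has the maximal dimension of a torsion subspace of \<open>A\<^sub>1\<close>, and it commutes up to
  torsion with the projection of \<open>W\<close> to \<open>A\<^sub>1\<close>, which it therefore contains. So \<open>W\<close> contains
  \<open>A\<^sub>2\<close>, and \<open>dim (F * A\<^sub>2) = rk A\<^sub>2\<close>.
\<close>

text \<open>Both halves of the dimension formula are needed: the lower bound is applied to the two
  factors, where it turns a large torsion subspace into a large dimension, and the upper bound to
  the tensor product. Without the \<open>- 1\<close> the inequality is a projection argument; the
  work lies in excluding equality.

  The upper bound rests on a gap in growth. If every proper right ideal meets \<open>F * C\<close>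
  in 0 for some \<open>C\<close> of codimension at most \<open>k\<close>, then every nonzero
  subquotient grows at least like N^(n-k), while the algebra grows like N^n. Along a descending
  chain only finitely many steps keep the growth exponent of the interval, so the exponents n-k,
  ..., n bound the deviation by \<open>k\<close>. Growth is measured on elements with nonnegative
  exponents, reached by translating with a unit.

  For the lower bound the right ideals are cut out by linear functionals instead of being generated
  by products: strictness of an inclusion then needs one functional evaluated at one product.
  Binomial coefficients take the place of derivatives, so the characteristic of F does not
  matter.\<close>

definition smul :: "'k::field \<Rightarrow> ('i \<Rightarrow> 'k) \<Rightarrow> 'i \<Rightarrow> 'k" where
  "smul k x = (\<lambda>i. k * x i)"

lemma smul_apply [simp]: "smul k x i = k * x i"
  by (simp add: smul_def)

text \<open>One interpretation serves both algebra elements over F and exponent vectors over the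
  rationals.\<close>

interpretation fs: vector_space "smul :: 'k::field \<Rightarrow> ('i \<Rightarrow> 'k) \<Rightarrow> 'i \<Rightarrow> 'k"
  by unfold_locales (auto simp: fun_eq_iff algebra_simps)

lemma sum_apply: "(\<Sum>i\<in>A. f i) x = (\<Sum>i\<in>A. f i x)"
  for f :: "'i \<Rightarrow> 'b \<Rightarrow> 'c::comm_monoid_add"
  by (induction A rule: infinite_finite_induct) auto


section \<open>Deviation\<close>

text \<open>A strictly monotone map sends descending chains to descending chains, so the source
  deviates at most as much as the target. Injectivity is what the trivial interval at level 0 needs.
  Used in both directions, this compares two models of one algebra.\<close>

lemma dev_le_strict_mono:
  assumes "dev_le L' (\<Phi> b) (\<Phi> a) k"
    and "\<And>I. I \<in> L \<Longrightarrow> \<Phi> I \<in> L'"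
    and "\<And>I J. I \<in> L \<Longrightarrow> J \<in> L \<Longrightarrow> I \<subseteq> J \<Longrightarrow> \<Phi> I \<subseteq> \<Phi> J"
    and "inj_on \<Phi> L" and "a \<in> L" and "b \<in> L"
  shows "dev_le L b a k"
  using assms(1,5,6)
proof (induction k arbitrary: a b)
  case 0
  then show ?case using assms(4) by (auto dest: inj_onD)
next
  case (Suc k)
  show ?case
    unfolding dev_le.simps
  proof (intro allI impI)
    fix f assume f: "f 0 \<subseteq> a \<and> (\<forall>i. f i \<in> L \<and> b \<subseteq> f i \<and> f (Suc i) \<subseteq> f i)"
    then have "\<Phi> (f 0) \<subseteq> \<Phi> a \<and> (\<forall>i. \<Phi> (f i) \<in> L' \<and> \<Phi> b \<subseteq> \<Phi> (f i) \<and> \<Phi> (f (Suc i)) \<subseteq> \<Phi> (f i))"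
      using assms(2,3) Suc.prems by auto
    with Suc.prems(1) obtain N where "\<forall>i\<ge>N. dev_le L' (\<Phi> (f (Suc i))) (\<Phi> (f i)) k"
      unfolding dev_le.simps by (elim allE[of _ "\<Phi> \<circ> f"]) auto
    then show "\<exists>N. \<forall>i\<ge>N. dev_le L (f (Suc i)) (f i) k"
      using Suc.IH f by blast
  qed
qed

text \<open>On lists of one fixed length r this is the ordinal omega^r, the head being the most
  significant digit.\<close>

fun lex_less :: "nat list \<Rightarrow> nat list \<Rightarrow> bool" where
  "lex_less (x # xs) (y # ys) \<longleftrightarrow> x < y \<or> x = y \<and> lex_less xs ys"
| "lex_less _ _ \<longleftrightarrow> False"

lemma lex_less_replicate: "lex_less (replicate (length e) 0) e \<or> e = replicate (length e) 0"
  by (induction e) auto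

text \<open>The deviation of the reversed ordinal \<open>\<omega>\<^sup>r\<close> is \<open>r\<close>.\<close>

lemma not_dev_le_if_lex_chain:
  assumes "\<And>e. length e = r \<Longrightarrow> J e \<in> L \<and> J e \<subseteq> a \<and> b \<subset> J e"
    and "\<And>e e'. length e = r \<Longrightarrow> length e' = r \<Longrightarrow> lex_less e e' \<Longrightarrow> J e' \<subset> J e"
  shows "\<not> dev_le L b a r"
  using assms
proof (induction r arbitrary: J a b)
  case 0
  then show ?case by force
next
  case (Suc r)
  \<comment> \<open>The coarse chain runs through the limit points \<open>i # z\<close>; the segment
    between two neighbours contains the lists \<open>N # e\<close>, a chain of type omega^r for the
    induction hypothesis.\<close>
  define z where "z = replicate r (0::nat)"
  have z [simp]: "length z = r" by (simp add: z_def)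
  show ?case
  proof
    assume *: "dev_le L b a (Suc r)"
    have "J (Suc i # z) \<subset> J (i # z)" for i
      using Suc.prems(2)[of "i # z" "Suc i # z"] by simp
    then have "J (0 # z) \<subseteq> a \<and> (\<forall>i. J (i # z) \<in> L \<and> b \<subseteq> J (i # z) \<and> J (Suc i # z) \<subseteq> J (i # z))"
      using Suc.prems(1)[of "_ # z"] by (simp add: psubset_imp_subset)
    with * obtain N where N: "dev_le L (J (Suc N # z)) (J (N # z)) r"
      unfolding dev_le.simps by (elim allE[of _ "\<lambda>i. J (i # z)"]) auto
    have lz: "lex_less z e \<or> e = z" if "length e = r" for e
      using lex_less_replicate[of e] that by (simp add: z_def)
    have "\<not> dev_le L (J (Suc N # z)) (J (N # z)) r"
    proof (rule Suc.IH[of "\<lambda>e. J (N # e)"])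
      fix e :: "nat list" assume e: "length e = r"
      have "J (N # e) \<subseteq> J (N # z)"
        using lz[of e] Suc.prems(2)[of "N # z" "N # e"] e by auto
      then show "J (N # e) \<in> L \<and> J (N # e) \<subseteq> J (N # z) \<and> J (Suc N # z) \<subset> J (N # e)"
        using e Suc.prems(1)[of "N # e"] Suc.prems(2)[of "N # e" "Suc N # z"] by auto
    next
      fix e e' :: "nat list" assume "length e = r" "length e' = r" "lex_less e e'"
      then show "J (N # e') \<subset> J (N # e)"
        using Suc.prems(2)[of "N # e" "N # e'"] by auto
    qed
    with N show False by blast
  qed
qed

section \<open>Twisted group algebras\<close>

definition supp :: "('g \<Rightarrow> 'a::zero) \<Rightarrow> 'g set" where
  "supp x = {g. x g \<noteq> 0}"

definition Alg :: "'g set \<Rightarrow> ('g \<Rightarrow> 'a::zero) set" where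
  "Alg G = {x. finite (supp x) \<and> supp x \<subseteq> G}"

definition ind :: "'g \<Rightarrow> 'g \<Rightarrow> 'a::zero_neq_one" where
  "ind a = (\<lambda>c. if c = a then 1 else 0)"

definition sub :: "'g::ab_group_add set \<Rightarrow> bool" where
  "sub G \<longleftrightarrow> 0 \<in> G \<and> (\<forall>a\<in>G. \<forall>b\<in>G. a - b \<in> G)"

lemma sub_0: "sub G \<Longrightarrow> 0 \<in> G"
  and sub_diff: "sub G \<Longrightarrow> a \<in> G \<Longrightarrow> b \<in> G \<Longrightarrow> a - b \<in> G"
  by (auto simp: sub_def)

lemma sub_neg: "sub G \<Longrightarrow> a \<in> G \<Longrightarrow> - a \<in> G"
  using sub_diff[of G 0 a] sub_0[of G] by simp

lemma sub_add: "sub G \<Longrightarrow> a \<in> G \<Longrightarrow> b \<in> G \<Longrightarrow> a + b \<in> G"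
  using sub_diff[of G a "- b"] sub_neg[of G b] by simp

lemma ind_apply: "ind a c = (if c = a then 1 else 0)"
  by (simp add: ind_def)

lemma supp_add: "supp (x + y) \<subseteq> supp x \<union> supp y" for x y :: "'g \<Rightarrow> 'a::monoid_add"
  by (auto simp: supp_def)

lemma supp_smul: "supp (smul k x) \<subseteq> supp x"
  by (auto simp: supp_def)

lemma supp_ind [simp]: "supp (ind a :: 'g \<Rightarrow> 'a::zero_neq_one) = {a}"
  by (auto simp: supp_def ind_def)

lemma Alg_0 [simp]: "0 \<in> Alg G"
  by (simp add: Alg_def supp_def)

lemma Alg_add: "x \<in> Alg G \<Longrightarrow> y \<in> Alg G \<Longrightarrow> x + y \<in> Alg G" for x y :: "'g \<Rightarrow> 'a::monoid_add"
  unfolding Alg_def using supp_add[of x y] by (auto intro: finite_subset)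

lemma Alg_smul: "x \<in> Alg G \<Longrightarrow> smul k x \<in> Alg G"
  unfolding Alg_def using supp_smul[of k x] by (auto intro: finite_subset)

lemma Alg_ind: "a \<in> G \<Longrightarrow> (ind a :: 'g \<Rightarrow> 'a::zero_neq_one) \<in> Alg G"
  by (simp add: Alg_def)

lemma Alg_sum: "(\<And>i. i \<in> A \<Longrightarrow> f i \<in> Alg G) \<Longrightarrow> (\<Sum>i\<in>A. f i) \<in> Alg G"
  for f :: "'i \<Rightarrow> 'g \<Rightarrow> 'a::comm_monoid_add"
  by (induction A rule: infinite_finite_induct) (auto intro: Alg_add)

lemma eq_sum_ind:
  assumes "finite S" "supp x \<subseteq> S"
  shows "x = (\<Sum>a\<in>S. smul (x a) (ind a))"
proof
  fix c
  have "(\<Sum>a\<in>S. smul (x a) (ind a)) c = (\<Sum>a\<in>S. if c = a then x a else 0)"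
    by (auto simp: sum_apply ind_apply intro!: sum.cong)
  also have "\<dots> = x c"
    using assms by (auto simp: supp_def)
  finally show "x c = (\<Sum>a\<in>S. smul (x a) (ind a)) c" by simp
qed

text \<open>The cocycle is not normalised: the identity of the algebra is \<open>ind 0\<close>
  divided by \<open>\<tau> 0 0\<close>, which explains the factors \<open>\<tau> 0 0\<close> below.
  It is total on the type; subgroups enter only through sets \<open>G\<close> of exponents.\<close>

locale twisted =
  fixes \<tau> :: "'g::ab_group_add \<Rightarrow> 'g \<Rightarrow> 'a::field"
  assumes nz [simp]: "\<tau> a b \<noteq> 0"
    and coc: "\<tau> a b * \<tau> (a + b) c = \<tau> b c * \<tau> a (b + c)"
begin

lemma tau_right_0: "\<tau> c 0 = \<tau> 0 0"
  using coc[of c 0 0] by simp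

lemma tau_left_0: "\<tau> 0 c = \<tau> 0 0"
  using coc[of 0 0 c] by simp

text \<open>Right multiplication by the basis element of \<open>a\<close>.\<close>

definition rm :: "('g \<Rightarrow> 'a) \<Rightarrow> 'g \<Rightarrow> 'g \<Rightarrow> 'a" where
  "rm x a = (\<lambda>c. x (c - a) * \<tau> (c - a) a)"

lemma rm_add: "rm (x + y) a = rm x a + rm y a"
  by (auto simp: rm_def fun_eq_iff algebra_simps)

lemma rm_smul: "rm (smul k x) a = smul k (rm x a)"
  by (auto simp: rm_def fun_eq_iff algebra_simps)

lemma rm_0_left [simp]: "rm 0 a = 0"
  by (auto simp: rm_def fun_eq_iff)

lemma rm_sum: "rm (\<Sum>i\<in>A. f i) a = (\<Sum>i\<in>A. rm (f i) a)"
  by (rule ext) (simp add: rm_def sum_apply sum_distrib_right)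

lemma rm_rm: "rm (rm x a) b = smul (\<tau> a b) (rm x (a + b))"
proof
  fix c
  show "rm (rm x a) b c = smul (\<tau> a b) (rm x (a + b)) c"
    using coc[of "c - b - a" a b] by (simp add: rm_def algebra_simps)
qed

lemma rm_0: "rm x 0 = smul (\<tau> 0 0) x"
proof
  fix c
  show "rm x 0 c = smul (\<tau> 0 0) x c" using tau_right_0[of c] by (simp add: rm_def)
qed

lemma supp_rm: "supp (rm x a) = (\<lambda>c. c + a) ` supp x"
proof -
  have "c \<in> (\<lambda>c. c + a) ` supp x" if "x (c - a) \<noteq> 0" for c
    by (rule image_eqI[of _ _ "c - a"]) (use that in \<open>auto simp: supp_def\<close>)
  then show ?thesis by (auto simp: supp_def rm_def)
qed

lemma rm_ind: "rm (ind b) a = smul (\<tau> b a) (ind (b + a))"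
  by (auto simp: rm_def fun_eq_iff ind_apply algebra_simps)

lemma Alg_rm: "sub G \<Longrightarrow> x \<in> Alg G \<Longrightarrow> a \<in> G \<Longrightarrow> rm x a \<in> Alg G"
  by (auto simp: Alg_def supp_rm intro: sub_add)

text \<open>Scalars and basis elements span the algebra, so closure under these two operations
  already gives closure under all right multiplications, see \<open>mul_in_rideal\<close>.\<close>

definition rideal :: "'g set \<Rightarrow> ('g \<Rightarrow> 'a) set \<Rightarrow> bool" where
  "rideal G I \<longleftrightarrow> I \<subseteq> Alg G \<and> 0 \<in> I \<and> (\<forall>x\<in>I. \<forall>y\<in>I. x + y \<in> I) \<and>
     (\<forall>x\<in>I. \<forall>k. smul k x \<in> I) \<and> (\<forall>x\<in>I. \<forall>a\<in>G. rm x a \<in> I)"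

lemma rideal_Alg: "rideal G I \<Longrightarrow> x \<in> I \<Longrightarrow> x \<in> Alg G"
  and rideal_0: "rideal G I \<Longrightarrow> 0 \<in> I"
  and rideal_add: "rideal G I \<Longrightarrow> x \<in> I \<Longrightarrow> y \<in> I \<Longrightarrow> x + y \<in> I"
  and rideal_smul: "rideal G I \<Longrightarrow> x \<in> I \<Longrightarrow> smul k x \<in> I"
  and rideal_rm: "rideal G I \<Longrightarrow> x \<in> I \<Longrightarrow> a \<in> G \<Longrightarrow> rm x a \<in> I"
  by (auto simp: rideal_def)

lemma rideal_sum: "rideal G I \<Longrightarrow> (\<And>i. i \<in> A \<Longrightarrow> f i \<in> I) \<Longrightarrow> (\<Sum>i\<in>A. f i) \<in> I"
  by (induction A rule: infinite_finite_induct) (auto intro: rideal_add rideal_0)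

lemma rideal_diff: 
  assumes "rideal G I" "x \<in> I" "y \<in> I" 
  shows "x - y \<in> I"
proof -
  have "x - y = x + smul (- 1) y" by (simp add: fun_eq_iff)
  then show ?thesis using rideal_add rideal_smul assms by metis
qed

lemma rideal_whole: "sub G \<Longrightarrow> rideal G (Alg G)"
  by (auto simp: rideal_def intro: Alg_add Alg_smul Alg_rm)

lemma rideal_zero: "rideal G {0}"
  by (auto simp: rideal_def)

lemma rideal_smul_iff: "rideal G I \<Longrightarrow> k \<noteq> 0 \<Longrightarrow> smul k x \<in> I \<longleftrightarrow> x \<in> I"
  using rideal_smul[of G I "smul k x" "inverse k"] rideal_smul[of G I x k]
  by (auto simp: smul_def field_simps)

lemma rideal_rm_iff: 
  assumes "sub G" "rideal G I" "a \<in> G"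
  shows "rm x a \<in> I \<longleftrightarrow> x \<in> I"
proof
  assume "rm x a \<in> I"
  then have "rm (rm x a) (- a) \<in> I" using assms by (blast intro: rideal_rm sub_neg)
  then have "smul (\<tau> a (- a) * \<tau> 0 0) x \<in> I"
    by (simp add: rm_rm rm_0 smul_def mult.assoc)
  then show "x \<in> I" using rideal_smul_iff[OF assms(2)] by simp
qed (use assms rideal_rm in blast)

text \<open>Basis elements are units: right multiplication by the one at \<open>b - a\<close>
  carries the one at \<open>a\<close> to a nonzero multiple of the one at \<open>b\<close>.\<close>

lemma rideal_eq_Alg:
  assumes "sub G" "rideal G I" "ind a \<in> I"
  shows "I = (Alg G :: ('g \<Rightarrow> 'a) set)"
proof
  show "I \<subseteq> (Alg G :: ('g \<Rightarrow> 'a) set)" using assms by (auto simp: rideal_def)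
  have aG: "a \<in> G" using rideal_Alg[OF assms(2,3)] by (simp add: Alg_def)
  have ind: "ind b \<in> I" if "b \<in> G" for b
  proof -
    have "rm (ind a) (b - a) \<in> I" using assms aG that by (blast intro: rideal_rm sub_diff)
    then show ?thesis using rideal_smul_iff[OF assms(2)] by (simp add: rm_ind)
  qed
  show "Alg G \<subseteq> I"
  proof
    fix x :: "'g \<Rightarrow> 'a" assume x: "x \<in> Alg G"
    have "(\<Sum>b\<in>supp x. smul (x b) (ind b)) \<in> I"
      using x by (intro rideal_sum[OF assms(2)] rideal_smul[OF assms(2)] ind) (auto simp: Alg_def)
    then show "x \<in> I" using x eq_sum_ind[of "supp x" x] by (simp add: Alg_def)
  qed
qed

definition mul :: "('g \<Rightarrow> 'a) \<Rightarrow> ('g \<Rightarrow> 'a) \<Rightarrow> ('g \<Rightarrow> 'a)" where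
  "mul x y = (\<Sum>b\<in>supp y. smul (y b) (rm x b))"

lemma mul_eq: "finite S \<Longrightarrow> supp y \<subseteq> S \<Longrightarrow> mul x y = (\<Sum>b\<in>S. smul (y b) (rm x b))"
  unfolding mul_def by (rule sum.mono_neutral_left) (auto simp: supp_def)

lemma mul_add:
  assumes "y \<in> Alg G" "z \<in> Alg G" 
  shows "mul x (y + z) = mul x y + mul x z"
proof -
  let ?S = "supp y \<union> supp z"
  have fin: "finite ?S" using assms by (auto simp: Alg_def)
  have "mul x (y + z) = (\<Sum>b\<in>?S. smul ((y + z) b) (rm x b))"
    by (rule mul_eq[OF fin supp_add])
  also have "\<dots> = (\<Sum>b\<in>?S. smul (y b) (rm x b)) + (\<Sum>b\<in>?S. smul (z b) (rm x b))"
    by (simp add: sum.distrib[symmetric] fs.scale_left_distrib)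
  finally show ?thesis using mul_eq[OF fin, of y] mul_eq[OF fin, of z] by simp
qed

lemma mul_smul:
  assumes "y \<in> Alg G"
  shows "mul x (smul k y) = smul k (mul x y)"
proof -
  have "mul x (smul k y) = (\<Sum>b\<in>supp y. smul (smul k y b) (rm x b))"
    by (rule mul_eq) (use assms supp_smul[of k y] in \<open>auto simp: Alg_def\<close>)
  then show ?thesis by (simp add: mul_def fs.scale_sum_right)
qed

lemma mul_ind: "mul x (ind a) = rm x a"
  by (simp add: mul_def ind_apply)

lemma mul_rm: 
  assumes "s \<in> Alg G"
  shows "mul x (rm s b) = rm (mul x s) b"
proof -
  have "mul x (rm s b) = (\<Sum>c\<in>(\<lambda>c. c + b) ` supp s. smul (rm s b c) (rm x c))"
    by (simp add: mul_def supp_rm)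
  also have "\<dots> = (\<Sum>c\<in>supp s. smul (rm s b (c + b)) (rm x (c + b)))"
    by (simp add: sum.reindex inj_on_def)
  also have "\<dots> = (\<Sum>c\<in>supp s. rm (smul (s c) (rm x c)) b)"
    by (rule sum.cong) (auto simp: rm_smul rm_rm, simp add: rm_def smul_def)
  also have "\<dots> = rm (mul x s) b" by (simp add: mul_def rm_sum)
  finally show ?thesis .
qed

lemma mul_in_rideal: "rideal G I \<Longrightarrow> x \<in> I \<Longrightarrow> y \<in> Alg G \<Longrightarrow> mul x y \<in> I"
  unfolding mul_def
  by (rule rideal_sum[of G], assumption, rule rideal_smul[of G], assumption, rule rideal_rm[of G])
    (auto simp: Alg_def)

text \<open>The commutator: exchanging the basis elements of \<open>a\<close> and \<open>b\<close>
  costs the factor \<open>lam a b\<close>. It is bimultiplicative and alternating, and carries all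
  of the noncommutativity.\<close>

definition lam :: "'g \<Rightarrow> 'g \<Rightarrow> 'a" where
  "lam a b = \<tau> a b / \<tau> b a"

lemma lam_nz [simp]: "lam a b \<noteq> 0"
  by (simp add: lam_def)

lemma lam_self [simp]: "lam a a = 1"
  by (simp add: lam_def)

lemma lam_swap: "lam b a = inverse (lam a b)"
  by (simp add: lam_def)

lemma lam_0_right [simp]: "lam a 0 = 1"
  using tau_left_0[of a] tau_right_0[of a] by (simp add: lam_def)

text \<open>The cocycle identity for the triples (a, b, c), (b, c, a) and (b, a, c) expresses all
  values at sums through values that cancel in the quotient.\<close>

lemma lam_add_right: "lam a (b + c) = lam a b * lam a c"
proof -
  have 1: "\<tau> a (b + c) = \<tau> a b * \<tau> (a + b) c / \<tau> b c"
    using coc[of a b c] by (simp add: field_simps)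
  have 2: "\<tau> (b + c) a = \<tau> c a * \<tau> b (c + a) / \<tau> b c"
    using coc[of b c a] by (simp add: field_simps)
  have "\<tau> (a + b) c = \<tau> a c * \<tau> b (c + a) / \<tau> b a"
    using coc[of b a c] by (simp add: field_simps)
  then show ?thesis
    unfolding lam_def 1 2 by (simp add: field_simps)
qed

lemma lam_neg_right: "lam a (- b) = inverse (lam a b)"
  using lam_add_right[of a b "- b"] by (simp add: field_simps)

definition tors :: "'g \<Rightarrow> 'g \<Rightarrow> bool" where
  "tors a b \<longleftrightarrow> (\<exists>k>0. lam a b ^ k = 1)"

lemma tors_sym: "tors a b \<longleftrightarrow> tors b a"
  by (simp add: tors_def lam_swap[of a b] power_inverse)

lemma tors_self: "tors a a"
  by (auto simp: tors_def)

lemma tors_0: "tors a 0"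
  by (auto simp: tors_def)

lemma tors_add: "tors a b \<Longrightarrow> tors a c \<Longrightarrow> tors a (b + c)"
proof -
  assume "tors a b" "tors a c"
  then obtain k l where "k > 0" "lam a b ^ k = 1" "l > 0" "lam a c ^ l = 1"
    by (auto simp: tors_def)
  moreover have "lam a (b + c) ^ (k * l) = (lam a b ^ k) ^ l * (lam a c ^ l) ^ k"
    by (simp add: lam_add_right power_mult_distrib power_mult[symmetric] mult.commute)
  ultimately have "k * l > 0 \<and> lam a (b + c) ^ (k * l) = 1" by simp
  then show ?thesis unfolding tors_def by blast
qed

lemma tors_neg: "tors a b \<Longrightarrow> tors a (- b)"
  by (auto simp: tors_def lam_neg_right power_inverse)

end

section \<open>Rational subspaces and their integer points\<close>

text \<open>The ambient function space has infinite dimension, so finiteness of bases is always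
  drawn from a finite spanning set \<open>T\<close>.\<close>

lemma basis_in_finite_span:
  assumes "V \<subseteq> fs.span T" "finite T"
  shows "\<exists>B. B \<subseteq> V \<and> finite B \<and> fs.independent B \<and> V \<subseteq> fs.span B \<and> card B = fs.dim V"
proof -
  obtain B where B: "B \<subseteq> V" "fs.independent B" "V \<subseteq> fs.span B" "card B = fs.dim V"
    using fs.basis_exists[of V] by blast
  moreover have "finite B"
    using fs.independent_span_bound[of T B] assms B by blast
  ultimately show ?thesis by blast
qed

lemma independent_card_le_dim_fin:
  assumes "B \<subseteq> V" "fs.independent B" "V \<subseteq> fs.span T" "finite T"
  shows "finite B \<and> card B \<le> fs.dim V"
proof -
  obtain C where "C \<subseteq> V" "finite C" "fs.independent C" "V \<subseteq> fs.span C" "card C = fs.dim V"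
    using basis_in_finite_span[OF assms(3,4)] by blast
  then show ?thesis using fs.independent_span_bound[of C B] assms by auto
qed

lemma dim_strict_mono_fin:
  assumes "V \<subset> W" "fs.subspace V" "W \<subseteq> fs.span T" "finite T"
  shows "fs.dim V < fs.dim W"
proof -
  obtain B where B: "B \<subseteq> V" "finite B" "fs.independent B" "V \<subseteq> fs.span B" "card B = fs.dim V"
    using basis_in_finite_span[OF order_trans[OF psubset_imp_subset[OF assms(1)] assms(3)] assms(4)] by blast
  obtain w where w: "w \<in> W" "w \<notin> V" using assms by blast
  have "w \<notin> fs.span B" using w B(1) assms(2) fs.span_minimal by blast
  then have "fs.independent (insert w B)" and "w \<notin> B"
    using B fs.independent_insertI fs.span_base by blast+
  then show ?thesis
    using independent_card_le_dim_fin[of "insert w B" W T] assms B w psubset_imp_subset[OF assms(1)]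
    by (simp add: order_trans[of B V W])
qed

lemma complement_fin:
  assumes "B \<subseteq> V" "fs.subspace B" "fs.subspace V"
  obtains Q where "fs.subspace Q" "Q \<subseteq> V" "B \<inter> Q = {0}" "\<And>v. v \<in> V \<Longrightarrow> \<exists>b\<in>B. \<exists>q\<in>Q. v = b + q"
proof -
  obtain X where X: "X \<subseteq> B" "fs.independent X" "B \<subseteq> fs.span X"
    using fs.maximal_independent_subset[of B] by blast
  obtain Y where Y: "X \<subseteq> Y" "Y \<subseteq> V" "fs.independent Y" "V \<subseteq> fs.span Y"
    using fs.maximal_independent_subset_extend[of X V] X assms(1) by blast
  define Q where "Q = fs.span (Y - X)"
  have spanX: "fs.span X = B" using X assms by (metis fs.span_minimal subset_antisym)
  have "Y = X \<union> (Y - X)" using Y by blast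
  then have "fs.span Y = fs.span (X \<union> (Y - X))" by simp
  also have "\<dots> = {x + y | x y. x \<in> B \<and> y \<in> Q}"
    unfolding Q_def spanX[symmetric] by (rule fs.span_Un)
  finally have VY: "fs.span Y = {x + y | x y. x \<in> B \<and> y \<in> Q}" .
  have "x = 0" if x: "x \<in> B" "x \<in> Q" for x
  proof -
    have X': "fs.independent X" "fs.independent (Y - X)" using Y fs.independent_mono by blast+
    have 1: "x \<in> fs.span X" "x \<in> fs.span (Y - X)" using x spanX Q_def by auto
    \<comment> \<open>The unique coordinates of \<open>x\<close> over \<open>Y\<close> are supported
      in \<open>X\<close> as well as in \<open>Y - X\<close>, hence vanish.\<close>
    have "fs.representation Y x = fs.representation X x"
      using fs.representation_extend[OF Y(3) 1(1) Y(1)] .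
    moreover have "fs.representation Y x = fs.representation (Y - X) x"
      using fs.representation_extend[OF Y(3) 1(2)] by blast
    moreover have "fs.representation X x b = 0" if "b \<notin> X" for b
      using that fs.representation_ne_zero by blast
    moreover have "fs.representation (Y - X) x b = 0" if "b \<in> X" for b
      using that fs.representation_ne_zero by blast
    ultimately have "fs.representation X x b = 0" for b by metis
    then show ?thesis using fs.sum_nonzero_representation_eq[OF X'(1) 1(1)] by simp
  qed
  then have "B \<inter> Q = {0}" using assms(2) fs.subspace_0 Q_def fs.span_zero by blast
  moreover have "Q \<subseteq> V" unfolding Q_def using Y assms by (meson Diff_subset fs.span_minimal order_trans)
  ultimately show thesis using that[of Q] VY Y Q_def by blast
qed

definition vec :: "(nat \<Rightarrow> int) \<Rightarrow> nat \<Rightarrow> rat" where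
  "vec a = (\<lambda>i. of_int (a i))"

text \<open>Groups of all ranks live in one type, as functions vanishing from \<open>n\<close> on;
  this makes subgroups and subspaces plain sets and avoids transport in inductions on the
  rank.\<close>

definition Qn :: "nat \<Rightarrow> (nat \<Rightarrow> rat) set" where
  "Qn n = {u. \<forall>i\<ge>n. u i = 0}"

definition Zn :: "nat \<Rightarrow> (nat \<Rightarrow> int) set" where
  "Zn n = {a. \<forall>i\<ge>n. a i = 0}"

definition lat :: "(nat \<Rightarrow> rat) set \<Rightarrow> (nat \<Rightarrow> int) set" where
  "lat V = {a. vec a \<in> V}"

definition zs :: "int \<Rightarrow> (nat \<Rightarrow> int) \<Rightarrow> nat \<Rightarrow> int" where
  "zs m a = (\<lambda>i. m * a i)"

lemma vec_apply [simp]: "vec a i = of_int (a i)"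
  by (simp add: vec_def)

lemma vec_inj: "vec a = vec b \<longleftrightarrow> a = b"
  by (simp add: fun_eq_iff)

lemma vec_add: "vec (a + b) = vec a + vec b"
  and vec_diff: "vec (a - b) = vec a - vec b"
  and vec_zs: "vec (zs m a) = smul (of_int m) (vec a)"
  and vec_0 [simp]: "vec 0 = 0"
  by (auto simp: fun_eq_iff zs_def)

lemma zs_apply [simp]: "zs m a i = m * a i"
  by (simp add: zs_def)

lemma lat_Qn: "lat (Qn n) = Zn n"
  by (auto simp: lat_def Qn_def Zn_def)

lemma lat_mono: "V \<subseteq> W \<Longrightarrow> lat V \<subseteq> lat W"
  by (auto simp: lat_def)

lemma sub_lat: "fs.subspace V \<Longrightarrow> sub (lat V)"
  by (auto simp: sub_def lat_def vec_diff fs.subspace_0 fs.subspace_diff)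

lemma subspace_Qn: "fs.subspace (Qn n)"
  by (auto simp: fs.subspace_def Qn_def)

lemma sub_Zn: "sub (Zn n)"
  using sub_lat[OF subspace_Qn] by (simp add: lat_Qn)

lemma Qn_span: "Qn n \<subseteq> fs.span (ind ` {..<n})"
proof
  fix u :: "nat \<Rightarrow> rat" assume "u \<in> Qn n"
  then have "supp u \<subseteq> {..<n}" by (fastforce simp: Qn_def supp_def not_le[symmetric])
  then have "u = (\<Sum>a<n. smul (u a) (ind a))" by (intro eq_sum_ind) auto
  moreover have "(\<Sum>a<n. smul (u a) (ind a)) \<in> fs.span (ind ` {..<n})"
    by (intro fs.span_sum fs.span_scale fs.span_base) auto
  ultimately show "u \<in> fs.span (ind ` {..<n})" by simp
qed

lemma inj_ind: "inj_on (ind :: 'g \<Rightarrow> 'g \<Rightarrow> 'a::zero_neq_one) A"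
  by (metis inj_onI singleton_inject supp_ind)

lemma independent_ind:
  assumes "finite A"
  shows "fs.independent ((ind :: 'g \<Rightarrow> 'g \<Rightarrow> 'k::field) ` A)"
proof (rule fs.independent_if_scalars_zero)
  fix f :: "('g \<Rightarrow> 'k) \<Rightarrow> 'k" and x :: "'g \<Rightarrow> 'k"
  assume 0: "(\<Sum>x\<in>ind ` A. smul (f x) x) = 0" and "x \<in> ind ` A"
  then obtain a where a: "a \<in> A" "x = ind a" by blast
  have "0 = (\<Sum>b\<in>A. smul (f (ind b)) (ind b)) a"
    using 0 by (simp add: sum.reindex inj_ind)
  also have "\<dots> = (\<Sum>b\<in>A. if a = b then f (ind b) else 0)"
    by (auto simp: sum_apply ind_apply intro!: sum.cong)
  finally show "f x = 0" using a assms by simp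
qed (use assms in simp)

lemma clear_denominators:
  assumes "u \<in> Qn n"
  obtains m a where "m > (0::nat)" "a \<in> Zn n" "vec a = smul (of_nat m) u"
proof -
  have "\<exists>m>(0::nat). \<forall>i<k. of_nat m * u i \<in> \<int>" for k
  proof (induction k)
    case (Suc k)
    then obtain m where m: "m > (0::nat)" "\<forall>i<k. of_nat m * u i \<in> \<int>" by blast
    obtain p q where pq: "quotient_of (u k) = (p, q)" by force
    then have q: "q > 0" "u k = of_int p / of_int q"
      by (auto simp: quotient_of_denom_pos quotient_of_div)
    have "of_nat (m * nat q) * u i \<in> \<int>" if "i < Suc k" for i
    proof (cases "i = k")
      case True
      have "of_nat (m * nat q) * u k = of_int (int m * p)"
        using q by (simp add: field_simps)
      then show ?thesis using True Ints_of_int by metis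
    next
      case False
      have "of_nat (m * nat q) * u i = of_int q * (of_nat m * u i)" using q by simp
      moreover have "of_nat m * u i \<in> \<int>" using m False that by simp
      ultimately show ?thesis using Ints_mult Ints_of_int by metis
    qed
    moreover have "m * nat q > 0" using m q by simp
    ultimately show ?case by blast
  qed auto
  then obtain m where m: "m > (0::nat)" "\<forall>i<n. of_nat m * u i \<in> \<int>" by blast
  define a where "a = (\<lambda>i. \<lfloor>of_nat m * u i\<rfloor>)"
  have u0: "u i = 0" if "i \<ge> n" for i using that assms by (simp add: Qn_def)
  have "vec a i = smul (of_nat m) u i" for i
    using m u0[of i] by (cases "i < n") (auto simp: a_def elim!: Ints_cases)
  moreover have "a \<in> Zn n" using u0 by (auto simp: Zn_def a_def)
  ultimately show thesis using that m by blast
qed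

lemma span_vec_lat:
  assumes "fs.subspace V" "V \<subseteq> Qn n"
  shows "fs.span (vec ` lat V) = V"
proof
  show "fs.span (vec ` lat V) \<subseteq> V"
    using assms by (intro fs.span_minimal) (auto simp: lat_def)
  show "V \<subseteq> fs.span (vec ` lat V)"
  proof
    fix u assume u: "u \<in> V"
    then obtain m a where ma: "m > (0::nat)" "vec a = smul (of_nat m) u"
      using clear_denominators assms by blast
    then have "a \<in> lat V" using u assms by (simp add: lat_def fs.subspace_scale)
    then have "smul (inverse (of_nat m)) (vec a) \<in> fs.span (vec ` lat V)"
      by (intro fs.span_scale fs.span_base) auto
    then show "u \<in> fs.span (vec ` lat V)" using ma by simp
  qed
qed

text \<open>A maximal independent subset is taken among the integer vectors of \<open>V\<close>;
  these span \<open>V\<close> because denominators can be cleared.\<close>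

lemma integral_basis:
  assumes "fs.subspace V" "V \<subseteq> Qn n"
  obtains B where "B \<subseteq> lat V" "finite B" "fs.independent (vec ` B)" "V = fs.span (vec ` B)" "card B = fs.dim V"
proof -
  obtain X where X: "X \<subseteq> vec ` lat V" "fs.independent X" "vec ` lat V \<subseteq> fs.span X"
    using fs.maximal_independent_subset[of "vec ` lat V"] by blast
  obtain B where B: "B \<subseteq> lat V" "X = vec ` B" using X by (meson subset_image_iff)
  have V: "V = fs.span X"
    using span_vec_lat[OF assms] X by (metis fs.span_minimal fs.span_mono fs.subspace_span subset_antisym)
  have "finite X" 
    using fs.independent_span_bound[OF _ X(2), of "ind ` {..<n}"] V assms(2) Qn_span[of n] fs.span_superset[of X] by auto
  moreover have "inj_on vec B" by (simp add: inj_on_def vec_inj)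
  ultimately show thesis using that[of B] B X V fs.dim_span_eq_card_independent[OF X(2)]
    by (auto simp: card_image finite_image_iff)
qed

locale twistedZ = twisted \<tau> for \<tau> :: "(nat \<Rightarrow> int) \<Rightarrow> (nat \<Rightarrow> int) \<Rightarrow> 'a::field"
begin

lemma lam_zs: "lam a (zs (int k) b) = lam a b ^ k"
proof (induction k)
  case 0
  have "zs 0 b = 0" by (simp add: fun_eq_iff)
  then show ?case by (metis lam_0_right of_nat_0 power_0)
next
  case (Suc k)
  have "zs (int (Suc k)) b = zs (int k) b + b" by (simp add: fun_eq_iff algebra_simps)
  then have "lam a (zs (int (Suc k)) b) = lam a (zs (int k) b + b)" by (rule arg_cong)
  then show ?case by (simp only: lam_add_right Suc.IH power_Suc2)
qed

text \<open>Roots of unity are closed under powers and under extraction of roots, so torsion depends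
  only on the rational line through \<open>b\<close>. This is why it can be a property of rational
  subspaces.\<close>

lemma tors_zs_iff: 
  assumes "k > 0" 
  shows "tors a (zs (int k) b) \<longleftrightarrow> tors a b"
proof
  assume "tors a (zs (int k) b)"
  then obtain l where "l > 0" "lam a b ^ (k * l) = 1" by (auto simp: tors_def lam_zs power_mult)
  then have "k * l > 0 \<and> lam a b ^ (k * l) = 1" using assms by simp
  then show "tors a b" unfolding tors_def by blast
next
  assume "tors a b"
  then obtain l where "l > 0" "lam a b ^ l = 1" by (auto simp: tors_def)
  then have "l > 0 \<and> lam a (zs (int k) b) ^ l = 1"
    by (simp add: lam_zs power_mult[symmetric] mult.commute[of k]) (simp add: power_mult)
  then show "tors a (zs (int k) b)" unfolding tors_def by blast
qed

lemma tors_zs: "tors a b \<Longrightarrow> tors a (zs m b)"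
proof (cases m)
  case (nonneg k)
  assume "tors a b"
  moreover have "zs 0 b = 0" by (simp add: fun_eq_iff)
  ultimately show ?thesis using nonneg tors_zs_iff[of k] tors_0 by (cases "k = 0") auto
next
  case (neg k)
  assume "tors a b"
  then have "tors a (- zs (int (Suc k)) b)" using tors_zs_iff[of "Suc k"] tors_neg by blast
  moreover have "- zs (int (Suc k)) b = zs m b" unfolding neg by (simp add: fun_eq_iff algebra_simps)
  ultimately show ?thesis by simp
qed

definition torsub :: "(nat \<Rightarrow> rat) set \<Rightarrow> bool" where
  "torsub V \<longleftrightarrow> (\<forall>a\<in>lat V. \<forall>b\<in>lat V. tors a b)"

text \<open>The rational span of the exponents commuting with \<open>a\<close> up to torsion; that it is a subspace
  reduces torsion of a span to torsion of generators.\<close>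

definition tcl :: "(nat \<Rightarrow> int) \<Rightarrow> (nat \<Rightarrow> rat) set" where
  "tcl a = {u. \<exists>m>(0::nat). \<exists>b. vec b = smul (of_nat m) u \<and> tors a b}"

lemma subspace_tcl: "fs.subspace (tcl a)"
  unfolding fs.subspace_def
proof (intro conjI ballI allI)
  show "0 \<in> tcl a"
    unfolding tcl_def using tors_0[of a] by (auto intro!: exI[of _ "1::nat"] exI[of _ "0 :: nat \<Rightarrow> int"])
next
  fix u v assume "u \<in> tcl a" "v \<in> tcl a"
  then obtain m b m' b' where *: "m > (0::nat)" "vec b = smul (of_nat m) u" "tors a b"
    "m' > (0::nat)" "vec b' = smul (of_nat m') v" "tors a b'"
    unfolding tcl_def by auto
  have "vec (zs (int m') b + zs (int m) b') = smul (of_nat (m * m')) (u + v)"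
    by (simp add: vec_add vec_zs * ) (simp add: fun_eq_iff algebra_simps)
  moreover have "tors a (zs (int m') b + zs (int m) b')"
    by (simp add: tors_add tors_zs * )
  moreover have "m * m' > 0" using * by simp
  ultimately show "u + v \<in> tcl a" unfolding tcl_def by blast
next
  fix c u assume "u \<in> tcl a"
  then obtain m b where *: "m > (0::nat)" "vec b = smul (of_nat m) u" "tors a b"
    unfolding tcl_def by auto
  obtain p q where pq: "quotient_of c = (p, q)" by force
  then have q: "q > 0" "c = of_int p / of_int q"
    by (auto simp: quotient_of_denom_pos quotient_of_div)
  have "vec (zs p b) = smul (of_nat (m * nat q)) (smul c u)"
    using q by (simp add: vec_zs * )
  moreover have "m * nat q > 0" using * q by simp
  ultimately show "smul c u \<in> tcl a" unfolding tcl_def using tors_zs * by blast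
qed

lemma vec_in_tcl: "vec b \<in> tcl a \<longleftrightarrow> tors a b"
proof
  assume "vec b \<in> tcl a"
  then obtain m b' where *: "m > (0::nat)" "vec b' = smul (of_nat m) (vec b)" "tors a b'"
    unfolding tcl_def by auto
  then have "vec b' = vec (zs (int m) b)" by (simp add: vec_zs)
  then show "tors a b" using * tors_zs_iff by (simp add: vec_inj)
next
  assume "tors a b"
  moreover have "smul (of_nat 1) (vec b) = vec b" by simp
  ultimately show "vec b \<in> tcl a" unfolding tcl_def by (metis (mono_tags, lifting) mem_Collect_eq zero_less_one)
qed

text \<open>Torsion passes from generators to their span one argument at a time: first with the left
  argument in \<open>S\<close>, then, by symmetry, with it anywhere in the span.\<close>

lemma torsub_span:
  assumes "\<And>a b. a \<in> S \<Longrightarrow> b \<in> S \<Longrightarrow> tors a b"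
  shows "torsub (fs.span (vec ` S))"
proof -
  have 1: "tors a b" if "a \<in> S" "b \<in> lat (fs.span (vec ` S))" for a b
  proof -
    have "vec ` S \<subseteq> tcl a" using assms that by (auto simp: vec_in_tcl)
    from fs.span_minimal[OF this subspace_tcl] show ?thesis
      using that by (auto simp: lat_def vec_in_tcl[symmetric])
  qed
  have "tors b a" if "a \<in> lat (fs.span (vec ` S))" "b \<in> lat (fs.span (vec ` S))" for a b
  proof -
    have "vec ` S \<subseteq> tcl b" using 1 that tors_sym by (auto simp: vec_in_tcl)
    from fs.span_minimal[OF this subspace_tcl] show ?thesis
      using that by (auto simp: lat_def vec_in_tcl[symmetric])
  qed
  then show ?thesis by (auto simp: torsub_def)
qed

end

section \<open>Modules of finite dimension over F force torsion\<close>

lemma nontrivial_combination: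
  fixes \<phi> :: "'t \<Rightarrow> 's \<Rightarrow> 'k::field"
  assumes "finite T" "finite S" "card S < card T"
  shows "\<exists>c. (\<exists>t\<in>T. c t \<noteq> 0) \<and> (\<forall>s\<in>S. (\<Sum>t\<in>T. c t * \<phi> t s) = 0)"
proof -
  define \<psi> where "\<psi> t = (\<lambda>s. if s \<in> S then \<phi> t s else 0)" for t
  have \<psi>: "\<psi> t \<in> fs.span (ind ` S)" for t
  proof -
    have "\<psi> t = (\<Sum>s\<in>S. smul (\<psi> t s) (ind s))"
      by (rule eq_sum_ind) (use assms in \<open>auto simp: supp_def \<psi>_def\<close>)
    also have "\<dots> \<in> fs.span (ind ` S)"
      by (intro fs.span_sum fs.span_scale fs.span_base) auto
    finally show ?thesis .
  qed
  \<comment> \<open>Linear dependence is a notion for sets, so a repeated vector is treated apart: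
    it gives the relation with coefficients 1 and -1.\<close>
  show ?thesis
  proof (cases "inj_on \<psi> T")
    case True
    have "card (\<psi> ` T) > card ((ind :: 's \<Rightarrow> 's \<Rightarrow> 'k) ` S)"
      using assms card_image[OF True] card_image_le[of S "ind :: 's \<Rightarrow> 's \<Rightarrow> 'k"] by simp
    then have "fs.dependent (\<psi> ` T)"
      using fs.independent_span_bound[of "ind ` S" "\<psi> ` T"] \<psi> assms by fastforce
    then obtain u where u: "\<exists>v\<in>\<psi> ` T. u v \<noteq> 0" "(\<Sum>v\<in>\<psi> ` T. smul (u v) v) = 0"
      using fs.dependent_finite[of "\<psi> ` T"] assms by auto
    have "(\<Sum>t\<in>T. u (\<psi> t) * \<phi> t s) = 0" if "s \<in> S" for s
    proof -
      have "(\<Sum>t\<in>T. u (\<psi> t) * \<phi> t s) = (\<Sum>t\<in>T. smul (u (\<psi> t)) (\<psi> t)) s"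
        using that by (simp add: sum_apply \<psi>_def)
      also have "\<dots> = (\<Sum>v\<in>\<psi> ` T. smul (u v) v) s" by (simp only: sum.reindex[OF True] o_def)
      finally show ?thesis using u by simp
    qed
    then show ?thesis using u by (intro exI[of _ "\<lambda>t. u (\<psi> t)"]) auto
  next
    case False
    then obtain p q where pq: "p \<in> T" "q \<in> T" "p \<noteq> q" "\<psi> p = \<psi> q" by (auto simp: inj_on_def)
    define c where "c t = (if t = p then 1 else if t = q then - 1 else 0 :: 'k)" for t
    have "(\<Sum>t\<in>T. c t * \<phi> t s) = 0" if "s \<in> S" for s
    proof -
      have "(\<Sum>t\<in>T. c t * \<phi> t s) = (\<Sum>t\<in>{p, q}. c t * \<phi> t s)"
        by (rule sum.mono_neutral_right) (use assms pq in \<open>auto simp: c_def\<close>)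
      also have "\<dots> = 0" using pq(3) fun_cong[OF pq(4), of s] that by (simp add: c_def \<psi>_def)
      finally show ?thesis .
    qed
    then show ?thesis using pq by (intro exI[of _ c]) (auto simp: c_def)
  qed
qed

context twisted
begin

lemma mul_ind_left: "mul (ind g) r = (\<Sum>c\<in>supp r. smul (r c * \<tau> g c) (ind (g + c)))"
  by (simp add: mul_def rm_ind)

text \<open>Moving the basis element of \<open>a\<close> leftwards across \<open>r\<close>
  multiplies the coefficient at \<open>c\<close> by \<open>lam c a\<close>; then it merges with that
  of \<open>g - a\<close> into that of \<open>g\<close>. So an element annihilating a module may be
  rescaled in this way and still annihilates it.\<close>

lemma mul_conjugate:
  "mul (ind (g - a)) (rm r a) = smul (\<tau> (g - a) a) (mul (ind g) (\<lambda>c. lam c a * r c))"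
proof -
  have *: "\<tau> c a * \<tau> (g - a) (c + a) = \<tau> (g - a) a * lam c a * \<tau> g c" for c
    using coc[of "g - a" a c] by (simp add: lam_def field_simps)
  have "mul (ind (g - a)) (rm r a) =
      (\<Sum>c\<in>supp r. smul (rm r a (c + a) * \<tau> (g - a) (c + a)) (ind (g - a + (c + a))))"
    by (simp add: mul_ind_left supp_rm sum.reindex inj_on_def)
  also have "\<dots> = (\<Sum>c\<in>supp r. smul (\<tau> (g - a) a) (smul (lam c a * r c * \<tau> g c) (ind (g + c))))"
  proof (rule sum.cong)
    fix c
    have "rm r a (c + a) * \<tau> (g - a) (c + a) = \<tau> (g - a) a * (lam c a * r c * \<tau> g c)"
      using *[of c] by (simp add: rm_def mult.assoc)
    then show "smul (rm r a (c + a) * \<tau> (g - a) (c + a)) (ind (g - a + (c + a))) =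
        smul (\<tau> (g - a) a) (smul (lam c a * r c * \<tau> g c) (ind (g + c)))"
      by (simp add: algebra_simps)
  qed simp
  also have "\<dots> = smul (\<tau> (g - a) a) (mul (ind g) (\<lambda>c. lam c a * r c))"
  proof -
    have "supp (\<lambda>c. lam c a * r c) = supp r" by (auto simp: supp_def)
    then show ?thesis by (simp only: mul_ind_left fs.scale_sum_right)
  qed
  finally show ?thesis .
qed

lemma mul_sum_left: "mul (\<Sum>i\<in>A. smul (k i) (f i)) r = (\<Sum>i\<in>A. smul (k i) (mul (f i) r))"
  unfolding mul_def rm_sum rm_smul fs.scale_sum_right
  by (subst sum.swap) (simp add: mult.commute)

lemma mul_add_left: "mul (x + y) r = mul x r + mul y r"
  unfolding mul_def rm_add fs.scale_right_distrib sum.distrib by simp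

end

context twistedZ
begin

text \<open>The annihilator of a module of finite dimension contains a nonzero element supported on the
  multiples of \<open>b\<close>; conjugating one of minimal support by \<open>a\<close> produces a shorter one unless
  \<open>lam b a\<close> is a root of unity.\<close>

lemma tors_if_finite_codim:
  assumes G: "sub G" and I: "rideal G I" "I \<noteq> Alg G"
    and E: "finite E" "E \<subseteq> G" and red: "\<And>g. g \<in> G \<Longrightarrow> \<exists>y\<in>Alg E. ind g - y \<in> I"
    and a: "a \<in> G" and b: "b \<in> G"
  shows "tors b a"
proof (rule ccontr)
  assume not: "\<not> tors b a"
  define bk where "bk k = zs (int k) b" for k
  have bk0: "bk 0 = 0" and bkS: "bk (Suc k) = bk k + b" for k
    by (auto simp: bk_def fun_eq_iff algebra_simps)
  have bkG: "bk k \<in> G" for k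
  proof (induction k)
    case 0
    show ?case unfolding bk0 by (rule sub_0[OF G])
  next
    case (Suc k)
    then show ?case unfolding bkS using b by (blast intro: sub_add[OF G])
  qed
  have lambk: "lam (bk k) a = lam b a ^ k" for k
    using lam_zs[of a k b] by (simp add: bk_def lam_swap[of _ a] power_inverse)
  \<comment> \<open>Since \<open>lam b a\<close> is not a root of unity, conjugation by
    \<open>a\<close> tells all multiples of \<open>b\<close> apart.\<close>
  have lam_inj: "k = l" if "lam (bk k) a = lam (bk l) a" for k l
  proof (rule ccontr)
    assume "k \<noteq> l"
    have "lam b a ^ (max k l - min k l) = 1"
      using that by (auto simp: lambk max_def min_def power_diff)
    moreover have "max k l - min k l > 0" using \<open>k \<noteq> l\<close> by auto
    ultimately show False using not unfolding tors_def by blast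
  qed
  have bk_inj: "inj bk" using lam_inj by (metis injI)
  obtain nf where nf: "\<And>g. g \<in> G \<Longrightarrow> nf g \<in> Alg E \<and> ind g - nf g \<in> I"
    using red by metis
  \<comment> \<open>Annihilation of the whole quotient \<open>Alg G\<close> modulo \<open>I\<close>,
    not just of the class of the identity: only this is stable under conjugation.\<close>
  define Ann where "Ann r \<longleftrightarrow> r \<in> Alg (range bk) \<and> r \<noteq> 0 \<and> (\<forall>g\<in>G. mul (ind g) r \<in> I)" for r
  have AlgG: "r \<in> Alg G" if "r \<in> Alg (range bk)" for r :: "(nat \<Rightarrow> int) \<Rightarrow> 'a"
    using that bkG by (auto simp: Alg_def)
  have "\<exists>r. Ann r"
  proof -
    \<comment> \<open>Modulo \<open>I\<close>, right multiplication by the basis element of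
      \<open>bk k\<close> is represented on the span of \<open>E\<close> by a matrix with entries
      \<open>\<phi> k\<close>. One matrix more than there are entries forces a linear
      relation.\<close>
    define K where "K = {..card (E \<times> E)}"
    define \<phi> where "\<phi> k = (\<lambda>(e, e'). \<tau> e (bk k) * nf (e + bk k) e')" for k
    have "\<exists>c. (\<exists>k\<in>K. c k \<noteq> 0) \<and> (\<forall>s\<in>E \<times> E. (\<Sum>k\<in>K. c k * \<phi> k s) = 0)"
      by (rule nontrivial_combination) (use E in \<open>auto simp: K_def\<close>)
    then obtain c where c: "\<exists>k\<in>K. c k \<noteq> 0" "\<And>e e'. e \<in> E \<Longrightarrow> e' \<in> E \<Longrightarrow> (\<Sum>k\<in>K. c k * \<phi> k (e, e')) = 0"
      by auto
    define r where "r = (\<Sum>k\<in>K. smul (c k) (ind (bk k)))"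
    have rA: "r \<in> Alg (range bk)" unfolding r_def by (intro Alg_sum Alg_smul Alg_ind) auto
    have rbk: "r (bk k) = c k" if "k \<in> K" for k
    proof -
      have "r (bk k) = (\<Sum>l\<in>K. if k = l then c l else 0)"
        using bk_inj by (auto simp: r_def sum_apply ind_apply inj_eq intro!: sum.cong)
      then show ?thesis using that by (simp add: K_def)
    qed
    have r0: "r \<noteq> 0" using c(1) rbk by fastforce
    have supp_r: "supp r \<subseteq> bk ` K"
      by (fastforce simp: r_def supp_def sum_apply ind_apply intro!: sum.neutral)
    have E_in: "mul (ind e) r \<in> I" if e: "e \<in> E" for e
    proof -
      have eG: "e + bk k \<in> G" for k using e E bkG sub_add[OF G] by blast
      have "mul (ind e) r = (\<Sum>g\<in>bk ` K. smul (r g) (rm (ind e) g))"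
        by (rule mul_eq) (use supp_r in \<open>auto simp: K_def\<close>)
      also have "\<dots> = (\<Sum>k\<in>K. smul (c k * \<tau> e (bk k)) (ind (e + bk k)))"
        using inj_on_subset[OF bk_inj subset_UNIV, of K] by (simp add: sum.reindex rbk rm_ind)
      also have "\<dots> = (\<Sum>k\<in>K. smul (c k * \<tau> e (bk k)) (ind (e + bk k) - nf (e + bk k)))
          + (\<Sum>k\<in>K. smul (c k * \<tau> e (bk k)) (nf (e + bk k)))"
        unfolding sum.distrib[symmetric] by (rule sum.cong) (auto simp: fun_eq_iff algebra_simps)
      also have "(\<Sum>k\<in>K. smul (c k * \<tau> e (bk k)) (nf (e + bk k))) = 0"
      proof
        fix e'
        show "(\<Sum>k\<in>K. smul (c k * \<tau> e (bk k)) (nf (e + bk k))) e' = 0 e'"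
        proof (cases "e' \<in> E")
          case True
          then show ?thesis using c(2)[OF e, of e'] by (simp add: sum_apply \<phi>_def mult.assoc)
        next
          case False
          then have "nf (e + bk k) e' = 0" for k
            using nf[OF eG, of k] by (auto simp: Alg_def supp_def)
          then show ?thesis by (simp add: sum_apply)
        qed
      qed
      finally have "mul (ind e) r = (\<Sum>k\<in>K. smul (c k * \<tau> e (bk k)) (ind (e + bk k) - nf (e + bk k)))"
        by (simp only: add_0_right)
      also have "\<dots> \<in> I"
        using nf[OF eG] by (intro rideal_sum[OF I(1)] rideal_smul[OF I(1)]) auto
      finally show ?thesis .
    qed
    \<comment> \<open>From \<open>E\<close> to all of \<open>G\<close>: replacing
      \<open>ind g\<close> by its normal form changes the product by an element of the right
      ideal.\<close>
    have "mul (ind g) r \<in> I" if g: "g \<in> G" for g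
    proof -
      have "nf g = (\<Sum>e\<in>E. smul (nf g e) (ind e))"
        using nf[OF g] E by (intro eq_sum_ind) (auto simp: Alg_def)
      then have "mul (nf g) r = (\<Sum>e\<in>E. smul (nf g e) (mul (ind e) r))"
        using mul_sum_left by metis
      also have "\<dots> \<in> I" by (intro rideal_sum[OF I(1)] rideal_smul[OF I(1)] E_in)
      finally have 1: "mul (nf g) r \<in> I" .
      have 2: "mul (ind g - nf g) r \<in> I"
        using nf[OF g] AlgG[OF rA] mul_in_rideal[OF I(1)] by blast
      have "mul (ind g) r = mul (ind g - nf g) r + mul (nf g) r"
        using mul_add_left[of "ind g - nf g" "nf g" r] by simp
      then show ?thesis using rideal_add[OF I(1) 2 1] by simp
    qed
    then show ?thesis using rA r0 Ann_def by blast
  qed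
  then obtain r where r: "Ann r" and rmin: "\<And>s. Ann s \<Longrightarrow> card (supp r) \<le> card (supp s)"
    using ex_has_least_nat[of Ann _ "\<lambda>r. card (supp r)"] by blast
  have fin: "finite (supp r)" and supp_r: "supp r \<subseteq> range bk" and rA: "r \<in> Alg (range bk)"
    using r by (auto simp: Ann_def Alg_def)
  obtain c where c: "r c \<noteq> 0" using r by (auto simp: Ann_def fun_eq_iff)
  show False
  proof (cases "supp r = {c}")
    case True
    have "mul (ind 0) r = smul (r c * \<tau> 0 c) (ind c)" using True by (simp add: mul_ind_left)
    then have "ind c \<in> I" using r sub_0[OF G] rideal_smul_iff[OF I(1), of "r c * \<tau> 0 c" "ind c"] c
      unfolding Ann_def by fastforce
    then show False using rideal_eq_Alg[OF G I(1)] I(2) by blast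
  next
    case False
    then obtain d where d: "r d \<noteq> 0" "d \<noteq> c" using c by (auto simp: supp_def)
    \<comment> \<open>Conjugation scales the coefficient at \<open>g\<close> by
      \<open>lam g a\<close>; subtracting \<open>lam c a\<close> times \<open>r\<close> deletes
      \<open>c\<close> from the support and keeps \<open>d\<close>.\<close>
    define s where "s = (\<lambda>g. lam g a * r g) + smul (- lam c a) r"
    obtain k l where kl: "c = bk k" "d = bk l" using c d supp_r unfolding supp_def by blast
    then have "lam d a \<noteq> lam c a" using lam_inj d by blast
    then have s0: "s \<noteq> 0" using d by (auto simp: s_def fun_eq_iff)
    have supp_s: "supp s \<subseteq> supp r - {c}" by (auto simp: s_def supp_def)
    have sA: "s \<in> Alg (range bk)"
      using supp_s fin supp_r by (auto simp: Alg_def intro: finite_subset)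
    have rA': "(\<lambda>g. lam g a * r g) \<in> Alg G"
      using AlgG[OF rA] by (auto simp: Alg_def supp_def)
    have "mul (ind g) s \<in> I" if g: "g \<in> G" for g
    proof -
      have "mul (ind (g - a)) (rm r a) \<in> I"
        using mul_rm[OF AlgG[OF rA]] r g a by (simp add: Ann_def sub_diff[OF G] rideal_rm[OF I(1)])
      then have "mul (ind g) (\<lambda>g. lam g a * r g) \<in> I"
        unfolding mul_conjugate using rideal_smul_iff[OF I(1)] by simp
      moreover have "mul (ind g) (smul (- lam c a) r) \<in> I"
        unfolding mul_smul[OF AlgG[OF rA]] using r g by (intro rideal_smul[OF I(1)]) (simp add: Ann_def)
      ultimately show ?thesis
        unfolding s_def mul_add[OF rA' Alg_smul[OF AlgG[OF rA]]] by (rule rideal_add[OF I(1)])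
    qed
    then have "Ann s" using sA s0 by (simp add: Ann_def)
    then have "card (supp r) \<le> card (supp r - {c})"
      using rmin[of s] card_mono[OF _ supp_s] fin by auto
    moreover have "c \<in> supp r" using c by (simp add: supp_def)
    ultimately show False using fin by (metis card_Diff1_less leD)
  qed
qed

end

section \<open>Degeneration\<close>

lemma finite_Zn_box: "finite {a \<in> Zn n. \<forall>i<n. \<bar>a i\<bar> \<le> M}"
proof -
  have "{a \<in> Zn n. \<forall>i<n. \<bar>a i\<bar> \<le> M}
      \<subseteq> {f. \<forall>x. (x \<in> {..<n} \<longrightarrow> f x \<in> {- M..M}) \<and> (x \<notin> {..<n} \<longrightarrow> f x = 0)}"
    by (auto simp: Zn_def abs_le_iff)
  then show ?thesis
    by (rule finite_subset) (rule finite_set_of_finite_funs, auto)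
qed

text \<open>The squared Euclidean length is an integer, hence an induction measure, and it comes
  with an inner product from which the limiting weight is read off.\<close>

definition nrm :: "nat \<Rightarrow> (nat \<Rightarrow> int) \<Rightarrow> int" where
  "nrm n a = (\<Sum>i<n. (a i)\<^sup>2)"

lemma nrm_nonneg: "nrm n a \<ge> 0"
  by (simp add: nrm_def sum_nonneg)

lemma nrm_add: "nrm n (a + b) = nrm n a + 2 * (\<Sum>i<n. a i * b i) + nrm n b"
  by (simp add: nrm_def power2_sum sum.distrib sum_distrib_left mult.assoc)

lemma finite_nrm_le: "finite {a \<in> Zn n. nrm n a \<le> N}"
proof (rule finite_subset[OF _ finite_Zn_box[of n N]])
  have "\<bar>a i\<bar> \<le> N" if "nrm n a \<le> N" "i < n" for a i
  proof -
    have "\<bar>a i\<bar> \<le> (a i)\<^sup>2"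
      using self_le_power[of "\<bar>a i\<bar>" 2] by (cases "a i = 0") auto
    also have "\<dots> \<le> nrm n a" unfolding nrm_def by (rule member_le_sum) (use that in auto)
    finally show ?thesis using that by simp
  qed
  then show "{a \<in> Zn n. nrm n a \<le> N} \<subseteq> {a \<in> Zn n. \<forall>i<n. \<bar>a i\<bar> \<le> N}" by blast
qed

text \<open>Bolzano-Weierstrass, one coordinate at a time: each passage takes a monotone
  subsequence, which converges because it is bounded.\<close>

lemma bounded_seqs_convergent_subseq:
  fixes f :: "nat \<Rightarrow> nat \<Rightarrow> real"
  assumes "\<And>i k. \<bar>f k i\<bar> \<le> B"
  shows "\<exists>\<sigma> w. strict_mono (\<sigma> :: nat \<Rightarrow> nat) \<and> (\<forall>i<n. (\<lambda>k. f (\<sigma> k) i) \<longlonglongrightarrow> w i)"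
proof (induction n)
  case 0
  then show ?case using strict_mono_id by (auto simp: id_def)
next
  case (Suc n)
  then obtain \<sigma> w where \<sigma>: "strict_mono (\<sigma> :: nat \<Rightarrow> nat)" "\<forall>i<n. (\<lambda>k. f (\<sigma> k) i) \<longlonglongrightarrow> w i" by blast
  obtain \<rho> where \<rho>: "strict_mono \<rho>" "monoseq (\<lambda>k. f (\<sigma> (\<rho> k)) n)"
    using seq_monosub[of "\<lambda>k. f (\<sigma> k) n"] by auto
  have "Bseq (\<lambda>k. f (\<sigma> (\<rho> k)) n)" by (rule BseqI'[of _ B]) (use assms in simp)
  with \<rho> obtain l where l: "(\<lambda>k. f (\<sigma> (\<rho> k)) n) \<longlonglongrightarrow> l"
    using Bseq_monoseq_convergent convergent_def by blast
  have "(\<lambda>k. f ((\<sigma> \<circ> \<rho>) k) i) \<longlonglongrightarrow> (w(n := l)) i" if "i < Suc n" for i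
  proof (cases "i = n")
    case False
    then show ?thesis using \<sigma>(2) that LIMSEQ_subseq_LIMSEQ[OF _ \<rho>(1), of "\<lambda>k. f (\<sigma> k) i"] by (auto simp: o_def)
  qed (use l in simp)
  moreover have "strict_mono (\<sigma> \<circ> \<rho>)" using \<sigma> \<rho> by (simp add: strict_mono_o)
  ultimately show ?case by blast
qed

definition wd :: "nat \<Rightarrow> (nat \<Rightarrow> real) \<Rightarrow> (nat \<Rightarrow> rat) \<Rightarrow> real" where
  "wd n w u = (\<Sum>i<n. w i * of_rat (u i))"

lemma wd_add: "wd n w (u + v) = wd n w u + wd n w v"
  and wd_diff: "wd n w (u - v) = wd n w u - wd n w v"
  and wd_smul: "wd n w (smul c u) = of_rat c * wd n w u"
  and wd_0 [simp]: "wd n w 0 = 0"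
  by (simp_all add: wd_def of_rat_add of_rat_diff of_rat_mult algebra_simps sum.distrib sum_subtractf sum_distrib_left)

text \<open>\<open>w\<close> is a limit of the unit vectors -a(N)/|a(N)|. If it were orthogonal to
  all \<open>a N\<close>, it would be orthogonal to itself. For a shift \<open>b\<close> of positive
  weight the inner product of \<open>a N\<close> and \<open>b\<close> tends to minus infinity along
  the subsequence and outweighs the constant |b|^2 in |a(N)+b|^2; hence the minus sign in
  \<open>w\<close>.\<close>

lemma limit_direction:
  fixes a :: "nat \<Rightarrow> nat \<Rightarrow> int"
  assumes "\<And>N. nrm n (a N) > int N"
  obtains w where "\<And>V. (\<And>N. vec (a N) \<in> V) \<Longrightarrow> \<exists>v\<in>V. wd n w v \<noteq> 0"
    and "\<And>B. finite B \<Longrightarrow> (\<And>b. b \<in> B \<Longrightarrow> wd n w (vec b) > 0) \<Longrightarrow> \<exists>N. \<forall>b\<in>B. nrm n (a N + b) < nrm n (a N)"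
proof -
  define s where "s N = sqrt (real_of_int (nrm n (a N)))" for N
  have npos: "nrm n (a N) > 0" for N using assms[of N] by linarith
  have spos: "s N > 0" for N using npos by (simp add: s_def)
  have s2: "s N ^ 2 = real_of_int (nrm n (a N))" for N using nrm_nonneg by (simp add: s_def)
  define f where "f N i = (if i < n then - real_of_int (a N i) / s N else 0)" for N i
  have ssum: "s N ^ 2 = (\<Sum>i<n. (real_of_int (a N i))\<^sup>2)" for N
    unfolding s2 nrm_def by simp
  have "\<bar>f N i\<bar> \<le> 1" for N i
  proof (cases "i < n")
    case True
    have "(real_of_int (a N i))\<^sup>2 \<le> s N ^ 2"
      unfolding ssum by (rule member_le_sum) (use True in auto)
    then have "\<bar>real_of_int (a N i)\<bar> \<le> s N" using spos[of N] by (simp add: abs_le_square_iff[symmetric])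
    then show ?thesis using True spos[of N] by (simp add: f_def)
  qed (simp add: f_def)
  then obtain \<sigma> w where \<sigma>: "strict_mono \<sigma>" and w: "\<And>i. i < n \<Longrightarrow> (\<lambda>k. f (\<sigma> k) i) \<longlonglongrightarrow> w i"
    using bounded_seqs_convergent_subseq[of f 1 n] by blast
  have lim: "(\<lambda>k. \<Sum>i<n. f (\<sigma> k) i * g i) \<longlonglongrightarrow> (\<Sum>i<n. w i * g i)" for g
    by (intro tendsto_sum tendsto_mult tendsto_const w) auto
  have f2: "(\<Sum>i<n. f N i * f N i) = 1" for N
  proof -
    have "(\<Sum>i<n. f N i * f N i) = (\<Sum>i<n. (real_of_int (a N i))\<^sup>2) / s N ^ 2"
      by (simp add: f_def sum_divide_distrib power2_eq_square)
    then show ?thesis unfolding ssum[symmetric] using spos[of N] by simp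
  qed
  have "(\<lambda>k. \<Sum>i<n. f (\<sigma> k) i * f (\<sigma> k) i) \<longlonglongrightarrow> (\<Sum>i<n. w i * w i)"
    by (intro tendsto_sum tendsto_mult w) auto
  then have w1: "(\<Sum>i<n. w i * w i) = 1" unfolding f2 using LIMSEQ_unique tendsto_const by blast
  have s_lim: "filterlim (\<lambda>k. s (\<sigma> k)) at_top sequentially"
  proof -
    have "filterlim (\<lambda>k. sqrt (real k)) at_top sequentially"
      by (rule filterlim_compose[OF sqrt_at_top filterlim_real_sequentially])
    moreover have "sqrt (real k) \<le> s (\<sigma> k)" for k
    proof -
      have "k \<le> \<sigma> k" using \<sigma> by (rule strict_mono_imp_increasing)
      then have "int k \<le> nrm n (a (\<sigma> k))" using assms[of "\<sigma> k"] by linarith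
      then have "real k \<le> real_of_int (nrm n (a (\<sigma> k)))" by (metis of_int_le_iff of_int_of_nat_eq)
      then show ?thesis by (simp add: s_def)
    qed
    ultimately show ?thesis by (simp add: filterlim_at_top_mono)
  qed
  show thesis
  proof (rule that[of w])
    fix V assume V: "\<And>N. vec (a N) \<in> V"
    show "\<exists>v\<in>V. wd n w v \<noteq> 0"
    proof (rule ccontr)
      assume no: "\<not> ?thesis"
      have "(\<Sum>i<n. f N i * w i) = 0" for N
      proof -
        have "wd n w (vec (a N)) = 0" using no V by blast
        then have "(\<Sum>i<n. w i * real_of_int (a N i)) = 0" by (simp add: wd_def)
        moreover have "(\<Sum>i<n. f N i * w i) = - (\<Sum>i<n. w i * real_of_int (a N i)) / s N"
          by (simp add: f_def sum_divide_distrib sum_negf[symmetric] mult.commute)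
        ultimately show ?thesis by simp
      qed
      then have "(\<Sum>i<n. w i * w i) = 0" using lim[of w] by (simp add: LIMSEQ_const_iff)
      then show False using w1 by simp
    qed
  next
    fix B assume B: "finite B" "\<And>b. b \<in> B \<Longrightarrow> wd n w (vec b) > 0"
    have "eventually (\<lambda>k. nrm n (a (\<sigma> k) + b) < nrm n (a (\<sigma> k))) sequentially" if b: "b \<in> B" for b
    proof -
      let ?g = "wd n w (vec b)"
      have "(\<lambda>k. \<Sum>i<n. f (\<sigma> k) i * real_of_int (b i)) \<longlonglongrightarrow> ?g"
        using lim[of "\<lambda>i. real_of_int (b i)"] by (simp add: wd_def)
      \<comment> \<open>Half of the limit suffices: it makes \<open>- 2 * d\<close> exceed
        \<open>s * ?g\<close>, which in turn eventually exceeds \<open>nrm n b\<close>.\<close>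
      then have "eventually (\<lambda>k. (\<Sum>i<n. f (\<sigma> k) i * real_of_int (b i)) > ?g / 2) sequentially"
        by (rule order_tendstoD) (use B b in simp)
      moreover have "eventually (\<lambda>k. s (\<sigma> k) > real_of_int (nrm n b) / ?g) sequentially"
        using s_lim by (simp add: filterlim_at_top_dense)
      ultimately show ?thesis
      proof eventually_elim
        case (elim k)
        define t where "t = (\<Sum>i<n. f (\<sigma> k) i * real_of_int (b i))"
        define d where "d = (\<Sum>i<n. a (\<sigma> k) i * b i)"
        have st: "s (\<sigma> k) * t = - real_of_int d"
          unfolding t_def d_def
          using spos[of "\<sigma> k"] by (simp add: f_def sum_distrib_left sum_negf[symmetric] sum_divide_distrib)
        have "real_of_int (nrm n b) < s (\<sigma> k) * ?g" using elim B b by (simp add: field_simps)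
        also have "\<dots> < s (\<sigma> k) * (2 * t)" using elim(1) spos unfolding t_def[symmetric] by simp
        also have "\<dots> = - 2 * real_of_int d" using st by linarith
        finally have "nrm n b < - 2 * d" by linarith
        then show ?case by (simp add: nrm_add d_def)
      qed
    qed
    then have "eventually (\<lambda>k. \<forall>b\<in>B. nrm n (a (\<sigma> k) + b) < nrm n (a (\<sigma> k))) sequentially"
      using B(1) by (simp add: eventually_ball_finite)
    then show "\<exists>N. \<forall>b\<in>B. nrm n (a N + b) < nrm n (a N)"
      by (auto simp: eventually_sequentially)
  qed
qed

context twistedZ
begin

text \<open>The hypothesis on \<open>C\<close> and \<open>T\<close> says that \<open>I\<close> meets
  \<open>F * C\<close> for every \<open>C\<close> of codimension below \<open>r\<close> in
  \<open>V\<close>. If norms can be reduced modulo \<open>I\<close> outside a ball, finitely many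
  exponents span the quotient and \<open>V\<close> itself is torsion. Otherwise irreducible
  exponents escape to infinity, and their limiting direction is the weight of the
  degeneration.\<close>

theorem degeneration:
  assumes "fs.subspace V" "V \<subseteq> Qn n" "rideal (lat V) I" "I \<noteq> Alg (lat V)"
    and "\<And>C T. fs.subspace C \<Longrightarrow> C \<subseteq> V \<Longrightarrow> finite T \<Longrightarrow> card T < r \<Longrightarrow> V \<subseteq> fs.span (C \<union> T) \<Longrightarrow>
      \<exists>x\<in>I. x \<noteq> 0 \<and> supp x \<subseteq> lat C"
  shows "\<exists>W. fs.subspace W \<and> W \<subseteq> V \<and> r \<le> fs.dim W \<and> torsub W"
  using assms
proof (induction "fs.dim V" arbitrary: V I rule: less_induct)
  case less
  note V = less.prems(1,2) and I = less.prems(3,4) and P = less.prems(5)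
  have G: "sub (lat V)" using V sub_lat by blast
  have GZ: "lat V \<subseteq> Zn n" using V lat_mono lat_Qn by metis
  have fin_span: "V \<subseteq> fs.span (ind ` {..<n})" using V Qn_span by blast
  \<comment> \<open>\<open>a\<close> is reducible if some element of \<open>I\<close> has
    \<open>a\<close> as its strictly longest exponent, so that modulo \<open>I\<close> the basis
    element of \<open>a\<close> is a combination of shorter ones.\<close>
  define red where "red a \<longleftrightarrow> (\<exists>x\<in>I. x a \<noteq> 0 \<and> (\<forall>c\<in>supp x. c \<noteq> a \<longrightarrow> nrm n c < nrm n a))" for a
  show ?case
  proof (cases "\<exists>N. \<forall>a\<in>lat V. nrm n a > int N \<longrightarrow> red a")
    case True
    then obtain N where N: "\<And>a. a \<in> lat V \<Longrightarrow> nrm n a > int N \<Longrightarrow> red a" by blast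
    define E where "E = {a \<in> lat V. nrm n a \<le> int N}"
    have E: "finite E" "E \<subseteq> lat V"
      unfolding E_def using GZ by (auto intro: finite_subset[OF _ finite_nrm_le[of n "int N"]])
    have nf: "\<exists>y\<in>Alg E. ind g - y \<in> I" if "g \<in> lat V" for g
      using that
    proof (induction "nat (nrm n g)" arbitrary: g rule: less_induct)
      case (less g)
      show ?case
      proof (cases "nrm n g \<le> int N")
        case True
        have "ind g - ind g \<in> I" using rideal_0[OF I(1)] by simp
        moreover have "(ind g :: _ \<Rightarrow> 'a) \<in> Alg E" by (rule Alg_ind) (use True less in \<open>simp add: E_def\<close>)
        ultimately show ?thesis by blast
      next
        case False
        then obtain x where x: "x \<in> I" "x g \<noteq> 0" "\<And>c. c \<in> supp x \<Longrightarrow> c \<noteq> g \<Longrightarrow> nrm n c < nrm n g"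
          using N[OF less.prems] unfolding red_def by auto
        have xA: "finite (supp x)" "supp x \<subseteq> lat V" using rideal_Alg[OF I(1) x(1)] by (auto simp: Alg_def)
        define S where "S = supp x - {g}"
        have "\<exists>y\<in>Alg E. ind c - y \<in> I" if "c \<in> S" for c
        proof (rule less.hyps)
          show "nat (nrm n c) < nat (nrm n g)"
            using x(3)[of c] that nrm_nonneg[of n c] by (auto simp: S_def)
        qed (use that xA in \<open>auto simp: S_def\<close>)
        then obtain y where y: "\<And>c. c \<in> S \<Longrightarrow> y c \<in> Alg E \<and> ind c - y c \<in> I" by metis
        define z where "z = (\<Sum>c\<in>S. smul (- x c / x g) (y c))"
        have zE: "z \<in> Alg E" unfolding z_def using y by (blast intro: Alg_sum Alg_smul)
        have "x = (\<Sum>c\<in>supp x. smul (x c) (ind c))" using xA by (intro eq_sum_ind) auto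
        also have "\<dots> = smul (x g) (ind g) + (\<Sum>c\<in>S. smul (x c) (ind c))"
          unfolding S_def using xA x(2) by (subst sum.remove[of _ g]) (auto simp: supp_def)
        finally have xeq: "smul (inverse (x g)) x = ind g + (\<Sum>c\<in>S. smul (x c / x g) (ind c))"
        proof -
          assume e: "x = smul (x g) (ind g) + (\<Sum>c\<in>S. smul (x c) (ind c))"
          have "smul (inverse (x g)) x = smul (inverse (x g)) (smul (x g) (ind g) + (\<Sum>c\<in>S. smul (x c) (ind c)))"
            using e by (rule arg_cong)
          also have "\<dots> = ind g + (\<Sum>c\<in>S. smul (x c / x g) (ind c))"
            using x(2) by (simp add: fs.scale_right_distrib fs.scale_sum_right divide_inverse mult.commute)
          finally show ?thesis .
        qed
        have "ind g - z = smul (inverse (x g)) x - (\<Sum>c\<in>S. smul (x c / x g) (ind c - y c))"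
          unfolding xeq z_def
          by (simp add: fun_eq_iff sum_apply sum_subtractf right_diff_distrib sum_negf)
        also have "\<dots> \<in> I"
          by (rule rideal_diff[OF I(1) rideal_smul[OF I(1) x(1)]],
              rule rideal_sum[OF I(1)], rule rideal_smul[OF I(1)]) (use y in blast)
        finally show ?thesis using zE by blast
      qed
    qed
    have "torsub V"
      unfolding torsub_def using tors_if_finite_codim[OF G I E nf] by blast
    \<comment> \<open>Otherwise \<open>C = {0}\<close> is admissible and \<open>I\<close> contains a
      nonzero multiple of the unit \<open>ind 0\<close>.\<close>
    moreover have "r \<le> fs.dim V"
    proof (rule ccontr)
      assume "\<not> r \<le> fs.dim V"
      moreover obtain T where T: "finite T" "V \<subseteq> fs.span T" "card T = fs.dim V"
        using basis_in_finite_span[OF fin_span] by auto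
      moreover have "V \<subseteq> fs.span ({0} \<union> T)" using T by simp
      ultimately obtain x where x: "x \<in> I" "x \<noteq> 0" "supp x \<subseteq> lat {0}"
        using P[of "{0}" T] V fs.subspace_0 by auto
      have "lat {0} = {0}" using vec_inj[of _ 0] by (auto simp: lat_def)
      then have "x = (\<Sum>a\<in>{0}. smul (x a) (ind a))" using x by (intro eq_sum_ind) auto
      then have x0: "x = smul (x 0) (ind 0)" by simp
      have "x 0 \<noteq> 0"
      proof
        assume z: "x 0 = 0"
        have "x c = 0" for c using fun_cong[OF x0, of c] z by simp
        then show False using x(2) by (simp add: fun_eq_iff)
      qed
      then have "ind 0 \<in> I" using x0 x(1) rideal_smul_iff[OF I(1)] by metis
      then show False using rideal_eq_Alg[OF G I(1)] I(2) by blast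
    qed
    ultimately show ?thesis using V by blast
  next
    case False
    then have "\<forall>N. \<exists>a. a \<in> lat V \<and> nrm n a > int N \<and> \<not> red a" by blast
    then obtain a where a: "\<And>N. a N \<in> lat V" "\<And>N. nrm n (a N) > int N" "\<And>N. \<not> red (a N)" by metis
    obtain w where w1: "\<And>V. (\<And>N. vec (a N) \<in> V) \<Longrightarrow> \<exists>v\<in>V. wd n w v \<noteq> 0"
      and w2: "\<And>B. finite B \<Longrightarrow> (\<And>b. b \<in> B \<Longrightarrow> wd n w (vec b) > 0) \<Longrightarrow> \<exists>N. \<forall>b\<in>B. nrm n (a N + b) < nrm n (a N)"
      using limit_direction[of n a] a(2) by blast
    \<comment> \<open>The weight is real, so its rational kernel \<open>B\<close> may have
      codimension greater than one; only \<open>B\<close> being a proper subspace matters for the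
      induction.\<close>
    define B where "B = {u \<in> V. wd n w u = 0}"
    have sB: "fs.subspace B" unfolding B_def fs.subspace_def
      using V(1) by (auto simp: wd_add wd_smul fs.subspace_0 fs.subspace_add fs.subspace_scale)
    have "\<exists>v\<in>V. wd n w v \<noteq> 0" by (rule w1) (use a(1) in \<open>simp add: lat_def\<close>)
    then have BV: "B \<subset> V" by (auto simp: B_def)
    have dimB: "fs.dim B < fs.dim V" by (rule dim_strict_mono_fin[OF BV sB fin_span]) simp
    have G': "sub (lat B)" using sB by (rule sub_lat)
    have latB: "c \<in> lat B \<longleftrightarrow> c \<in> lat V \<and> wd n w (vec c) = 0" for c by (auto simp: lat_def B_def)
    txt \<open>\<open>I'\<close> is the degree zero part of the initial ideal of \<open>I\<close> for the weight \<open>w\<close>.\<close>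
    define I' where "I' = {y \<in> Alg (lat B). \<exists>x\<in>I. \<forall>c. wd n w (vec c) \<le> 0 \<longrightarrow> x c = y c}"
    have I': "rideal (lat B) I'"
      unfolding rideal_def
    proof (intro conjI ballI allI)
      show "I' \<subseteq> Alg (lat B)" by (auto simp: I'_def)
      show "0 \<in> I'" unfolding I'_def using rideal_0[OF I(1)] by (auto intro!: bexI[of _ 0])
    next
      fix y y' assume "y \<in> I'" "y' \<in> I'"
      then obtain x x' where "y \<in> Alg (lat B)" "y' \<in> Alg (lat B)" "x \<in> I" "x' \<in> I"
        "\<forall>c. wd n w (vec c) \<le> 0 \<longrightarrow> x c = y c" "\<forall>c. wd n w (vec c) \<le> 0 \<longrightarrow> x' c = y' c"
        by (auto simp: I'_def)
      then have "y + y' \<in> Alg (lat B) \<and> x + x' \<in> I \<and> (\<forall>c. wd n w (vec c) \<le> 0 \<longrightarrow> (x + x') c = (y + y') c)"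
        using rideal_add[OF I(1)] by (auto intro: Alg_add)
      then show "y + y' \<in> I'" unfolding I'_def by blast
    next
      fix y k assume "y \<in> I'"
      then obtain x where "y \<in> Alg (lat B)" "x \<in> I" "\<forall>c. wd n w (vec c) \<le> 0 \<longrightarrow> x c = y c"
        by (auto simp: I'_def)
      then have "smul k y \<in> Alg (lat B) \<and> smul k x \<in> I \<and> (\<forall>c. wd n w (vec c) \<le> 0 \<longrightarrow> smul k x c = smul k y c)"
        using rideal_smul[OF I(1)] by (auto intro: Alg_smul)
      then show "smul k y \<in> I'" unfolding I'_def by blast
    next
      fix y b assume "y \<in> I'" and b: "b \<in> lat B"
      then obtain x where x: "y \<in> Alg (lat B)" "x \<in> I" "\<forall>c. wd n w (vec c) \<le> 0 \<longrightarrow> x c = y c"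
        by (auto simp: I'_def)
      have "rm x b c = rm y b c" if "wd n w (vec c) \<le> 0" for c
        using x(3) b that by (simp add: rm_def latB vec_diff wd_diff)
      then have "rm y b \<in> Alg (lat B) \<and> rm x b \<in> I \<and> (\<forall>c. wd n w (vec c) \<le> 0 \<longrightarrow> rm x b c = rm y b c)"
        using x b Alg_rm[OF G'] rideal_rm[OF I(1)] latB by blast
      then show "rm y b \<in> I'" unfolding I'_def by blast
    qed
    \<comment> \<open>If 1 were an initial form, some \<open>x\<close> in \<open>I\<close> would be
      1 plus terms of positive weight. Translating by a suitable \<open>a N\<close> shortens all
      those terms and makes \<open>a N\<close> reducible.\<close>
    have "I' \<noteq> Alg (lat B)"
    proof
      assume "I' = Alg (lat B)"
      then have "ind 0 \<in> I'" using Alg_ind[OF sub_0[OF G']] by blast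
      then obtain x where x: "x \<in> I" "\<And>c. wd n w (vec c) \<le> 0 \<Longrightarrow> x c = ind 0 c"
        by (auto simp: I'_def)
      have finx: "finite (supp x)" using rideal_Alg[OF I(1) x(1)] by (auto simp: Alg_def)
      have x0: "x 0 = 1" using x(2)[of 0] by (simp add: ind_apply)
      have "wd n w (vec b) > 0" if "b \<in> supp x - {0}" for b
        by (rule ccontr) (use x(2)[of b] that in \<open>auto simp: supp_def ind_apply\<close>)
      then obtain N where N: "\<forall>b\<in>supp x - {0}. nrm n (a N + b) < nrm n (a N)"
        using w2[of "supp x - {0}"] finx by blast
      have "red (a N)"
        unfolding red_def
      proof (intro bexI[of _ "rm x (a N)"] conjI ballI impI)
        show "rm x (a N) \<in> I" using rideal_rm[OF I(1) x(1) a(1)] .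
        show "rm x (a N) (a N) \<noteq> 0" by (simp add: rm_def x0)
      next
        fix c assume "c \<in> supp (rm x (a N))" "c \<noteq> a N"
        then obtain b where "b \<in> supp x - {0}" "c = a N + b" by (auto simp: supp_rm add.commute)
        then show "nrm n c < nrm n (a N)" using N by blast
      qed
      then show False using a(3) by blast
    qed
    moreover have "\<exists>y\<in>I'. y \<noteq> 0 \<and> supp y \<subseteq> lat C"
      if C: "fs.subspace C" "C \<subseteq> B" "finite T" "card T < r" "B \<subseteq> fs.span (C \<union> T)" for C T
    proof -
      \<comment> \<open>Adding a complement of \<open>B\<close> to \<open>C\<close> keeps the
        codimension, so the hypothesis on \<open>I\<close> applies to \<open>C'\<close>;
        intersecting with \<open>B\<close> gives back \<open>C\<close>.\<close>
      obtain Q where Q: "fs.subspace Q" "Q \<subseteq> V" "B \<inter> Q = {0}" "\<And>v. v \<in> V \<Longrightarrow> \<exists>b\<in>B. \<exists>q\<in>Q. v = b + q"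
        using complement_fin[OF psubset_imp_subset[OF BV] sB V(1)] by blast
      define C' where "C' = fs.span (C \<union> Q)"
      have C'V: "C' \<subseteq> V" unfolding C'_def using C Q BV V by (intro fs.span_minimal) auto
      have C'eq: "C' = {x + y | x y. x \<in> C \<and> y \<in> Q}"
      proof -
        have "fs.span C = C" "fs.span Q = Q" using C(1) Q(1) by simp_all
        then show ?thesis by (simp only: C'_def fs.span_Un)
      qed
      have C'B: "u \<in> C" if uC: "u \<in> C'" "u \<in> B" for u
      proof -
        obtain c q where cq: "u = c + q" "c \<in> C" "q \<in> Q" using uC C'eq by blast
        then have "q \<in> B" using fs.subspace_diff[OF sB \<open>u \<in> B\<close>, of c] C by auto
        then have "q = 0" using cq(3) Q(3) by blast
        then show ?thesis using cq by simp
      qed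
      have "V \<subseteq> fs.span (C' \<union> T)"
      proof
        fix v assume "v \<in> V"
        from Q(4)[OF this] obtain b q where bq: "b \<in> B" "q \<in> Q" "v = b + q" by blast
        have sub: "C \<union> Q \<subseteq> C'" unfolding C'_def by (rule fs.span_superset)
        then have "fs.span (C \<union> T) \<subseteq> fs.span (C' \<union> T)" by (intro fs.span_mono) blast
        then have "b \<in> fs.span (C' \<union> T)" using bq(1) C(5) by blast
        moreover have "q \<in> fs.span (C' \<union> T)" using bq(2) sub by (intro fs.span_base) blast
        ultimately show "v \<in> fs.span (C' \<union> T)" unfolding bq(3) by (rule fs.span_add)
      qed
      moreover have sC': "fs.subspace C'" by (simp add: C'_def)
      ultimately obtain f where f: "f \<in> I" "f \<noteq> 0" "supp f \<subseteq> lat C'" using P C'V C by blast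
      have finf: "finite (supp f)" using rideal_Alg[OF I(1) f(1)] by (auto simp: Alg_def)
      have "supp f \<noteq> {}" using f(2) by (auto simp: supp_def fun_eq_iff)
      then obtain c0 where c0: "c0 \<in> supp f" "\<And>c. c \<in> supp f \<Longrightarrow> wd n w (vec c0) \<le> wd n w (vec c)"
        using finf arg_min_least[of "supp f" _ "\<lambda>c. wd n w (vec c)"] arg_min_if_finite(1)[of "supp f" "\<lambda>c. wd n w (vec c)"]
        by blast
      \<comment> \<open>Translating an exponent of least weight to 0 makes all weights nonnegative;
        the weight-zero part \<open>y\<close> is then the initial form, nonzero at 0.\<close>
      define x where "x = rm f (- c0)"
      define y where "y = (\<lambda>c. if wd n w (vec c) \<le> 0 then x c else 0)"
      have c0V: "c0 \<in> lat V" using c0 f C'V lat_mono by blast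
      have xI: "x \<in> I" unfolding x_def by (rule rideal_rm[OF I(1) f(1)]) (rule sub_neg[OF G c0V])
      have y0: "y 0 \<noteq> 0" using c0(1) by (simp add: y_def x_def rm_def supp_def)
      have y_supp: "c \<in> lat C \<and> c \<in> lat B" if "c \<in> supp y" for c
      proof -
        have le: "wd n w (vec c) \<le> 0" and "c \<in> supp x" using that by (auto simp: y_def supp_def split: if_splits)
        then obtain c' where c': "c' \<in> supp f" "c = c' - c0" by (auto simp: x_def supp_rm)
        have "wd n w (vec c) \<ge> 0" using c0(2)[OF c'(1)] c'(2) by (simp add: vec_diff wd_diff)
        then have 0: "wd n w (vec c) = 0" using le by simp
        have "c \<in> lat C'" using c' c0 f sub_diff[OF sub_lat[OF sC']] by blast
        then have "c \<in> lat B" using 0 C'V lat_mono latB by blast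
        then show ?thesis using C'B \<open>c \<in> lat C'\<close> by (simp add: lat_def)
      qed
      have "supp y \<subseteq> supp x" by (auto simp: y_def supp_def)
      then have "y \<in> Alg (lat B)"
        using rideal_Alg[OF I(1) xI] y_supp by (auto simp: Alg_def intro: finite_subset)
      then have "y \<in> I'" unfolding I'_def using xI by (auto simp: y_def)
      moreover have "y \<noteq> 0" using y0 by auto
      ultimately show ?thesis using y_supp by blast
    qed
    ultimately have "\<exists>W. fs.subspace W \<and> W \<subseteq> B \<and> r \<le> fs.dim W \<and> torsub W"
      using less.hyps[OF dimB sB _ I'] V BV by blast
    then show ?thesis using BV by blast
  qed
qed

end

section \<open>Growth of differences of up-sets\<close>

definition Nn :: "nat \<Rightarrow> (nat \<Rightarrow> int) set" where
  "Nn n = {a \<in> Zn n. \<forall>i. 0 \<le> a i}"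

definition deg :: "nat \<Rightarrow> (nat \<Rightarrow> int) \<Rightarrow> int" where
  "deg n a = (\<Sum>i<n. a i)"

definition Dn :: "nat \<Rightarrow> nat \<Rightarrow> (nat \<Rightarrow> int) set" where
  "Dn n N = {a \<in> Nn n. deg n a \<le> int N}"

definition upset :: "nat \<Rightarrow> (nat \<Rightarrow> int) set \<Rightarrow> bool" where
  "upset n U \<longleftrightarrow> U \<subseteq> Nn n \<and> (\<forall>p\<in>U. \<forall>q\<in>Nn n. (\<forall>i. p i \<le> q i) \<longrightarrow> q \<in> U)"

lemma upsetD: "upset n U \<Longrightarrow> p \<in> U \<Longrightarrow> q \<in> Nn n \<Longrightarrow> (\<And>i. p i \<le> q i) \<Longrightarrow> q \<in> U"
  by (simp add: upset_def)

definition cone :: "nat \<Rightarrow> (nat \<Rightarrow> int) \<Rightarrow> nat set \<Rightarrow> (nat \<Rightarrow> int) set" where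
  "cone n p T = {q \<in> Nn n. (\<forall>i. p i \<le> q i) \<and> (\<forall>i. i \<notin> T \<longrightarrow> q i = p i)}"

definition has_cone :: "nat \<Rightarrow> nat \<Rightarrow> (nat \<Rightarrow> int) set \<Rightarrow> bool" where
  "has_cone n m X \<longleftrightarrow> (\<exists>p\<in>Nn n. \<exists>T\<subseteq>{..<n}. card T = m \<and> cone n p T \<subseteq> X)"

lemma Dn_coord: "a \<in> Dn n N \<Longrightarrow> a i \<le> int N"
proof (cases "i < n")
  case True
  assume a: "a \<in> Dn n N"
  have "a i \<le> deg n a" unfolding deg_def
    by (rule member_le_sum) (use a True in \<open>auto simp: Dn_def Nn_def\<close>)
  then show ?thesis using a by (simp add: Dn_def)
qed (simp add: Dn_def Nn_def Zn_def)

lemma inj_on_restrict_Nn: "inj_on (\<lambda>a. restrict a {..<n}) (Nn n)"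
proof (rule inj_onI)
  fix a b assume *: "a \<in> Nn n" "b \<in> Nn n" "restrict a {..<n} = restrict b {..<n}"
  show "a = b"
  proof
    fix i
    show "a i = b i"
      using *(1,2) fun_cong[OF *(3), of i] by (cases "i < n") (auto simp: Nn_def Zn_def)
  qed
qed

lemma card_box_le:
  assumes "X \<subseteq> Nn n" "\<And>a i. a \<in> X \<Longrightarrow> i < n \<Longrightarrow> a i < int (M i)"
  shows "finite X \<and> card X \<le> (\<Prod>i<n. M i)"
proof -
  let ?P = "PiE {..<n} (\<lambda>i. {0..<int (M i)})"
  have inj: "inj_on (\<lambda>a. restrict a {..<n}) X" using inj_on_restrict_Nn assms(1) by (rule inj_on_subset)
  have sub: "(\<lambda>a. restrict a {..<n}) ` X \<subseteq> ?P"
  proof (rule image_subsetI)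
    fix a assume a: "a \<in> X"
    then have "a \<in> Nn n" using assms(1) by blast
    then show "restrict a {..<n} \<in> ?P" using assms(2)[OF a] by (simp add: restrict_PiE_iff Nn_def)
  qed
  have fin: "finite ?P" by (intro finite_PiE) auto
  have "card ?P = (\<Prod>i<n. M i)" by (simp add: card_PiE)
  then show ?thesis
    using card_inj_on_le[OF inj sub fin] inj_on_finite[OF inj sub fin] by simp
qed

lemma finite_Dn: "finite (Dn n N)" and card_Dn_le: "card (Dn n N) \<le> (N + 1) ^ n"
proof -
  have "finite (Dn n N) \<and> card (Dn n N) \<le> (\<Prod>i<n. N + 1)"
  proof (rule card_box_le)
    show "Dn n N \<subseteq> Nn n" by (auto simp: Dn_def)
    show "a i < int (N + 1)" if "a \<in> Dn n N" for a i using Dn_coord[OF that, of i] by simp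
  qed
  then show "finite (Dn n N)" "card (Dn n N) \<le> (N + 1) ^ n" by auto
qed

lemma mono_subseq_nat:
  fixes f :: "nat \<Rightarrow> int"
  assumes "\<And>k. 0 \<le> f k"
  shows "\<exists>\<sigma>. strict_mono (\<sigma> :: nat \<Rightarrow> nat) \<and> mono (\<lambda>k. f (\<sigma> k))"
proof -
  obtain \<sigma> :: "nat \<Rightarrow> nat" where \<sigma>: "strict_mono \<sigma>" "monoseq (\<lambda>k. f (\<sigma> k))"
    using seq_monosub[of f] by auto
  show ?thesis
  proof (cases "mono (\<lambda>k. f (\<sigma> k))")
    case True
    then show ?thesis using \<sigma> by blast
  next
    case False
    then have dec: "f (\<sigma> l) \<le> f (\<sigma> k)" if "k \<le> l" for k l
      using \<sigma>(2) that by (auto simp: monoseq_def mono_def)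
    obtain N where N: "\<And>k. nat (f (\<sigma> N)) \<le> nat (f (\<sigma> k))"
      using ex_has_least_nat[of "\<lambda>_. True" 0 "\<lambda>k. nat (f (\<sigma> k))"] by auto
    have "f (\<sigma> (N + k)) = f (\<sigma> N)" for k
      using dec[of N "N + k"] N[of "N + k"] assms[of "\<sigma> N"] assms[of "\<sigma> (N + k)"] by simp
    moreover have "strict_mono (\<lambda>k. \<sigma> (N + k))" using \<sigma>(1) by (simp add: strict_mono_def)
    ultimately show ?thesis by (intro exI[of _ "\<lambda>k. \<sigma> (N + k)"]) (auto simp: mono_def)
  qed
qed

lemma mono_subseq:
  fixes f :: "nat \<Rightarrow> nat \<Rightarrow> int"
  assumes "\<And>k i. 0 \<le> f k i"
  shows "\<exists>\<sigma>. strict_mono (\<sigma> :: nat \<Rightarrow> nat) \<and> (\<forall>i<n. mono (\<lambda>k. f (\<sigma> k) i))"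
proof (induction n)
  case 0
  then show ?case using strict_mono_id by auto
next
  case (Suc n)
  then obtain \<sigma> where \<sigma>: "strict_mono (\<sigma> :: nat \<Rightarrow> nat)" "\<forall>i<n. mono (\<lambda>k. f (\<sigma> k) i)" by blast
  obtain \<rho> :: "nat \<Rightarrow> nat" where \<rho>: "strict_mono \<rho>" "mono (\<lambda>k. f (\<sigma> (\<rho> k)) n)"
    using mono_subseq_nat[of "\<lambda>k. f (\<sigma> k) n"] assms by blast
  have "mono (\<lambda>k. f ((\<sigma> \<circ> \<rho>) k) i)" if "i < Suc n" for i
  proof (cases "i = n")
    case False
    then have "mono (\<lambda>k. f (\<sigma> k) i)" using \<sigma> that by simp
    then show ?thesis using strict_mono_mono[OF \<rho>(1)] by (simp add: mono_def)
  qed (use \<rho> in simp)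
  then show ?case using strict_mono_o[OF \<sigma>(1) \<rho>(1)] by blast
qed

text \<open>A form of Dickson's lemma: minimal elements of an up-set are bounded. If truncation
  failed at every level, a subsequence increasing in all coordinates would put the truncation of a
  late member above the first member \<open>p\<close>.\<close>

lemma upset_truncation:
  assumes "upset n U"
  shows "\<exists>K. \<forall>K'\<ge>K. \<forall>b\<in>U. (\<lambda>i. min (b i) (int K')) \<in> U"
proof (rule ccontr)
  assume "\<not> ?thesis"
  then have "\<forall>K. \<exists>K' b. K' \<ge> K \<and> b \<in> U \<and> (\<lambda>i. min (b i) (int K')) \<notin> U" by blast
  then obtain K' b where Kb: "\<And>K. K' K \<ge> K" "\<And>K. b K \<in> U" "\<And>K. (\<lambda>i. min (b K i) (int (K' K))) \<notin> U"
    by metis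
  have bN: "b K \<in> Nn n" for K using Kb(2) assms by (auto simp: upset_def)
  then have b0: "0 \<le> b K i" for K i by (simp add: Nn_def)
  obtain \<sigma> :: "nat \<Rightarrow> nat" where \<sigma>: "strict_mono \<sigma>" "\<forall>i<n. mono (\<lambda>k. b (\<sigma> k) i)"
    using mono_subseq[of b n] b0 by blast
  define p where "p = b (\<sigma> 0)"
  define M where "M = nat (deg n p)"
  have pM: "p i \<le> int M" for i
  proof -
    have "deg n p \<ge> 0" using b0 by (simp add: deg_def p_def sum_nonneg)
    then have "p \<in> Dn n M" using bN by (simp add: Dn_def M_def p_def)
    then show ?thesis by (rule Dn_coord)
  qed
  let ?q = "\<lambda>i. min (b (\<sigma> M) i) (int (K' (\<sigma> M)))"
  have pq: "p i \<le> ?q i" for i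
  proof -
    have "M \<le> K' (\<sigma> M)" using strict_mono_imp_increasing[OF \<sigma>(1), of M] Kb(1)[of "\<sigma> M"] by linarith
    moreover have "p i \<le> b (\<sigma> M) i"
      using \<sigma>(2) bN[of "\<sigma> 0"] bN[of "\<sigma> M"] by (cases "i < n") (auto simp: p_def mono_def Nn_def Zn_def)
    ultimately show ?thesis using pM[of i] by simp
  qed
  have qN: "?q \<in> Nn n" using bN[of "\<sigma> M"] by (auto simp: Nn_def Zn_def)
  have "p \<in> U" using Kb(2) by (simp add: p_def)
  then have "?q \<in> U" by (rule upsetD[OF assms _ qN pq])
  then show False using Kb(3) by blast
qed

text \<open>Membership in \<open>U - V\<close> depends only on the truncation at \<open>K\<close>,
  so coordinates that are at least \<open>K\<close> may be raised freely. A point with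
  \<open>m\<close> of them yields a cone; without cones fewer than \<open>m\<close> coordinates are
  unbounded, leaving O(N^(m-1)) points. The factor \<open>N\<close> on the left stands for the
  exponent \<open>m - 1\<close>, so \<open>m = 0\<close> is covered: there the difference is
  empty.\<close>

lemma upset_diff_dichotomy:
  assumes U: "upset n U" and V: "upset n V" and no: "\<not> has_cone n m (U - V)"
  shows "\<exists>K. \<forall>N\<ge>1. card ((U - V) \<inter> Dn n N) * N \<le> K * N ^ m"
proof -
  obtain K1 where K1: "\<And>K' b. K' \<ge> K1 \<Longrightarrow> b \<in> U \<Longrightarrow> (\<lambda>i. min (b i) (int K')) \<in> U"
    using upset_truncation[OF U] by blast
  obtain K2 where K2: "\<And>K' b. K' \<ge> K2 \<Longrightarrow> b \<in> V \<Longrightarrow> (\<lambda>i. min (b i) (int K')) \<in> V"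
    using upset_truncation[OF V] by blast
  define K where "K = max K1 K2"
  define tr where "tr b = (\<lambda>i. min (b i) (int K))" for b :: "nat \<Rightarrow> int"
  have trN: "tr b \<in> Nn n" if "b \<in> Nn n" for b using that by (auto simp: tr_def Nn_def Zn_def)
  have trle: "tr b i \<le> b i" for b i by (simp add: tr_def)
  have trU: "tr b \<in> U \<longleftrightarrow> b \<in> U" if "b \<in> Nn n" for b
  proof
    show "b \<in> U" if "tr b \<in> U" using upsetD[OF U that \<open>b \<in> Nn n\<close> trle] .
    show "tr b \<in> U" if "b \<in> U" using K1[OF _ that, of K] by (simp add: tr_def K_def)
  qed
  have trV: "tr b \<in> V \<longleftrightarrow> b \<in> V" if "b \<in> Nn n" for b
  proof
    show "b \<in> V" if "tr b \<in> V" using upsetD[OF V that \<open>b \<in> Nn n\<close> trle] .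
    show "tr b \<in> V" if "b \<in> V" using K2[OF _ that, of K] by (simp add: tr_def K_def)
  qed
  have UN: "U \<subseteq> Nn n" using U by (simp add: upset_def)
  define big where "big b = {i. i < n \<and> b i \<ge> int K}" for b :: "nat \<Rightarrow> int"
  have fin_big: "finite (big b)" for b by (simp add: big_def)
  have few: "card (big b) < m" if b: "b \<in> U - V" for b
  proof (rule ccontr)
    assume "\<not> card (big b) < m"
    then obtain T where T: "T \<subseteq> big b" "card T = m"
      by (meson not_less obtain_subset_with_card_n)
    have bN: "b \<in> Nn n" using b UN by blast
    have "cone n (tr b) T \<subseteq> U - V"
    proof
      fix q assume q: "q \<in> cone n (tr b) T"
      have "tr q = tr b"
      proof
        fix i
        show "tr q i = tr b i"
        proof (cases "i \<in> T")
          case True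
          then have "b i \<ge> int K" using T by (auto simp: big_def)
          moreover have "tr b i \<le> q i" using q by (simp add: cone_def)
          ultimately show ?thesis by (simp add: tr_def)
        next
          case False
          then have "q i = tr b i" using q by (simp add: cone_def)
          then show ?thesis by (simp add: tr_def)
        qed
      qed
      moreover have "q \<in> Nn n" using q by (simp add: cone_def)
      ultimately show "q \<in> U - V" using trU trV b bN by (metis DiffD1 DiffD2 DiffI)
    qed
    moreover have "T \<subseteq> {..<n}" using T by (auto simp: big_def)
    ultimately have "has_cone n m (U - V)" unfolding has_cone_def using T trN[OF bN] by blast
    with no show False by blast
  qed
  show ?thesis
  proof (cases m)
    case 0
    then have "U - V = {}" using few by blast
    then show ?thesis by (simp only: Int_empty_left card.empty) simp
  next
    case (Suc m')
    define C where "C = 2 ^ n * (2 ^ m' * (K + 1) ^ n)"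
    have "card ((U - V) \<inter> Dn n N) * N \<le> C * N ^ m" if N: "N \<ge> 1" for N
    proof -
      define X where "X T = {b \<in> Dn n N. big b = T}" for T
      have X: "card (X T) \<le> 2 ^ m' * N ^ m' * (K + 1) ^ n" if T: "T \<subseteq> {..<n}" "card T \<le> m'" for T
      proof -
        let ?M = "\<lambda>i. if i \<in> T then N + 1 else K"
        have "card (X T) \<le> (\<Prod>i<n. ?M i)"
        proof -
          have "a i < int (?M i)" if "a \<in> X T" "i < n" for a i
            using that Dn_coord[of a n N i] by (auto simp: X_def big_def)
          moreover have "X T \<subseteq> Nn n" by (auto simp: X_def Dn_def)
          ultimately show ?thesis using card_box_le[of "X T" n ?M] by blast
        qed
        also have "\<dots> \<le> (\<Prod>i<n. (if i \<in> T then N + 1 else 1) * (K + 1))"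
          by (rule prod_mono) auto
        also have "\<dots> = (\<Prod>i<n. if i \<in> T then N + 1 else 1) * (K + 1) ^ n"
          by (simp only: prod.distrib prod_constant card_lessThan)
        also have "(\<Prod>i<n. if i \<in> T then N + 1 else 1) = (N + 1) ^ card T"
        proof -
          have "(\<Prod>i<n. if i \<in> T then N + 1 else 1) = (\<Prod>i\<in>T. N + 1)"
            using T by (simp add: prod.If_cases Int_absorb1 Int_absorb2 Collect_conj_eq)
          then show ?thesis by simp
        qed
        also have "(N + 1) ^ card T \<le> (2 * N) ^ m'"
        proof -
          have "(N + 1) ^ card T \<le> (2 * N) ^ card T" using N by (intro power_mono) auto
          also have "\<dots> \<le> (2 * N) ^ m'" using N T by (intro power_increasing) auto
          finally show ?thesis .
        qed
        finally show ?thesis by (simp add: power_mult_distrib)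
      qed
      define P where "P = {T. T \<subseteq> {..<n} \<and> card T \<le> m'}"
      have P: "finite P" "card P \<le> 2 ^ n"
      proof -
        have "P \<subseteq> Pow {..<n}" by (auto simp: P_def)
        then show "finite P" "card P \<le> 2 ^ n"
          using card_mono[of "Pow {..<n}" P] by (auto simp: card_Pow intro: finite_subset)
      qed
      have "(U - V) \<inter> Dn n N \<subseteq> (\<Union>T\<in>P. X T)"
        using few Suc by (fastforce simp: P_def X_def big_def)
      moreover have "finite (\<Union>T\<in>P. X T)" using P finite_Dn by (auto simp: X_def)
      ultimately have "card ((U - V) \<inter> Dn n N) \<le> card (\<Union>T\<in>P. X T)" by (rule card_mono[rotated])
      also have "\<dots> \<le> (\<Sum>T\<in>P. card (X T))" by (rule card_UN_le[OF P(1)])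
      also have "\<dots> \<le> (\<Sum>T\<in>P. 2 ^ m' * N ^ m' * (K + 1) ^ n)" by (rule sum_mono) (use X in \<open>auto simp: P_def\<close>)
      also have "\<dots> \<le> 2 ^ n * (2 ^ m' * N ^ m' * (K + 1) ^ n)" using P by simp
      finally have "card ((U - V) \<inter> Dn n N) * N \<le> 2 ^ n * (2 ^ m' * N ^ m' * (K + 1) ^ n) * N" by simp
      then show ?thesis by (simp add: C_def Suc algebra_simps)
    qed
    then show ?thesis by blast
  qed
qed

lemma card_cone_ge:
  assumes "p \<in> Nn n" "T \<subseteq> {..<n}" "deg n p + int (card T * L) \<le> int N"
  shows "(L + 1) ^ card T \<le> card (cone n p T \<inter> Dn n N)"
proof -
  have fT: "finite T" using assms(2) finite_subset by blast
  let ?P = "PiE T (\<lambda>_. {0..int L})"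
  define h where "h f = (\<lambda>i. p i + (if i \<in> T then f i else 0))" for f :: "nat \<Rightarrow> int"
  have "inj_on h ?P"
  proof (rule inj_onI)
    fix f g assume *: "f \<in> ?P" "g \<in> ?P" "h f = h g"
    show "f = g"
    proof (rule PiE_ext[OF *(1,2)])
      fix i assume "i \<in> T"
      then show "f i = g i" using fun_cong[OF *(3), of i] by (simp add: h_def)
    qed
  qed
  moreover have "h ` ?P \<subseteq> cone n p T \<inter> Dn n N"
  proof clarify
    fix f assume f: "f \<in> ?P"
    have f0: "0 \<le> f i \<and> f i \<le> int L" if "i \<in> T" for i using PiE_mem[OF f that] by simp
    have hN: "h f \<in> Nn n" using assms f0 by (auto simp: h_def Nn_def Zn_def)
    have "deg n (h f) = deg n p + (\<Sum>i<n. if i \<in> T then f i else 0)" by (simp add: deg_def h_def sum.distrib)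
    also have "(\<Sum>i<n. if i \<in> T then f i else 0) = (\<Sum>i\<in>T. f i)"
      using assms(2) by (simp add: sum.If_cases Int_absorb1 Int_absorb2)
    also have "(\<Sum>i\<in>T. f i) \<le> (\<Sum>i\<in>T. int L)" by (rule sum_mono) (use f0 in auto)
    finally have "deg n (h f) \<le> int N" using assms(3) by simp
    then show "h f \<in> cone n p T \<inter> Dn n N" using hN f0 by (auto simp: cone_def Dn_def h_def)
  qed
  moreover have "finite (cone n p T \<inter> Dn n N)" using finite_Dn by blast
  ultimately have "card ?P \<le> card (cone n p T \<inter> Dn n N)" by (rule card_inj_on_le)
  moreover have "card {0..int L} = L + 1" by simp
  then have "card ?P = (L + 1) ^ card T" using fT by (simp only: card_PiE prod_constant)
  ultimately show ?thesis by simp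
qed

text \<open>All cones of dimension \<open>m\<close> have growth at least \<open>N\<^sup>m / m\<^sup>m\<close>, so a set of growth \<open>O(N\<^sup>m)\<close>
  contains only finitely many disjoint ones.\<close>

lemma finite_cone_steps:
  assumes anti: "\<And>i. U (Suc i) \<subseteq> U i" and sub: "\<And>i. U i \<subseteq> A" "\<And>i. B \<subseteq> U i"
    and bound: "\<And>N. N \<ge> 1 \<Longrightarrow> card ((A - B) \<inter> Dn n N) \<le> K * N ^ m"
  shows "finite {i. has_cone n m (U i - U (Suc i))}"
proof (rule ccontr)
  assume "infinite {i. has_cone n m (U i - U (Suc i))}"
  \<comment> \<open>One cone more than volume allows: each has at least \<open>(L + 1) ^ m\<close>
    points up to degree \<open>N\<close>, while \<open>K * N ^ m\<close> is at most
    \<open>K * (m + 1) ^ m * (L + 1) ^ m\<close>.\<close>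
  then obtain X where X: "finite X" "X \<subseteq> {i. has_cone n m (U i - U (Suc i))}" "card X = K * (m + 1) ^ m + 1"
    using infinite_arbitrarily_large[of "{i. has_cone n m (U i - U (Suc i))}" "K * (m + 1) ^ m + 1"] by metis
  have "\<exists>p T. p \<in> Nn n \<and> T \<subseteq> {..<n} \<and> card T = m \<and> cone n p T \<subseteq> U i - U (Suc i)" if "i \<in> X" for i
  proof -
    from that X(2) have "has_cone n m (U i - U (Suc i))" by blast
    then show ?thesis unfolding has_cone_def by blast
  qed
  then obtain p T where pT: "\<And>i. i \<in> X \<Longrightarrow> p i \<in> Nn n \<and> T i \<subseteq> {..<n} \<and> card (T i) = m \<and> cone n (p i) (T i) \<subseteq> U i - U (Suc i)"
    by metis
  \<comment> \<open>\<open>L\<close> dominates the degrees of all apexes, so an apex plus a cube of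
    side \<open>L\<close> stays within degree \<open>(m + 1) * L\<close>. The \<open>+ 1\<close>
    ensures \<open>N \<ge> 1\<close>.\<close>
  define L where "L = (\<Sum>i\<in>X. nat (deg n (p i))) + 1"
  define N where "N = (m + 1) * L"
  have L: "deg n (p i) \<le> int L" if "i \<in> X" for i
  proof -
    have "nat (deg n (p i)) \<le> (\<Sum>i\<in>X. nat (deg n (p i)))" by (rule member_le_sum) (use X that in auto)
    then have "nat (deg n (p i)) \<le> L" unfolding L_def by linarith
    then show ?thesis by linarith
  qed
  define Y where "Y i = cone n (p i) (T i) \<inter> Dn n N" for i
  have Y: "(L + 1) ^ m \<le> card (Y i)" if "i \<in> X" for i
    using card_cone_ge[of "p i" n "T i" L N] pT[OF that] L[OF that] by (simp add: Y_def N_def algebra_simps)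
  have antiU: "U j \<subseteq> U i" if "i \<le> j" for i j using anti that by (rule lift_Suc_antimono_le)
  have disj: "Y i \<inter> Y j = {}" if "i \<in> X" "j \<in> X" "i < j" for i j
    using pT[OF that(1)] pT[OF that(2)] antiU[of "Suc i" j] that(3) by (auto simp: Y_def)
  have disj': "\<forall>i\<in>X. \<forall>j\<in>X. i \<noteq> j \<longrightarrow> Y i \<inter> Y j = {}"
    using disj by (metis inf_commute linorder_neqE_nat)
  have "card X * (L + 1) ^ m = (\<Sum>i\<in>X. (L + 1) ^ m)" by simp
  also have "\<dots> \<le> (\<Sum>i\<in>X. card (Y i))" by (rule sum_mono) (rule Y)
  also have "\<dots> = card (\<Union>i\<in>X. Y i)"
    by (rule card_UN_disjoint[symmetric]) (use X disj' finite_Dn in \<open>auto simp: Y_def\<close>)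
  also have "\<dots> \<le> card ((A - B) \<inter> Dn n N)"
    by (rule card_mono) (use finite_Dn pT sub in \<open>fastforce simp: Y_def\<close>)+
  also have "\<dots> \<le> K * N ^ m" by (rule bound) (simp add: N_def L_def)
  also have "\<dots> \<le> K * (m + 1) ^ m * (L + 1) ^ m"
  proof -
    have "N ^ m \<le> ((m + 1) * (L + 1)) ^ m" unfolding N_def by (intro power_mono mult_left_mono) auto
    then show ?thesis unfolding power_mult_distrib mult.assoc by (rule mult_left_mono) simp
  qed
  finally have "card X \<le> K * (m + 1) ^ m" by simp
  then show False using X by simp
qed

section \<open>Upper bound for the deviation\<close>

text \<open>A degree-compatible total order on exponents, as the pull-back of the order on \<open>\<int>[X]\<close>.\<close>

definition key :: "nat \<Rightarrow> (nat \<Rightarrow> int) \<Rightarrow> int poly" where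
  "key n a = (\<Sum>i<n. monom (a i) i) + monom (deg n a) n"

lemma coeff_key: "coeff (key n a) j = (if j < n then a j else if j = n then deg n a else 0)"
  by (auto simp: key_def coeff_sum)

lemma key_add: "key n (a + b) = key n a + key n b"
  by (rule poly_eqI) (auto simp: coeff_key deg_def sum.distrib)

lemma key_inj: "a \<in> Zn n \<Longrightarrow> b \<in> Zn n \<Longrightarrow> key n a = key n b \<Longrightarrow> a = b"
proof
  fix i assume *: "a \<in> Zn n" "b \<in> Zn n" "key n a = key n b"
  then have "coeff (key n a) i = coeff (key n b) i" by simp
  then show "a i = b i" using *(1,2) by (cases "i < n") (auto simp: coeff_key Zn_def)
qed

text \<open>The degree is stored as the top coefficient, at position \<open>n\<close>, and integer
  polynomials are compared by the leading coefficient of their difference.\<close>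

lemma deg_le_if_key_le:
  assumes "key n a \<le> key n b"
  shows "deg n a \<le> deg n b"
proof (rule ccontr)
  assume less: "\<not> deg n a \<le> deg n b"
  let ?q = "key n a - key n b"
  have c: "coeff ?q n > 0" using less by (simp add: coeff_key)
  have "degree ?q \<le> n" by (rule degree_le) (auto simp: coeff_key)
  moreover have "n \<le> degree ?q" using c by (intro le_degree) simp
  ultimately have "pos_poly ?q" using c by (simp add: pos_poly_def)
  then have "key n b < key n a" by (simp add: less_poly_def)
  then show False using assms by simp
qed

text \<open>The leading exponents of the elements of \<open>J\<close> supported on \<open>\<nat>\<^sup>n\<close>.\<close>

definition Ul :: "nat \<Rightarrow> ((nat \<Rightarrow> int) \<Rightarrow> 'a::field) set \<Rightarrow> (nat \<Rightarrow> int) set" where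
  "Ul n J = {a. \<exists>x\<in>J. x a \<noteq> 0 \<and> (\<forall>c\<in>supp x. c \<in> Nn n \<and> key n c \<le> key n a)}"

lemma Ul_mono: "I \<subseteq> J \<Longrightarrow> Ul n I \<subseteq> Ul n J"
  unfolding Ul_def by blast

lemma Nn_Zn: "a \<in> Nn n \<Longrightarrow> a \<in> Zn n"
  by (simp add: Nn_def)

lemma Ul_Nn: "a \<in> Ul n J \<Longrightarrow> a \<in> Nn n"
  by (auto simp: Ul_def supp_def)

lemma max_key_exists:
  assumes "finite S" "S \<noteq> {}"
  shows "\<exists>a\<in>S. \<forall>c\<in>S. key n c \<le> key n a"
proof -
  have "Max (key n ` S) \<in> key n ` S" using assms by simp
  then obtain a where "a \<in> S" "key n a = Max (key n ` S)" by auto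
  then show ?thesis using assms by (metis Max_ge finite_imageI imageI)
qed

context twistedZ
begin

text \<open>The order is invariant under translation, so multiplying by the basis element of
  \<open>q - p\<close> moves the leading exponent from \<open>p\<close> to \<open>q\<close>.\<close>

lemma Ul_upset:
  assumes "rideal (Zn n) J"
  shows "upset n (Ul n J)"
  unfolding upset_def
proof (intro conjI ballI impI)
  show "Ul n J \<subseteq> Nn n" using Ul_Nn by blast
next
  fix p q assume p: "p \<in> Ul n J" and q: "q \<in> Nn n" "\<forall>i. p i \<le> q i"
  obtain x where x: "x \<in> J" "x p \<noteq> 0" "\<And>c. c \<in> supp x \<Longrightarrow> c \<in> Nn n \<and> key n c \<le> key n p"
    using p unfolding Ul_def by blast
  define h where "h = q - p"
  have h: "h \<in> Nn n" "p + h = q" using q Ul_Nn[OF p] by (auto simp: h_def Nn_def Zn_def)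
  have "rm x h \<in> J" using rideal_rm[OF assms x(1) Nn_Zn[OF h(1)]] .
  moreover have "rm x h q \<noteq> 0" using x(2) by (simp add: rm_def h_def)
  moreover have "c \<in> Nn n \<and> key n c \<le> key n q" if c: "c \<in> supp (rm x h)" for c
  proof -
    obtain d where d: "d \<in> supp x" "c = d + h" using c by (auto simp: supp_rm)
    have dN: "d \<in> Nn n" "key n d \<le> key n p" using x(3)[OF d(1)] by auto
    have "c \<in> Nn n" using dN(1) h(1) d(2) by (auto simp: Nn_def Zn_def)
    moreover have "key n c \<le> key n q"
      using dN(2) unfolding h(2)[symmetric] d(2) key_add by simp
    ultimately show ?thesis by blast
  qed
  ultimately show "q \<in> Ul n J" unfolding Ul_def by blast
qed

text \<open>Division with remainder: the largest exponent of \<open>x\<close> in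
  \<open>Ul n I\<close> is cancelled by an element of \<open>I\<close> led by it. The order respects
  degrees, so everything stays in \<open>Dn n N\<close>; the measure counts the exponents there up
  to that largest one.\<close>

lemma reduce_mod_rideal:
  assumes I: "rideal (Zn n) I" and x: "supp x \<subseteq> Dn n N"
  shows "\<exists>y. supp y \<subseteq> Dn n N \<and> x - y \<in> I \<and> (\<forall>a\<in>Ul n I. y a = 0)"
  using x
proof (induction "card {c \<in> Dn n N. \<exists>b\<in>supp x \<inter> Ul n I. key n c \<le> key n b}" arbitrary: x rule: less_induct)
  case (less x)
  let ?B = "\<lambda>x. {c \<in> Dn n N. \<exists>b\<in>supp x \<inter> Ul n I. key n c \<le> key n b}"
  show ?case
  proof (cases "supp x \<inter> Ul n I = {}")
    case True
    then have "\<forall>a\<in>Ul n I. x a = 0" by (auto simp: supp_def)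
    moreover have "x - x \<in> I" using rideal_0[OF I] by simp
    ultimately show ?thesis using less.prems by blast
  next
    case False
    have finx: "finite (supp x)" using less.prems finite_Dn finite_subset by blast
    then obtain a where a: "a \<in> supp x \<inter> Ul n I" "\<And>c. c \<in> supp x \<inter> Ul n I \<Longrightarrow> key n c \<le> key n a"
      using max_key_exists[of "supp x \<inter> Ul n I" n] False by blast
    obtain y where y: "y \<in> I" "y a \<noteq> 0" "\<And>c. c \<in> supp y \<Longrightarrow> c \<in> Nn n \<and> key n c \<le> key n a"
      using a(1) unfolding Ul_def by blast
    have aD: "a \<in> Dn n N" using a(1) less.prems by blast
    have suppy: "c \<in> Dn n N" if "c \<in> supp y" for c
    proof -
      have "deg n c \<le> deg n a" using y(3)[OF that] deg_le_if_key_le by blast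
      then show ?thesis using y(3)[OF that] aD by (simp add: Dn_def)
    qed
    define k where "k = x a / y a"
    define x1 where "x1 = x - smul k y"
    have x1D: "supp x1 \<subseteq> Dn n N"
    proof
      fix c assume "c \<in> supp x1"
      then have "c \<in> supp x \<or> c \<in> supp y" by (auto simp: x1_def supp_def)
      then show "c \<in> Dn n N" using less.prems suppy by blast
    qed
    have x1a: "x1 a = 0" using y(2) by (simp add: x1_def k_def)
    have lt: "key n b < key n a" if b: "b \<in> supp x1 \<inter> Ul n I" for b
    proof (rule ccontr)
      assume "\<not> key n b < key n a"
      then have ge: "key n a \<le> key n b" by simp
      have "b \<noteq> a" using b x1a by (auto simp: supp_def)
      moreover have "b \<in> Zn n" "a \<in> Zn n" using b a(1) Ul_Nn Nn_Zn by blast+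
      ultimately have "key n b \<noteq> key n a" using key_inj by blast
      then have gt: "key n a < key n b" using ge by simp
      have "b \<notin> supp y" using y(3)[of b] gt by force
      then have "b \<in> supp x \<inter> Ul n I" using b by (auto simp: x1_def supp_def)
      then show False using a(2)[of b] gt by simp
    qed
    have "?B x1 \<subset> ?B x"
    proof
      show "?B x1 \<subseteq> ?B x"
      proof
        fix c assume "c \<in> ?B x1"
        then obtain b where b: "c \<in> Dn n N" "b \<in> supp x1 \<inter> Ul n I" "key n c \<le> key n b" by blast
        then have "key n c \<le> key n a" using lt[OF b(2)] by simp
        then show "c \<in> ?B x" using b(1) a(1) by blast
      qed
      have "a \<in> ?B x" using a(1) aD by blast
      moreover have "a \<notin> ?B x1" using lt by fastforce
      ultimately show "?B x1 \<noteq> ?B x" by blast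
    qed
    then have "card (?B x1) < card (?B x)" using finite_Dn by (intro psubset_card_mono) auto
    from less.hyps[OF this x1D] obtain z where z: "supp z \<subseteq> Dn n N" "x1 - z \<in> I" "\<forall>a\<in>Ul n I. z a = 0" by blast
    have "x - z = (x1 - z) + smul k y" by (simp add: x1_def)
    also have "\<dots> \<in> I" by (rule rideal_add[OF I z(2) rideal_smul[OF I y(1)]])
    finally show ?thesis using z by blast
  qed
qed

text \<open>Remainders modulo \<open>I\<close> avoid \<open>Ul n I\<close>. With too many elements,
  a nontrivial combination has a remainder \<open>v\<close> vanishing on
  \<open>Ul n J - Ul n I\<close> as well. As \<open>v\<close> is in \<open>J\<close>, no place is
  left for its leading exponent, so \<open>v = 0\<close>, against independence.\<close>

lemma card_independent_mod_le:
  assumes I: "rideal (Zn n) I" and J: "rideal (Zn n) J" and IJ: "I \<subseteq> J" and T: "finite T"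
    and z: "\<And>t. t \<in> T \<Longrightarrow> z t \<in> J \<and> supp (z t) \<subseteq> Dn n N"
    and indep: "\<And>c. (\<Sum>t\<in>T. smul (c t) (z t)) \<in> I \<Longrightarrow> \<forall>t\<in>T. c t = 0"
  shows "card T \<le> card ((Ul n J - Ul n I) \<inter> Dn n N)"
proof (rule ccontr)
  assume less: "\<not> ?thesis"
  have "\<forall>t\<in>T. \<exists>y. supp y \<subseteq> Dn n N \<and> z t - y \<in> I \<and> (\<forall>a\<in>Ul n I. y a = 0)"
    using reduce_mod_rideal[OF I] z by blast
  then obtain y where y: "\<And>t. t \<in> T \<Longrightarrow> supp (y t) \<subseteq> Dn n N \<and> z t - y t \<in> I \<and> (\<forall>a\<in>Ul n I. y t a = 0)"
    by metis
  obtain c where c: "\<exists>t\<in>T. c t \<noteq> 0" "\<And>s. s \<in> (Ul n J - Ul n I) \<inter> Dn n N \<Longrightarrow> (\<Sum>t\<in>T. c t * y t s) = 0"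
    using nontrivial_combination[OF T, of "(Ul n J - Ul n I) \<inter> Dn n N" y] less finite_Dn by auto
  define v where "v = (\<Sum>t\<in>T. smul (c t) (y t))"
  have zv: "(\<Sum>t\<in>T. smul (c t) (z t)) - v = (\<Sum>t\<in>T. smul (c t) (z t - y t))"
    unfolding v_def by (simp add: fs.scale_right_diff_distrib sum_subtractf)
  have zvI: "(\<Sum>t\<in>T. smul (c t) (z t)) - v \<in> I"
    unfolding zv by (rule rideal_sum[OF I], rule rideal_smul[OF I]) (use y in blast)
  have zJ: "(\<Sum>t\<in>T. smul (c t) (z t)) \<in> J"
    by (rule rideal_sum[OF J], rule rideal_smul[OF J]) (use z in blast)
  have vJ: "v \<in> J"
  proof -
    have "v = (\<Sum>t\<in>T. smul (c t) (z t)) - ((\<Sum>t\<in>T. smul (c t) (z t)) - v)" by simp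
    also have "\<dots> \<in> J" by (rule rideal_diff[OF J zJ]) (use zvI IJ in blast)
    finally show ?thesis .
  qed
  have vD: "supp v \<subseteq> Dn n N"
  proof
    fix a assume "a \<in> supp v"
    then have "(\<Sum>t\<in>T. c t * y t a) \<noteq> 0" by (simp add: v_def supp_def sum_apply)
    then obtain t where "t \<in> T" "c t * y t a \<noteq> 0" by (meson sum.not_neutral_contains_not_neutral)
    then have "a \<in> supp (y t)" "t \<in> T" by (auto simp: supp_def)
    then show "a \<in> Dn n N" using y by blast
  qed
  have "supp v = {}"
  proof (rule ccontr)
    assume ne: "supp v \<noteq> {}"
    have "finite (supp v)" using vD finite_Dn finite_subset by blast
    then obtain a where a: "a \<in> supp v" "\<forall>c\<in>supp v. key n c \<le> key n a"
      using max_key_exists[of "supp v" n] ne by blast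
    have aD: "a \<in> Dn n N" using a vD by blast
    have "\<forall>c\<in>supp v. c \<in> Nn n \<and> key n c \<le> key n a" using a vD by (auto simp: Dn_def)
    then have "a \<in> Ul n J" unfolding Ul_def using vJ a(1) by (auto simp: supp_def)
    moreover have "a \<notin> Ul n I"
    proof
      assume "a \<in> Ul n I"
      then have "y t a = 0" if "t \<in> T" for t using y that by blast
      then have "v a = 0" by (simp add: v_def sum_apply)
      then show False using a(1) by (simp add: supp_def)
    qed
    ultimately have "v a = 0" using c(2)[of a] aD by (simp add: v_def sum_apply)
    then show False using a(1) by (simp add: supp_def)
  qed
  then have "v = 0" by (auto simp: supp_def fun_eq_iff)
  then have "(\<Sum>t\<in>T. smul (c t) (z t)) \<in> I" using zvI by simp
  then show False using indep c(1) by blast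
qed

lemma rideal_quotient:
  assumes G: "sub G" and I: "rideal G I"
  shows "rideal G {s \<in> Alg G. mul x s \<in> I}"
  unfolding rideal_def
proof (intro conjI ballI allI)
  show "{s \<in> Alg G. mul x s \<in> I} \<subseteq> Alg G" by blast
  show "0 \<in> {s \<in> Alg G. mul x s \<in> I}" using rideal_0[OF I] by (simp add: mul_def supp_def)
next
  fix s t assume "s \<in> {s \<in> Alg G. mul x s \<in> I}" "t \<in> {s \<in> Alg G. mul x s \<in> I}"
  then show "s + t \<in> {s \<in> Alg G. mul x s \<in> I}"
    using mul_add[of s G t x] rideal_add[OF I] Alg_add by fastforce
next
  fix s k assume "s \<in> {s \<in> Alg G. mul x s \<in> I}"
  then show "smul k s \<in> {s \<in> Alg G. mul x s \<in> I}"
    using mul_smul[of s G x k] rideal_smul[OF I] Alg_smul by fastforce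
next
  fix s a assume "s \<in> {s \<in> Alg G. mul x s \<in> I}" "a \<in> G"
  then show "rm s a \<in> {s \<in> Alg G. mul x s \<in> I}"
    using mul_rm[of s G x a] rideal_rm[OF I] Alg_rm[OF G] by fastforce
qed

lemma mul_sum_ind:
  assumes "finite P" "inj_on g P"
  shows "mul x (\<Sum>t\<in>P. smul (c t) (ind (g t))) = (\<Sum>t\<in>P. smul (c t) (rm x (g t)))"
proof -
  define s where "s = (\<Sum>t\<in>P. smul (c t) (ind (g t)))"
  have sg: "s (g t) = c t" if "t \<in> P" for t
  proof -
    have "s (g t) = (\<Sum>u\<in>P. if t = u then c u else 0)"
      unfolding s_def sum_apply
      by (rule sum.cong) (use assms(2) that in \<open>auto simp: ind_apply inj_on_eq_iff\<close>)
    then show ?thesis using that assms by simp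
  qed
  have "supp s \<subseteq> g ` P"
  proof
    fix a assume "a \<in> supp s"
    then have "(\<Sum>t\<in>P. c t * ind (g t) a) \<noteq> 0" by (simp add: s_def supp_def sum_apply)
    then obtain t where "t \<in> P" "c t * ind (g t) a \<noteq> 0" by (meson sum.not_neutral_contains_not_neutral)
    then show "a \<in> g ` P" by (auto simp: ind_apply split: if_splits)
  qed
  then have "mul x s = (\<Sum>b\<in>g ` P. smul (s b) (rm x b))" using assms by (intro mul_eq) auto
  also have "\<dots> = (\<Sum>t\<in>P. smul (c t) (rm x (g t)))"
    using assms(2) sg by (simp add: sum.reindex)
  finally show ?thesis by (simp add: s_def)
qed

text \<open>For \<open>x\<close> in \<open>J\<close> outside \<open>I\<close>, \<open>S\<close> is
  the annihilator of the class of \<open>x\<close>, a proper right ideal. Since it meets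
  \<open>F * C\<close> only in 0, the translates of \<open>x\<close> by lattice points of
  \<open>C\<close> are independent modulo \<open>I\<close>, and this lattice has rank at least
  \<open>n - k\<close>.\<close>

lemma growth_lower:
  assumes I: "rideal (Zn n) I" and J: "rideal (Zn n) J" and IJ: "I \<subset> J"
    and H: "\<And>S. rideal (Zn n) S \<Longrightarrow> S \<noteq> Alg (Zn n) \<Longrightarrow> \<exists>C T. fs.subspace C \<and> C \<subseteq> Qn n \<and> finite T \<and> card T \<le> k \<and>
      Qn n \<subseteq> fs.span (C \<union> T) \<and> (\<forall>x\<in>S. supp x \<subseteq> lat C \<longrightarrow> x = 0)"
  shows "\<exists>K\<ge>1. \<forall>N. (N + 1) ^ (n - k) \<le> card ((Ul n J - Ul n I) \<inter> Dn n (K * (N + 1)))"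
proof -
  obtain x where x: "x \<in> J" "x \<notin> I" using IJ by blast
  define S where "S = {s \<in> Alg (Zn n). mul x s \<in> I}"
  have S: "rideal (Zn n) S" unfolding S_def by (rule rideal_quotient[OF sub_Zn I])
  have "ind 0 \<notin> S" using x(2) rideal_smul_iff[OF I] by (auto simp: S_def mul_ind rm_0)
  then have "S \<noteq> Alg (Zn n)" using Alg_ind[OF sub_0[OF sub_Zn]] by blast
  from H[OF S this] obtain C T where C: "fs.subspace C" "C \<subseteq> Qn n" and T: "finite T" "card T \<le> k"
    and CT: "Qn n \<subseteq> fs.span (C \<union> T)" and SC: "\<And>s. s \<in> S \<Longrightarrow> supp s \<subseteq> lat C \<Longrightarrow> s = 0" by blast
  obtain B where B: "B \<subseteq> lat C" "finite B" "fs.independent (vec ` B)" "C = fs.span (vec ` B)"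
    using integral_basis[OF C] by metis
  have "n \<le> card B + k"
  proof -
    have "fs.span (C \<union> T) = fs.span (vec ` B \<union> T)"
    proof
      have "C \<union> T \<subseteq> fs.span (vec ` B \<union> T)"
        unfolding B(4) using fs.span_superset[of "vec ` B \<union> T"] fs.span_mono[of "vec ` B" "vec ` B \<union> T"] by blast
      then show "fs.span (C \<union> T) \<subseteq> fs.span (vec ` B \<union> T)" by (rule fs.span_minimal) simp
      show "fs.span (vec ` B \<union> T) \<subseteq> fs.span (C \<union> T)"
        unfolding B(4) using fs.span_superset[of "vec ` B"] by (intro fs.span_mono) blast
    qed
    then have "Qn n \<subseteq> fs.span (vec ` B \<union> T)" using CT by simp
    moreover have "(ind :: nat \<Rightarrow> nat \<Rightarrow> rat) ` {..<n} \<subseteq> Qn n" by (auto simp: Qn_def ind_apply)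
    ultimately have "card ((ind :: nat \<Rightarrow> nat \<Rightarrow> rat) ` {..<n}) \<le> card (vec ` B \<union> T)"
      using fs.independent_span_bound[of "vec ` B \<union> T" "ind ` {..<n}"] independent_ind[of "{..<n}"] B(2) T(1)
      by (meson finite_UnI finite_imageI finite_lessThan order_trans)
    also have "\<dots> \<le> card (vec ` B) + card T" by (rule card_Un_le)
    also have "\<dots> \<le> card B + k" using card_image_le[OF B(2), of vec] T by simp
    finally show ?thesis by (simp add: card_image[OF inj_ind])
  qed
  then obtain B0 where B0: "B0 \<subseteq> B" "card B0 = n - k"
    by (metis le_diff_conv obtain_subset_with_card_n)
  have finB0: "finite B0" using B0 B finite_subset by blast
  define g where "g t = (\<Sum>b\<in>B0. zs (t b) b)" for t :: "(nat \<Rightarrow> int) \<Rightarrow> int"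
  have vecg: "vec (g t) = (\<Sum>b\<in>B0. smul (of_int (t b)) (vec b))" for t
    by (auto simp: g_def fun_eq_iff sum_apply)
  have gC: "g t \<in> lat C" for t
    unfolding lat_def mem_Collect_eq vecg
    by (rule fs.subspace_sum[OF C(1)], rule fs.subspace_scale[OF C(1)])
      (use B0(1) B(1) in \<open>auto simp: lat_def\<close>)
  have gZ: "g t \<in> Zn n" for t using gC C lat_mono lat_Qn by blast
  have g_inj: "t b = t' b" if gg: "g t = g t'" and b: "b \<in> B0" for t t' b
  proof -
    have ind: "fs.independent (vec ` B0)" using B(3) B0(1) fs.independent_mono by blast
    have inj: "inj_on vec B0" by (simp add: inj_on_def vec_inj)
    define u where "u v = of_int (t (inv_into B0 vec v)) - (of_int (t' (inv_into B0 vec v)) :: rat)" for v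
    have u: "u (vec b) = of_int (t b) - of_int (t' b)" if "b \<in> B0" for b
      using inv_into_f_f[OF inj that] by (simp add: u_def)
    have "(\<Sum>v\<in>vec ` B0. smul (u v) v) = (\<Sum>b\<in>B0. smul (of_int (t b) - of_int (t' b)) (vec b))"
      by (simp add: sum.reindex[OF inj] u)
    also have "\<dots> = vec (g t) - vec (g t')"
      unfolding vecg by (simp add: fs.scale_left_diff_distrib sum_subtractf)
    also have "\<dots> = 0" using gg by simp
    finally have "u (vec b) = 0"
      using fs.independentD[OF ind _ subset_refl] finB0 b by blast
    then show ?thesis using u[OF b] by simp
  qed
  obtain K0 :: nat where K0: "\<And>c i. c \<in> supp x \<Longrightarrow> i < n \<Longrightarrow> \<bar>c i\<bar> \<le> int K0"
  proof -
    have finx: "finite (supp x)" using rideal_Alg[OF J x(1)] by (simp add: Alg_def)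
    define K0 where "K0 = (\<Sum>c\<in>supp x. \<Sum>i<n. nat \<bar>c i\<bar>)"
    have "\<bar>c i\<bar> \<le> int K0" if ci: "c \<in> supp x" "i < n" for c i
    proof -
      have "nat \<bar>c i\<bar> \<le> (\<Sum>i<n. nat \<bar>c i\<bar>)"
        by (rule member_le_sum[of i "{..<n}" "\<lambda>i. nat \<bar>c i\<bar>"]) (use ci in auto)
      also have "\<dots> \<le> K0" unfolding K0_def
        by (rule member_le_sum[of c "supp x" "\<lambda>c. \<Sum>i<n. nat \<bar>c i\<bar>"]) (use ci finx in auto)
      finally show ?thesis by linarith
    qed
    then show thesis using that by blast
  qed
  \<comment> \<open>\<open>K0\<close> bounds the coordinates in the support of \<open>x\<close> and
    \<open>K1 i * N\<close> those of \<open>g t\<close>. After the translation by \<open>h\<close>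
    each of the \<open>n\<close> coordinates lies between 0 and \<open>2 * K2 * (N + 1)\<close>; the
    \<open>+ 1\<close> in \<open>K\<close> makes it positive.\<close>
  define K1 where "K1 i = (\<Sum>b\<in>B0. nat \<bar>b i\<bar>)" for i
  define K2 where "K2 = K0 + (\<Sum>i<n. K1 i)"
  define K where "K = 2 * n * K2 + 1"
  have "(N + 1) ^ (n - k) \<le> card ((Ul n J - Ul n I) \<inter> Dn n (K * (N + 1)))" for N
  proof -
    define P where "P = PiE B0 (\<lambda>_. {0..int N})"
    have finP: "finite P" unfolding P_def by (intro finite_PiE finB0) auto
    have "card {0..int N} = N + 1" by simp
    then have cardP: "card P = (N + 1) ^ (n - k)"
      unfolding P_def using finB0 B0(2) by (simp only: card_PiE prod_constant)
    have injg: "inj_on g P"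
    proof (rule inj_onI)
      fix t t' assume *: "t \<in> P" "t' \<in> P" "g t = g t'"
      show "t = t'"
        by (rule PiE_ext[OF *(1)[unfolded P_def] *(2)[unfolded P_def]]) (rule g_inj[OF *(3)])
    qed
    \<comment> \<open>Translation by the unit at \<open>h\<close> moves all supports into
      \<open>Nn n\<close> without affecting independence.\<close>
    define h where "h i = (if i < n then int (K2 * (N + 1)) else 0)" for i
    have hZ: "h \<in> Zn n" by (simp add: h_def Zn_def)
    define z where "z t = rm x (g t + h)" for t
    have ghZ: "g t + h \<in> Zn n" for t using sub_add[OF sub_Zn gZ hZ] .
    have gbound: "\<bar>g t i\<bar> \<le> int (K1 i * N)" if t: "t \<in> P" for t i
    proof -
      have "\<bar>g t i\<bar> \<le> (\<Sum>b\<in>B0. \<bar>t b * b i\<bar>)" unfolding g_def sum_apply zs_apply by (rule sum_abs)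
      also have "\<dots> \<le> (\<Sum>b\<in>B0. int N * \<bar>b i\<bar>)"
      proof (rule sum_mono)
        fix b assume "b \<in> B0"
        then have "0 \<le> t b \<and> t b \<le> int N" using t PiE_mem unfolding P_def by fastforce
        then show "\<bar>t b * b i\<bar> \<le> int N * \<bar>b i\<bar>" by (simp add: abs_mult mult_right_mono)
      qed
      also have "\<dots> = int (K1 i * N)" by (simp add: K1_def sum_distrib_left mult.commute)
      finally show ?thesis .
    qed
    have zJ: "z t \<in> J \<and> supp (z t) \<subseteq> Dn n (K * (N + 1))" if t: "t \<in> P" for t
    proof
      show "z t \<in> J" unfolding z_def by (rule rideal_rm[OF J x(1) ghZ])
      show "supp (z t) \<subseteq> Dn n (K * (N + 1))"
      proof
        fix d assume "d \<in> supp (z t)"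
        then obtain c where c: "c \<in> supp x" "d = c + (g t + h)" by (auto simp: z_def supp_rm)
        have cZ: "c \<in> Zn n" using c(1) rideal_Alg[OF J x(1)] by (auto simp: Alg_def)
        have dZ: "d \<in> Zn n" unfolding c(2) by (rule sub_add[OF sub_Zn cZ ghZ])
        have bound: "0 \<le> d i \<and> d i \<le> int (2 * (K2 * (N + 1)))" if i: "i < n" for i
        proof -
          have K1i: "K1 i \<le> (\<Sum>i<n. K1 i)" by (rule member_le_sum) (use i in auto)
          have "\<bar>c i + g t i\<bar> \<le> int K0 + int (K1 i * N)"
            using K0[OF c(1) i] gbound[OF t, of i] by linarith
          also have "\<dots> = int (K0 + K1 i * N)" by simp
          also have "K0 + K1 i * N \<le> K2 * (N + 1)"
          proof -
            have "K0 + K1 i * N \<le> K0 * (N + 1) + (\<Sum>i<n. K1 i) * (N + 1)"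
              using K1i by (intro add_mono mult_mono) auto
            then show ?thesis by (simp only: K2_def add_mult_distrib)
          qed
          finally have "\<bar>c i + g t i\<bar> \<le> int (K2 * (N + 1))" by simp
          moreover have "d i = c i + g t i + int (K2 * (N + 1))" using i by (simp add: c(2) h_def)
          ultimately show ?thesis by linarith
        qed
        have dN: "d \<in> Nn n"
        proof -
          have "0 \<le> d i" for i using bound[of i] dZ by (cases "i < n") (auto simp: Zn_def)
          then show ?thesis using dZ by (simp add: Nn_def)
        qed
        have "deg n d \<le> (\<Sum>i<n. int (2 * (K2 * (N + 1))))"
          unfolding deg_def by (rule sum_mono) (use bound in auto)
        also have "\<dots> = int (2 * n * K2 * (N + 1))" by (simp add: algebra_simps)
        also have "\<dots> \<le> int (K * (N + 1))" unfolding K_def by (intro of_nat_mono mult_right_mono) auto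
        finally show "d \<in> Dn n (K * (N + 1))" using dN by (simp add: Dn_def)
      qed
    qed
    have indep: "\<forall>t\<in>P. c t = 0" if cI: "(\<Sum>t\<in>P. smul (c t) (z t)) \<in> I" for c
    proof -
      \<comment> \<open>The divisor \<open>\<tau> (g t) h\<close> offsets the factor arising when
        \<open>g t + h\<close> is split: x times s, translated by \<open>h\<close>, is exactly the
        given combination, so \<open>s\<close> lies in \<open>S\<close>.\<close>
      define s where "s = (\<Sum>t\<in>P. smul (c t / \<tau> (g t) h) (ind (g t)))"
      have sA: "s \<in> Alg (Zn n)" unfolding s_def by (intro Alg_sum Alg_smul Alg_ind gZ)
      have sC: "supp s \<subseteq> lat C"
      proof -
        have "s \<in> Alg (lat C)" unfolding s_def by (intro Alg_sum Alg_smul Alg_ind gC)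
        then show ?thesis by (simp add: Alg_def)
      qed
      have "rm (mul x s) h = (\<Sum>t\<in>P. smul (c t) (z t))"
        unfolding s_def mul_sum_ind[OF finP injg] rm_sum
        by (rule sum.cong) (simp_all add: rm_smul rm_rm z_def)
      then have "mul x s \<in> I" using cI rideal_rm_iff[OF sub_Zn I hZ] by metis
      then have "s = 0" using SC sA sC by (simp add: S_def)
      show ?thesis
      proof
        fix t assume t: "t \<in> P"
        have "s (g t) = (\<Sum>u\<in>P. if t = u then c u / \<tau> (g u) h else 0)"
          unfolding s_def sum_apply
          by (rule sum.cong) (use injg t in \<open>auto simp: ind_apply inj_on_eq_iff\<close>)
        then have "s (g t) = c t / \<tau> (g t) h" using t finP by simp
        then show "c t = 0" using \<open>s = 0\<close> by simp
      qed
    qed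
    show ?thesis
      unfolding cardP[symmetric]
      by (rule card_independent_mod_le[OF I J psubset_imp_subset[OF IJ] finP zJ indep])
  qed
  moreover have "K \<ge> 1" by (simp add: K_def)
  ultimately show ?thesis by blast
qed

text \<open>An interval is measured by its number of leading exponents up to degree
  \<open>N\<close>. By \<open>growth_lower\<close> a nonzero interval has growth exponent at least
  \<open>n - k\<close>, and every level of \<open>dev_le\<close> consumes one exponent. Multiplying
  by \<open>N\<close> shifts the exponent by one, so level 0 means growth below
  \<open>n - k\<close>, a trivial interval.\<close>

theorem dev_le_upper:
  assumes k: "k \<le> n"
    and H: "\<And>S. rideal (Zn n) S \<Longrightarrow> S \<noteq> Alg (Zn n) \<Longrightarrow> \<exists>C T. fs.subspace C \<and> C \<subseteq> Qn n \<and> finite T \<and> card T \<le> k \<and>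
      Qn n \<subseteq> fs.span (C \<union> T) \<and> (\<forall>x\<in>S. supp x \<subseteq> lat C \<longrightarrow> x = 0)"
  shows "dev_le {I. rideal (Zn n) I} {0} (Alg (Zn n)) (Suc k)"
proof -
  define h where "h I J N = card ((Ul n J - Ul n I) \<inter> Dn n N)" for I J :: "((nat \<Rightarrow> int) \<Rightarrow> 'a) set" and N
  have main: "dev_le {I. rideal (Zn n) I} I J j"
    if "rideal (Zn n) I" "rideal (Zn n) J" "I \<subseteq> J" "\<forall>N\<ge>1. h I J N * N \<le> K * N ^ (n - k + j)" for I J j K
    using that
  proof (induction j arbitrary: I J K)
    case 0
    have "I = J"
    proof (rule ccontr)
      assume "I \<noteq> J"
      then have "I \<subset> J" using 0 by blast
      from growth_lower[OF 0(1,2) this H] obtain K0 where K0: "K0 \<ge> 1" "\<And>N. (N + 1) ^ (n - k) \<le> h I J (K0 * (N + 1))"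
        unfolding h_def by blast
      \<comment> \<open>With this value the upper bound becomes
        \<open>(N + 1) ^ (n - k) * N\<close>, and comparison with the lower bound leaves
        \<open>K0 * (N + 1) \<le> N\<close>.\<close>
      define N where "N = K * K0 ^ (n - k)"
      have "(N + 1) ^ (n - k) * (K0 * (N + 1)) \<le> h I J (K0 * (N + 1)) * (K0 * (N + 1))"
        using K0(2)[of N] by (rule mult_right_mono) simp
      also have "\<dots> \<le> K * (K0 * (N + 1)) ^ (n - k)" using 0(4) K0(1) by simp
      also have "\<dots> = (N + 1) ^ (n - k) * N" by (simp only: N_def power_mult_distrib ac_simps)
      finally have "K0 * (N + 1) \<le> N" by simp
      moreover have "1 * (N + 1) \<le> K0 * (N + 1)" using K0(1) by (rule mult_right_mono) simp
      ultimately show False by simp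
    qed
    then show ?case by simp
  next
    case (Suc j)
    define m where "m = n - k + j"
    show ?case unfolding dev_le.simps
    proof (intro allI impI)
      fix f assume f: "f 0 \<subseteq> J \<and> (\<forall>i. f i \<in> {I. rideal (Zn n) I} \<and> I \<subseteq> f i \<and> f (Suc i) \<subseteq> f i)"
      have fJ: "f i \<subseteq> J" for i by (induction i) (use f in blast)+
      have fr: "rideal (Zn n) (f i)" for i using f by blast
      \<comment> \<open>Growth O(N^m) has room for finitely many cones of dimension
        \<open>m\<close>. A step without such a cone has growth lower by one exponent, with a
        constant of its own; hence \<open>K\<close> is arbitrary in the induction.\<close>
      have "finite {i. has_cone n m (Ul n (f i) - Ul n (f (Suc i)))}"
      proof (rule finite_cone_steps[of "\<lambda>i. Ul n (f i)" "Ul n J" "Ul n I" n K m])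
        show "Ul n (f (Suc i)) \<subseteq> Ul n (f i)" for i using f by (intro Ul_mono) blast
        show "Ul n (f i) \<subseteq> Ul n J" for i by (intro Ul_mono fJ)
        show "Ul n I \<subseteq> Ul n (f i)" for i using f by (intro Ul_mono) blast
        show "card ((Ul n J - Ul n I) \<inter> Dn n N) \<le> K * N ^ m" if N: "N \<ge> 1" for N
        proof -
          have "h I J N * N \<le> (K * N ^ m) * N" using Suc.prems(4) N by (simp add: m_def ac_simps)
          then have "h I J N \<le> K * N ^ m" using N by simp
          then show ?thesis by (simp add: h_def)
        qed
      qed
      then obtain N where N: "\<And>i. has_cone n m (Ul n (f i) - Ul n (f (Suc i))) \<Longrightarrow> i < N"
        using finite_nat_set_iff_bounded by auto
      have "dev_le {I. rideal (Zn n) I} (f (Suc i)) (f i) j" if "i \<ge> N" for i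
      proof -
        have "\<not> has_cone n m (Ul n (f i) - Ul n (f (Suc i)))" using N[of i] that by auto
        from upset_diff_dichotomy[OF Ul_upset[OF fr] Ul_upset[OF fr] this]
        obtain K' where "\<forall>N\<ge>1. h (f (Suc i)) (f i) N * N \<le> K' * N ^ (n - k + j)"
          unfolding h_def m_def by blast
        then show ?thesis using Suc.IH[OF fr fr, of "Suc i" i] f by blast
      qed
      then show "\<exists>N. \<forall>i\<ge>N. dev_le {I. rideal (Zn n) I} (f (Suc i)) (f i) j" by blast
    qed
  qed
  have "h {0} (Alg (Zn n)) N * N \<le> 2 ^ n * N ^ (n - k + Suc k)" if N: "N \<ge> 1" for N
  proof -
    have "h {0} (Alg (Zn n)) N \<le> card (Dn n N)"
      unfolding h_def by (rule card_mono[OF finite_Dn]) blast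
    also have "\<dots> \<le> (N + 1) ^ n" by (rule card_Dn_le)
    also have "\<dots> \<le> (2 * N) ^ n" using N by (intro power_mono) auto
    finally have "h {0} (Alg (Zn n)) N * N \<le> (2 * N) ^ n * N" by simp
    also have "\<dots> = 2 ^ n * N ^ (n - k + Suc k)" using k by (simp add: power_mult_distrib)
    finally show ?thesis .
  qed
  then show ?thesis
    by (intro main[of _ _ "2 ^ n"] rideal_zero rideal_whole[OF sub_Zn]) auto
qed

end

section \<open>Lower bound for the deviation\<close>

text \<open>The step is invertible, so the recursion can be run from 0 in both directions.\<close>

lemma int_recursion:
  fixes z :: 'b
  assumes "\<And>t x. \<psi> t (\<phi> t x) = x" "\<And>t x. \<phi> t (\<psi> t x) = x"
  shows "\<exists>d. d (0::int) = z \<and> (\<forall>t. d (t + 1) = \<phi> t (d t))"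
proof -
  define up where "up = rec_nat z (\<lambda>k. \<phi> (int k))"
  define down where "down = rec_nat z (\<lambda>k. \<psi> (- int k - 1))"
  define d where "d t = (if t \<ge> 0 then up (nat t) else down (nat (- t)))" for t :: int
  have "d (t + 1) = \<phi> t (d t)" for t
  proof (cases "t \<ge> 0")
    case True
    then have "nat (t + 1) = Suc (nat t)" by simp
    then show ?thesis using True by (simp add: d_def up_def)
  next
    case False
    define k where "k = nat (- t - 1)"
    have k: "nat (- t) = Suc k" "t = - int k - 1" "nat (- (t + 1)) = k" using False by (auto simp: k_def)
    have 1: "\<phi> t (d t) = down k"
      using False k(1,2) assms(2) by (simp add: d_def down_def)
    have 2: "d (t + 1) = down k"
    proof (cases "t = - 1")
      case True
      then show ?thesis by (simp add: d_def up_def down_def k_def)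
    next
      case f: False
      then show ?thesis using False k(3) by (simp add: d_def)
    qed
    show ?thesis using 1 2 by simp
  qed
  moreover have "d 0 = z" by (simp add: d_def up_def)
  ultimately show ?thesis by blast
qed

text \<open>Functions behaving like the binomial coefficients of \<open>a\<close> over
  \<open>e\<close>, for negative \<open>a\<close> too. Taking antidifferences repeatedly avoids
  division by factorials, so every characteristic is allowed.\<close>

lemma binomial_family:
  "\<exists>\<beta> :: int \<Rightarrow> int \<Rightarrow> 'a::field. (\<forall>a. \<beta> 0 a = 1) \<and> (\<forall>e a. e < 0 \<longrightarrow> \<beta> e a = 0) \<and>
    (\<forall>e a. \<beta> e (a + 1) = \<beta> e a + \<beta> (e - 1) a)"
proof -
  have ex: "\<exists>F :: int \<Rightarrow> 'a. \<forall>a. F (a + 1) = F a + f a" for f :: "int \<Rightarrow> 'a"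
    using int_recursion[of "\<lambda>t x. x - f t" "\<lambda>t x. x + f t" 0] by auto
  define B :: "nat \<Rightarrow> int \<Rightarrow> 'a" where
    "B = rec_nat (\<lambda>_. 1) (\<lambda>_ f. SOME F. \<forall>a. F (a + 1) = F a + f a)"
  have BS: "B (Suc k) (a + 1) = B (Suc k) a + B k a" for k a
    using someI_ex[OF ex[of "B k"]] by (simp add: B_def)
  define \<beta> where "\<beta> e = (if e < 0 then \<lambda>_. 0 else B (nat e))" for e :: int
  have "\<beta> e (a + 1) = \<beta> e a + \<beta> (e - 1) a" for e a
  proof (cases "e > 0")
    case True
    then obtain k where "nat e = Suc k" "nat (e - 1) = k" using that[of "nat (e - 1)"] by auto
    then show ?thesis using BS[of k a] True by (simp add: \<beta>_def)
  next
    case False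
    then show ?thesis by (cases "e = 0") (auto simp: \<beta>_def B_def)
  qed
  moreover have "\<beta> 0 a = 1" for a by (simp add: \<beta>_def B_def)
  ultimately show ?thesis by (intro exI[of _ \<beta>]) (auto simp: \<beta>_def)
qed

text \<open>The second cohomology of the infinite cyclic group vanishes: a solution for
  \<open>t = 1\<close> extends to all \<open>t\<close> by induction in both directions.\<close>

lemma int_cocycle_coboundary:
  fixes \<sigma> :: "int \<Rightarrow> int \<Rightarrow> 'a::field"
  assumes "twisted \<sigma>"
  shows "\<exists>d. (\<forall>t. d t \<noteq> 0) \<and> (\<forall>s t. \<sigma> s t * d (s + t) = d s * d t)"
proof -
  interpret twisted \<sigma> by fact
  \<comment> \<open>The case \<open>t = 0\<close> forces \<open>d 0\<close>; the recursion is the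
    case \<open>t = 1\<close> with \<open>d 1\<close> normalised to 1.\<close>
  obtain d where d: "d 0 = \<sigma> 0 0" "\<And>t. d (t + 1) = d t / \<sigma> t 1"
    using int_recursion[of "\<lambda>t x. x * \<sigma> t 1" "\<lambda>t x. x / \<sigma> t 1" "\<sigma> 0 0"] by auto
  have d': "d (t - 1) = d t * \<sigma> (t - 1) 1" for t using d(2)[of "t - 1"] by simp
  have nz: "d t \<noteq> 0" for t
    by (induction t rule: int_induct[of _ 0]) (simp_all add: d d')
  have "\<forall>s. \<sigma> s t * d (s + t) = d s * d t" for t
  proof (induction t rule: int_induct[of _ 0])
    case base
    show ?case
    proof
      fix s
      show "\<sigma> s 0 * d (s + 0) = d s * d 0" using tau_right_0[of s] by (simp add: d(1))
    qed
  next
    case (step1 t)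
    show ?case
    proof
      fix s
      have c: "\<sigma> s t * \<sigma> (s + t) 1 = \<sigma> t 1 * \<sigma> s (t + 1)" by (rule coc)
      have e: "\<sigma> s t * d (s + t) = d s * d t" using step1 by blast
      have "\<sigma> s (t + 1) * d (s + t) * \<sigma> t 1 = (\<sigma> s t * \<sigma> (s + t) 1) * d (s + t)"
        unfolding c by (simp only: ac_simps)
      also have "\<dots> = d s * d t * \<sigma> (s + t) 1" unfolding e[symmetric] by (simp only: ac_simps)
      finally have "\<sigma> s (t + 1) * (d (s + t) / \<sigma> (s + t) 1) = d s * (d t / \<sigma> t 1)"
        by (simp add: frac_eq_eq)
      then show "\<sigma> s (t + 1) * d (s + (t + 1)) = d s * d (t + 1)"
        by (simp only: d(2) add.assoc[symmetric])
    qed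
  next
    case (step2 t)
    show ?case
    proof
      fix s
      have c: "\<sigma> s (t - 1) * \<sigma> (s + t - 1) 1 = \<sigma> (t - 1) 1 * \<sigma> s t"
        using coc[of s "t - 1" 1] by (simp add: algebra_simps)
      have e: "\<sigma> s t * d (s + t) = d s * d t" using step2 by blast
      have "\<sigma> s (t - 1) * d (s + t - 1) = (\<sigma> s (t - 1) * \<sigma> (s + t - 1) 1) * d (s + t)"
        by (simp only: d' ac_simps)
      also have "\<dots> = (\<sigma> s t * d (s + t)) * \<sigma> (t - 1) 1" unfolding c by (simp only: ac_simps)
      also have "\<dots> = d s * d (t - 1)" unfolding e by (simp only: d' ac_simps)
      finally show "\<sigma> s (t - 1) * d (s + (t - 1)) = d s * d (t - 1)" by (simp only: add_diff_eq)
    qed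
  qed
  then show ?thesis using nz by blast
qed

text \<open>Compares coefficients in (x y)(x' y') = (x x')(y y'), valid in a commutative twisted
  algebra.\<close>

lemma (in twisted) symmetric_interchange:
  assumes sym: "\<And>a b. \<tau> a b = \<tau> b a"
  shows "\<tau> (x + y) (x' + y') * \<tau> x y * \<tau> x' y' = \<tau> x x' * \<tau> y y' * \<tau> (x + x') (y + y')"
proof -
  have 1: "\<tau> x y * \<tau> (x + y) (x' + y') = \<tau> y (x' + y') * \<tau> x (y + (x' + y'))" by (rule coc)
  have 2: "\<tau> y x' * \<tau> (y + x') y' = \<tau> x' y' * \<tau> y (x' + y')" by (rule coc)
  have 3: "\<tau> x' y * \<tau> (x' + y) y' = \<tau> y y' * \<tau> x' (y + y')" by (rule coc)
  have 4: "\<tau> x x' * \<tau> (x + x') (y + y') = \<tau> x' (y + y') * \<tau> x (x' + (y + y'))" by (rule coc)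
  have 5: "x' + (y + y') = y + (x' + y')" by (simp add: ac_simps)
  have 6: "\<tau> x' y' * \<tau> y (x' + y') = \<tau> y y' * \<tau> x' (y + y')"
    using 2 3 sym[of y x'] by (simp add: add.commute)
  have "\<tau> (x + y) (x' + y') * \<tau> x y * \<tau> x' y' = (\<tau> x' y' * \<tau> y (x' + y')) * \<tau> x (y + (x' + y'))"
    using 1 by (simp add: ac_simps)
  also have "\<dots> = \<tau> y y' * (\<tau> x' (y + y') * \<tau> x (x' + (y + y')))"
    unfolding 6 5 by (simp add: ac_simps)
  also have "\<dots> = \<tau> x x' * \<tau> y y' * \<tau> (x + x') (y + y')" unfolding 4[symmetric] by (simp add: ac_simps)
  finally show ?thesis .
qed

text \<open>\<open>c\<close> gives the values on basis elements of a character of the commutative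
  algebra; dividing basis elements by them turns it into an ordinary group algebra. Coordinates are
  added one at a time.\<close>

lemma (in twistedZ) symmetric_coboundary:
  assumes sym: "\<And>a b. \<tau> a b = \<tau> b a"
  shows "\<exists>c. (\<forall>a. c a \<noteq> 0) \<and> (\<forall>a\<in>Zn r. \<forall>b\<in>Zn r. \<tau> a b * c (a + b) = c a * c b)"
proof (induction r)
  case 0
  have "a = 0" if "a \<in> Zn 0" for a using that by (simp add: Zn_def fun_eq_iff)
  then show ?case by (intro exI[of _ "\<lambda>_. \<tau> 0 0"]) auto
next
  case (Suc r)
  then obtain c where c: "\<And>a. c a \<noteq> 0" "\<And>a b. a \<in> Zn r \<Longrightarrow> b \<in> Zn r \<Longrightarrow> \<tau> a b * c (a + b) = c a * c b"
    by blast
  define \<epsilon> where "\<epsilon> t = (\<lambda>j. if j = r then t else 0)" for t :: int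
  have \<epsilon>_add: "\<epsilon> (s + t) = \<epsilon> s + \<epsilon> t" for s t by (auto simp: \<epsilon>_def fun_eq_iff)
  have "twisted (\<lambda>s t. \<tau> (\<epsilon> s) (\<epsilon> t))"
    by unfold_locales (auto simp: \<epsilon>_add intro: coc)
  then obtain d where d: "\<And>t. d t \<noteq> 0" "\<And>s t. \<tau> (\<epsilon> s) (\<epsilon> t) * d (s + t) = d s * d t"
    using int_cocycle_coboundary by blast
  define p where "p a = a(r := 0)" for a :: "nat \<Rightarrow> int"
  have p_add: "p (a + b) = p a + p b" for a b by (auto simp: p_def fun_eq_iff)
  have split: "a = p a + \<epsilon> (a r)" for a by (auto simp: p_def \<epsilon>_def fun_eq_iff)
  have pZ: "p a \<in> Zn r" if "a \<in> Zn (Suc r)" for a using that by (auto simp: p_def Zn_def)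
  \<comment> \<open>Forced by factoring the basis element of \<open>a\<close> into those of
    \<open>p a\<close> and \<open>\<epsilon> (a r)\<close>, up to the cocycle value in the
    denominator.\<close>
  define c' where "c' a = c (p a) * d (a r) / \<tau> (p a) (\<epsilon> (a r))" for a
  have "\<tau> a b * c' (a + b) = c' a * c' b" if "a \<in> Zn (Suc r)" "b \<in> Zn (Suc r)" for a b
  proof -
    define x y x' y' where "x = p a" and "y = \<epsilon> (a r)" and "x' = p b" and "y' = \<epsilon> (b r)"
    have ab: "a = x + y" "b = x' + y'" using split x_def y_def x'_def y'_def by auto
    have E: "\<tau> a b * \<tau> x y * \<tau> x' y' = \<tau> x x' * \<tau> y y' * \<tau> (x + x') (y + y')"
      unfolding ab by (rule symmetric_interchange[OF sym])
    have c'ab: "c' (a + b) = c (x + x') * d (a r + b r) / \<tau> (x + x') (y + y')"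
      by (simp add: c'_def p_add \<epsilon>_add x_def x'_def y_def y'_def)
    have cc: "\<tau> x x' * c (x + x') = c x * c x'" using c(2) pZ that by (simp add: x_def x'_def)
    have dd: "\<tau> y y' * d (a r + b r) = d (a r) * d (b r)" using d(2) by (simp add: y_def y'_def)
    have "\<tau> a b * c' (a + b) * (\<tau> x y * \<tau> x' y' * \<tau> (x + x') (y + y'))
        = (\<tau> a b * \<tau> x y * \<tau> x' y') * (c (x + x') * d (a r + b r))"
      unfolding c'ab by (simp add: field_simps)
    also have "\<dots> = (\<tau> x x' * c (x + x')) * (\<tau> y y' * d (a r + b r)) * \<tau> (x + x') (y + y')"
      unfolding E by (simp add: ac_simps)
    also have "\<dots> = c' a * c' b * (\<tau> x y * \<tau> x' y' * \<tau> (x + x') (y + y'))"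
      unfolding cc dd c'_def x_def[symmetric] x'_def[symmetric] y_def[symmetric] y'_def[symmetric]
      by (simp add: field_simps)
    finally show ?thesis by simp
  qed
  moreover have "c' a \<noteq> 0" for a using c(1) d(1) by (simp add: c'_def)
  ultimately show ?case by blast
qed

lemma lex_less_trans: "lex_less a b \<Longrightarrow> lex_less b c \<Longrightarrow> lex_less a c"
  by (induction a b arbitrary: c rule: lex_less.induct) (case_tac c; auto)+

lemma lex_less_nth: "lex_less a b \<Longrightarrow> length a = length b \<Longrightarrow> \<exists>i<length a. a ! i < b ! i"
proof (induction a b rule: lex_less.induct)
  case (1 x xs y ys)
  then show ?case by (cases "x < y") (auto intro: exI[of _ 0] exI[of _ "Suc _"])
qed auto

context twistedZ
begin

definition lmul :: "(nat \<Rightarrow> int) \<Rightarrow> ((nat \<Rightarrow> int) \<Rightarrow> 'a) \<Rightarrow> (nat \<Rightarrow> int) \<Rightarrow> 'a" where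
  "lmul v x = (\<lambda>g. \<tau> v (g - v) * x (g - v))"

lemma supp_lmul: "supp (lmul v x) = (\<lambda>g. g + v) ` supp x"
proof -
  have "g \<in> (\<lambda>g. g + v) ` supp x" if "x (g - v) \<noteq> 0" for g
    by (rule image_eqI[of _ _ "g - v"]) (use that in \<open>auto simp: supp_def\<close>)
  then show ?thesis by (auto simp: supp_def lmul_def)
qed

lemma rm_lmul: "rm (lmul v x) a = lmul v (rm x a)"
proof
  fix g
  have "\<tau> v (g - v - a) * \<tau> (v + (g - v - a)) a = \<tau> (g - v - a) a * \<tau> v (g - v - a + a)" by (rule coc)
  then have c: "\<tau> v (g - v - a) * \<tau> (g - a) a = \<tau> (g - v - a) a * \<tau> v (g - v)" by (simp add: algebra_simps)
  have "g - a - v = g - v - a" by (simp add: algebra_simps)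
  then have "rm (lmul v x) a g = (\<tau> v (g - v - a) * \<tau> (g - a) a) * x (g - v - a)"
    by (simp only: rm_def lmul_def ac_simps)
  also have "\<dots> = lmul v (rm x a) g" unfolding c by (simp only: rm_def lmul_def ac_simps)
  finally show "rm (lmul v x) a g = lmul v (rm x a) g" .
qed

text \<open>Left multiplication by \<open>k\<close> times the basis element of \<open>v\<close>,
  minus the identity. Acting from the left, it commutes with the right module structure.\<close>

definition shift :: "(nat \<Rightarrow> int) \<Rightarrow> 'a \<Rightarrow> ((nat \<Rightarrow> int) \<Rightarrow> 'a) \<Rightarrow> (nat \<Rightarrow> int) \<Rightarrow> 'a" where
  "shift v k x = smul k (lmul v x) + smul (- 1) x"

lemma Alg_shift: "sub G \<Longrightarrow> v \<in> G \<Longrightarrow> x \<in> Alg G \<Longrightarrow> shift v k x \<in> Alg G"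
  unfolding shift_def
  by (intro Alg_add Alg_smul) (auto simp: Alg_def supp_lmul intro: sub_add)

lemma rm_shift: "rm (shift v k x) a = shift v k (rm x a)"
  by (simp only: shift_def rm_add rm_smul rm_lmul)

text \<open>Once the cocycle is trivialised on the sublattice spanned by the \<open>v i\<close>,
  left multiplications by z_i - 1 behave as for Laurent polynomials. The functionals
  \<open>\<Phi> e\<close> are adapted to their monomials: composing with \<open>P i\<close> lowers
  the index \<open>e\<close> by one at \<open>i\<close>, and a negative index gives 0.\<close>

theorem not_dev_le_if_commuting:
  assumes vZ: "\<And>i. i < r \<Longrightarrow> v i \<in> Zn n"
    and comm: "\<And>i j. i < r \<Longrightarrow> j < r \<Longrightarrow> lam (v i) (v j) = 1"
    and inj: "inj_on (\<lambda>a. \<Sum>i<r. zs (a i) (v i)) (Zn r)"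
  shows "\<not> dev_le {I. rideal (Zn n) I} {0} (Alg (Zn n)) r"
proof -
  define V where "V a = (\<Sum>i<r. zs (a i) (v i))" for a :: "nat \<Rightarrow> int"
  have V_add: "V (a + b) = V a + V b" for a b
    by (auto simp: V_def fun_eq_iff sum_apply distrib_right sum.distrib)
  have V_neg: "V (- a) = - V a" for a by (auto simp: V_def fun_eq_iff sum_apply sum_negf)
  have V_diff: "V (a - b) = V a - V b" for a b using V_add[of a "- b"] V_neg[of b] by simp
  have V_0: "V 0 = 0" by (auto simp: V_def fun_eq_iff sum_apply)
  have V_ind: "V (ind i) = v i" if "i < r" for i
  proof
    fix j
    have "V (ind i) j = (\<Sum>l<r. if i = l then v l j else 0)"
      unfolding V_def sum_apply by (rule sum.cong) (auto simp: ind_apply)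
    then show "V (ind i) j = v i j" using that by simp
  qed
  have injV: "inj_on V (Zn r)" using inj by (simp add: V_def[abs_def])
  have lam_V: "lam g (V a) = 1" if "\<And>i. i < r \<Longrightarrow> lam g (v i) = 1" for g a
  proof -
    have z: "lam g (zs m b) = 1" if b: "lam g b = 1" for m b
    proof (cases m)
      case (nonneg k)
      then show ?thesis by (simp only: nonneg lam_zs b power_one)
    next
      case (neg k)
      have "zs m b = - zs (int (Suc k)) b" unfolding neg by (simp add: fun_eq_iff algebra_simps)
      then show ?thesis by (simp only: lam_neg_right lam_zs b power_one inverse_1)
    qed
    have "lam g (\<Sum>i\<in>S. zs (a i) (v i)) = 1" if "finite S" "S \<subseteq> {..<r}" for S
      using that
    proof (induction S rule: finite_induct)
      case empty
      then show ?case by (simp only: sum.empty lam_0_right)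
    next
      case (insert i S)
      then have "lam g (zs (a i) (v i)) = 1" using z \<open>\<And>i. i < r \<Longrightarrow> lam g (v i) = 1\<close> by simp
      moreover have "lam g (\<Sum>i\<in>S. zs (a i) (v i)) = 1" using insert by blast
      ultimately show ?case by (simp only: sum.insert[OF insert(1,2)] lam_add_right mult_1_left)
    qed
    then show ?thesis unfolding V_def by blast
  qed
  have "lam (V a) (V b) = 1" for a b
  proof (rule lam_V)
    fix j assume j: "j < r"
    have "lam (v j) (V a) = 1" by (rule lam_V) (use comm j in blast)
    then show "lam (V a) (v j) = 1" unfolding lam_swap[of "V a"] by simp
  qed
  then have sym: "\<tau> (V a) (V b) = \<tau> (V b) (V a)" for a b
    by (simp add: lam_def)
  interpret pull: twistedZ "\<lambda>a b. \<tau> (V a) (V b)"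
    by unfold_locales (auto simp: V_add intro: coc)
  obtain c where c: "\<And>a. c a \<noteq> 0" "\<And>a b. a \<in> Zn r \<Longrightarrow> b \<in> Zn r \<Longrightarrow> \<tau> (V a) (V b) * c (a + b) = c a * c b"
    using pull.symmetric_coboundary[OF sym, of r] by blast
  obtain \<beta> :: "int \<Rightarrow> int \<Rightarrow> 'a" where \<beta>: "\<And>a. \<beta> 0 a = 1" "\<And>e a. e < 0 \<Longrightarrow> \<beta> e a = 0"
    "\<And>e a. \<beta> e (a + 1) = \<beta> e a + \<beta> (e - 1) a"
    using binomial_family by blast
  define \<psi> where "\<psi> e a = (\<Prod>i<r. \<beta> (e i) (a i))" for e a :: "nat \<Rightarrow> int"
  have \<psi>_step: "\<psi> e (a + ind i) = \<psi> e a + \<psi> (e - ind i) a" if i: "i < r" for e a i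
  proof -
    have rem: "(\<Prod>j<r. f j) = f i * (\<Prod>j\<in>{..<r} - {i}. f j)" for f :: "nat \<Rightarrow> 'a"
      using i by (simp add: prod.remove)
    have o1: "(\<Prod>j\<in>{..<r} - {i}. \<beta> (e j) ((a + ind i) j)) = (\<Prod>j\<in>{..<r} - {i}. \<beta> (e j) (a j))"
      by (rule prod.cong) (auto simp: ind_apply)
    have o2: "(\<Prod>j\<in>{..<r} - {i}. \<beta> ((e - ind i) j) (a j)) = (\<Prod>j\<in>{..<r} - {i}. \<beta> (e j) (a j))"
      by (rule prod.cong) (auto simp: ind_apply)
    show ?thesis
      unfolding \<psi>_def rem o1 o2 by (simp add: ind_apply \<beta>(3) distrib_right)
  qed
  have \<psi>_neg: "\<psi> e a = 0" if "i < r" "e i < 0" for e a i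
    unfolding \<psi>_def by (rule prod_zero) (use that \<beta>(2) in auto)
  define Vi where "Vi = inv_into (Zn r) V"
  have Vi: "Vi (V a) = a" if "a \<in> Zn r" for a unfolding Vi_def using injV that by (rule inv_into_f_f)
  \<comment> \<open>Weights of the functional: zero off the sublattice, and on it a product of
    binomial coefficients, with \<open>c\<close> absorbing the cocycle.\<close>
  define W where "W e g = (if g \<in> V ` Zn r then c (Vi g) * \<psi> e (Vi g) else 0)" for e g
  have W_V: "W e (V a) = c a * \<psi> e a" if "a \<in> Zn r" for e a using that Vi by (simp add: W_def)
  have indZ: "ind i \<in> Zn r" if "i < r" for i using that by (auto simp: Zn_def ind_apply)
  have W_step: "\<tau> (v i) g * W e (g + v i) = c (ind i) * (W e g + W (e - ind i) g)" if i: "i < r" for i g e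
  proof (cases "g \<in> V ` Zn r")
    case True
    then obtain a where a: "a \<in> Zn r" "g = V a" by blast
    have aZ: "a + ind i \<in> Zn r" by (rule sub_add[OF sub_Zn a(1) indZ[OF i]])
    have g: "g + v i = V (a + ind i)" using a V_add V_ind[OF i] by simp
    have cc: "\<tau> (v i) g * c (a + ind i) = c (ind i) * c a"
      using c(2)[OF indZ[OF i] a(1)] by (simp only: V_ind[OF i] a(2) add.commute)
    have "\<tau> (v i) g * W e (g + v i) = (\<tau> (v i) g * c (a + ind i)) * \<psi> e (a + ind i)"
      by (simp only: g W_V[OF aZ] mult.assoc)
    also have "\<dots> = c (ind i) * (c a * \<psi> e a + c a * \<psi> (e - ind i) a)"
      unfolding cc \<psi>_step[OF i] by (simp only: mult.assoc distrib_left)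
    finally show ?thesis by (simp only: W_V[OF a(1)] a(2))
  next
    case False
    have "g + v i \<notin> V ` Zn r"
    proof
      assume "g + v i \<in> V ` Zn r"
      then obtain a where a: "a \<in> Zn r" "g + v i = V a" by blast
      then have "g = V (a - ind i)" using V_diff V_ind[OF i] by (metis add_diff_cancel_right')
      then show False using False sub_diff[OF sub_Zn a(1) indZ[OF i]] by blast
    qed
    then show ?thesis using False by (simp add: W_def)
  qed
  define \<Phi> where "\<Phi> e x = (\<Sum>g\<in>supp x. x g * W e g)" for e x
  have \<Phi>_eq: "\<Phi> e x = (\<Sum>g\<in>S. x g * W e g)" if "finite S" "supp x \<subseteq> S" for e x S
    unfolding \<Phi>_def by (rule sum.mono_neutral_left) (use that in \<open>auto simp: supp_def\<close>)
  have \<Phi>_add: "\<Phi> e (x + y) = \<Phi> e x + \<Phi> e y" if "x \<in> Alg (Zn n)" "y \<in> Alg (Zn n)" for e x y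
  proof -
    have fin: "finite (supp x \<union> supp y)" using that by (simp add: Alg_def)
    show ?thesis
      unfolding \<Phi>_eq[OF fin supp_add] \<Phi>_eq[OF fin Un_upper1] \<Phi>_eq[OF fin Un_upper2]
      by (simp add: sum.distrib distrib_right)
  qed
  have \<Phi>_smul: "\<Phi> e (smul k x) = k * \<Phi> e x" if "x \<in> Alg (Zn n)" for e x k
  proof -
    have fin: "finite (supp x)" using that by (simp add: Alg_def)
    have "\<Phi> e (smul k x) = (\<Sum>g\<in>supp x. smul k x g * W e g)" by (rule \<Phi>_eq[OF fin supp_smul])
    also have "\<dots> = k * \<Phi> e x" unfolding \<Phi>_def by (simp add: sum_distrib_left mult.assoc)
    finally show ?thesis .
  qed
  \<comment> \<open>Dividing by the character value \<open>c (ind i)\<close> normalises the basis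
    element of \<open>v i\<close> to a z_i of value 1, and \<open>P i\<close> multiplies by z_i -
    1.\<close>
  define P where "P i = shift (v i) (inverse (c (ind i)))" for i
  have PA: "P i x \<in> Alg (Zn n)" if "i < r" "x \<in> Alg (Zn n)" for i x
    unfolding P_def using that by (intro Alg_shift[OF sub_Zn] vZ)
  have \<Phi>_P: "\<Phi> e (P i x) = \<Phi> (e - ind i) x" if i: "i < r" and x: "x \<in> Alg (Zn n)" for e i x
  proof -
    have LA: "lmul (v i) x \<in> Alg (Zn n)"
      using x vZ[OF i] by (auto simp: Alg_def supp_lmul intro: sub_add[OF sub_Zn])
    have "\<Phi> e (lmul (v i) x) = (\<Sum>g\<in>supp x. x g * (\<tau> (v i) g * W e (g + v i)))"
      unfolding \<Phi>_def supp_lmul by (simp add: sum.reindex inj_on_def lmul_def ac_simps)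
    also have "\<dots> = c (ind i) * (\<Phi> e x + \<Phi> (e - ind i) x)"
      unfolding W_step[OF i] \<Phi>_def sum_distrib_left sum.distrib[symmetric]
      by (rule sum.cong) (simp_all add: algebra_simps)
    finally have L: "\<Phi> e (lmul (v i) x) = c (ind i) * (\<Phi> e x + \<Phi> (e - ind i) x)" .
    have "\<Phi> e (P i x) = inverse (c (ind i)) * \<Phi> e (lmul (v i) x) + - 1 * \<Phi> e x"
      unfolding P_def shift_def using x LA by (simp only: \<Phi>_add \<Phi>_smul Alg_smul)
    also have "\<dots> = \<Phi> (e - ind i) x"
      unfolding L using c(1)[of "ind i"] by (simp add: mult.assoc[symmetric])
    finally show ?thesis .
  qed
  have PpA: "(P i ^^ k) x \<in> Alg (Zn n)" if "i < r" "x \<in> Alg (Zn n)" for i x k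
    using that by (induction k) (auto intro: PA)
  have \<Phi>_Pp: "\<Phi> e ((P i ^^ k) x) = \<Phi> (e - zs (int k) (ind i)) x" if i: "i < r" and x: "x \<in> Alg (Zn n)" for e i x k
  proof (induction k arbitrary: e)
    case 0
    have "e - zs (int 0) (ind i) = e" by (simp add: fun_eq_iff)
    then show ?case by (simp only: funpow_0)
  next
    case (Suc k)
    have "\<Phi> e ((P i ^^ Suc k) x) = \<Phi> (e - ind i - zs (int k) (ind i)) x"
      by (simp only: funpow.simps o_apply \<Phi>_P[OF i PpA[OF i x]] Suc)
    moreover have "e - ind i - zs (int k) (ind i) = e - zs (int (Suc k)) (ind i)"
      by (simp add: fun_eq_iff algebra_simps)
    ultimately show ?case by (simp only:)
  qed
  define pw where "pw e s x = rec_nat x (\<lambda>i y. (P i ^^ (e ! i)) y) s" for e :: "nat list" and s x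
  have pw_0: "pw e 0 x = x" and pw_Suc: "pw e (Suc s) x = (P s ^^ (e ! s)) (pw e s x)" for e s x
    by (simp_all add: pw_def)
  define idx where "idx e s = (\<lambda>i. if i < s then int (e ! i) else 0)" for e :: "nat list" and s :: nat
  have pwA: "pw e s x \<in> Alg (Zn n)" if "s \<le> r" "x \<in> Alg (Zn n)" for e s x
    using that by (induction s) (auto simp: pw_0 pw_Suc intro: PpA)
  have \<Phi>_pw: "\<Phi> f (pw e s x) = \<Phi> (f - idx e s) x" if "s \<le> r" "x \<in> Alg (Zn n)" for e s x f
    using that
  proof (induction s arbitrary: f)
    case 0
    have "f - idx e 0 = f" by (simp add: idx_def fun_eq_iff)
    then show ?case by (simp only: pw_0)
  next
    case (Suc s)
    have "\<Phi> f (pw e (Suc s) x) = \<Phi> (f - zs (int (e ! s)) (ind s) - idx e s) x"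
    proof -
      have s: "s < r" "s \<le> r" using Suc.prems(1) by auto
      show ?thesis
        by (simp only: pw_Suc \<Phi>_Pp[OF s(1) pwA[OF s(2) Suc.prems(2)]] Suc.IH[OF s(2) Suc.prems(2)])
    qed
    moreover have "f - zs (int (e ! s)) (ind s) - idx e s = f - idx e (Suc s)"
      by (auto simp: fun_eq_iff idx_def ind_apply less_Suc_eq)
    ultimately show ?case by (simp only:)
  qed
  have rm_Pp: "rm ((P i ^^ k) x) a = (P i ^^ k) (rm x a)" for i k x a
    by (induction k) (simp_all add: P_def rm_shift)
  have rm_pw: "rm (pw e s x) a = pw e s (rm x a)" for e s x a
    by (induction s) (simp_all add: pw_0 pw_Suc rm_Pp)
  txt \<open>\<open>\<Phi> (idx e r)\<close> extracts the coefficient of \<open>\<Prod> (z\<^sub>i - 1)\<^bsup>e i\<^esup>\<close> in the expansion at \<open>z = 1\<close>,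
    so \<open>J e\<close> consists of the elements whose expansion starts at \<open>e\<close> or later.\<close>
  define J where "J e = {x \<in> Alg (Zn n). \<forall>e'. length e' = r \<and> lex_less e' e \<longrightarrow> (\<forall>a\<in>Zn n. \<Phi> (idx e' r) (rm x a) = 0)}" for e
  have J_ideal: "rideal (Zn n) (J e)" for e
    unfolding rideal_def
  proof (intro conjI ballI allI)
    show "J e \<subseteq> Alg (Zn n)" by (auto simp: J_def)
    show "0 \<in> J e" by (auto simp: J_def \<Phi>_def supp_def)
  next
    fix x y assume "x \<in> J e" "y \<in> J e"
    then show "x + y \<in> J e"
      using \<Phi>_add[OF Alg_rm[OF sub_Zn] Alg_rm[OF sub_Zn]] by (auto simp: J_def rm_add intro: Alg_add)
  next
    fix x k assume "x \<in> J e"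
    then show "smul k x \<in> J e"
      using \<Phi>_smul[OF Alg_rm[OF sub_Zn]] by (auto simp: J_def rm_smul intro: Alg_smul)
  next
    fix x b assume "x \<in> J e" "b \<in> Zn n"
    then show "rm x b \<in> J e"
      using \<Phi>_smul[OF Alg_rm[OF sub_Zn]] by (auto simp: J_def rm_rm sub_add[OF sub_Zn] intro: Alg_rm[OF sub_Zn])
  qed
  have one: "(ind 0 :: _ \<Rightarrow> 'a) \<in> Alg (Zn n)" by (rule Alg_ind[OF sub_0[OF sub_Zn]])
  \<comment> \<open>Up to a scalar the product of the powers of z_i - 1 with exponents
    \<open>e\<close>. It lies in \<open>J e\<close> but in no \<open>J e'\<close> with
    \<open>e'\<close> later, because the functional of index \<open>e\<close> takes the value
    \<open>c 0\<close> on it.\<close>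
  define x where "x e = pw e r (ind 0)" for e
  have xA: "x e \<in> Alg (Zn n)" for e unfolding x_def by (rule pwA[OF _ one]) simp
  have x_in: "x e \<in> J e" if e: "length e = r" for e
  proof -
    have "\<Phi> (idx e' r) (rm (x e) a) = 0" if e': "length e' = r" "lex_less e' e" and a: "a \<in> Zn n" for e' a
    proof -
      have "\<Phi> (idx e' r) (rm (x e) a) = \<Phi> (idx e' r - idx e r) (rm (ind 0) a)"
        unfolding x_def rm_pw using \<Phi>_pw[OF _ Alg_rm[OF sub_Zn one a], of r] by simp
      \<comment> \<open>A lexicographically smaller list is smaller in some coordinate, where the
        difference of indices is negative and the functional vanishes.\<close>
      moreover obtain i where i: "i < r" "e' ! i < e ! i" using lex_less_nth[OF e'(2)] e e'(1) by auto
      have "(idx e' r - idx e r) i < 0" using i by (simp add: idx_def)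
      then have "W (idx e' r - idx e r) g = 0" for g using \<psi>_neg[OF i(1)] by (simp add: W_def)
      ultimately show ?thesis by (simp add: \<Phi>_def)
    qed
    then show ?thesis using xA by (simp add: J_def)
  qed
  have \<Phi>_x: "\<Phi> (idx e r) (x e) \<noteq> 0" for e
  proof -
    have "\<Phi> (idx e r) (x e) = \<Phi> 0 (ind 0)" unfolding x_def using \<Phi>_pw[OF _ one, of r] by simp
    also have "\<dots> = W 0 (V 0)" unfolding V_0 by (simp add: \<Phi>_def ind_apply)
    also have "\<dots> = c 0" unfolding W_V[OF sub_0[OF sub_Zn]] by (simp add: \<psi>_def \<beta>(1))
    finally show ?thesis using c(1) by simp
  qed
  show ?thesis
  proof (rule not_dev_le_if_lex_chain[of r J])
    fix e :: "nat list" assume e: "length e = r"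
    have "x e \<noteq> 0"
    proof
      assume "x e = 0"
      then have "supp (x e) = {}" by (simp add: supp_def)
      then show False using \<Phi>_x[of e] by (simp add: \<Phi>_def)
    qed
    then have "{0} \<subset> J e" using x_in[OF e] rideal_0[OF J_ideal] by blast
    then show "J e \<in> {I. rideal (Zn n) I} \<and> J e \<subseteq> Alg (Zn n) \<and> {0} \<subset> J e"
      using J_ideal rideal_Alg[OF J_ideal] by blast
  next
    fix e e' :: "nat list" assume e: "length e = r" "length e' = r" "lex_less e e'"
    have "J e' \<subseteq> J e" using lex_less_trans[OF _ e(3)] by (auto simp: J_def)
    moreover have "x e \<notin> J e'"
    proof
      assume "x e \<in> J e'"
      then have "\<Phi> (idx e r) (rm (x e) 0) = 0" using e sub_0[OF sub_Zn] by (simp add: J_def)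
      then show False using \<Phi>_x[of e] by (simp add: rm_0 \<Phi>_smul[OF xA])
    qed
    ultimately show "J e' \<subset> J e" using x_in[OF e(1)] by blast
  qed
qed

end

section \<open>Dimension and torsion subspaces\<close>

lemma independent_linear_image:
  fixes f :: "('i \<Rightarrow> 'k::field) \<Rightarrow> ('j \<Rightarrow> 'k)"
  assumes "\<And>x y. f (x + y) = f x + f y" "\<And>c x. f (smul c x) = smul c (f x)"
    and "fs.independent B" "\<And>x. x \<in> fs.span B \<Longrightarrow> f x = 0 \<Longrightarrow> x = 0"
  shows "fs.independent (f ` B) \<and> inj_on f B"
proof -
  interpret f: Vector_Spaces.linear smul smul f
    by unfold_locales (use assms in auto)
  have "inj_on f (fs.span B)"
    using f.inj_on_iff_eq_0[of "fs.span B"] assms(4) by auto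
  then show ?thesis
    using f.independent_injective_image[OF assms(3)] inj_on_subset[OF _ fs.span_superset] by blast
qed

definition co :: "nat set \<Rightarrow> nat \<Rightarrow> (nat \<Rightarrow> rat) set" where
  "co A n = {u \<in> Qn n. \<forall>i. i \<notin> A \<longrightarrow> u i = 0}"

lemma subspace_co: "fs.subspace (co A n)"
  by (auto simp: fs.subspace_def co_def Qn_def)

lemma co_span: "co A n \<subseteq> fs.span (ind ` ({..<n} \<inter> A))"
proof
  fix u assume "u \<in> co A n"
  then have "supp u \<subseteq> {..<n} \<inter> A" by (fastforce simp: co_def Qn_def supp_def not_le[symmetric])
  then have "u = (\<Sum>a\<in>{..<n} \<inter> A. smul (u a) (ind a))" by (intro eq_sum_ind) auto
  moreover have "(\<Sum>a\<in>{..<n} \<inter> A. smul (u a) (ind a)) \<in> fs.span (ind ` ({..<n} \<inter> A))"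
    by (intro fs.span_sum fs.span_scale fs.span_base) auto
  ultimately show "u \<in> fs.span (ind ` ({..<n} \<inter> A))" by simp
qed

context twistedZ
begin

lemma torsub_mono: "torsub W \<Longrightarrow> V \<subseteq> W \<Longrightarrow> torsub V"
  unfolding torsub_def using lat_mono by blast

text \<open>Multiplying all exponents by a common order \<open>m\<close> of the commutators makes
  them commute exactly, and independence survives.\<close>

lemma not_dev_le_if_tors:
  assumes B: "B \<subseteq> Zn n" "finite B" "fs.independent (vec ` B)"
    and t: "\<And>a b. a \<in> B \<Longrightarrow> b \<in> B \<Longrightarrow> tors a b"
  shows "\<not> dev_le {I. rideal (Zn n) I} {0} (Alg (Zn n)) (card B)"
proof -
  obtain b where b: "bij_betw b {0..<card B} B" using ex_bij_betw_nat_finite[OF B(2)] by blast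
  have bB: "b i \<in> B" if "i < card B" for i using bij_betwE[OF b] that by simp
  have "\<forall>x\<in>B. \<forall>y\<in>B. \<exists>k>0. lam x y ^ k = 1" using t by (simp add: tors_def)
  then obtain k where k: "\<And>x y. x \<in> B \<Longrightarrow> y \<in> B \<Longrightarrow> k x y > 0 \<and> lam x y ^ k x y = 1" by metis
  define m where "m = (\<Prod>(x, y)\<in>B \<times> B. k x y)"
  have m: "m > 0" unfolding m_def using k by (auto intro!: prod_pos)
  have lam_m: "lam x y ^ m = 1" if "x \<in> B" "y \<in> B" for x y
  proof -
    have "k x y dvd m"
      unfolding m_def using dvd_prodI[of "B \<times> B" "(x, y)" "\<lambda>(x, y). k x y"] that B(2) by simp
    then obtain l where "m = k x y * l" by blast
    then show ?thesis using k[OF that] by (simp add: power_mult)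
  qed
  define v where "v i = zs (int m) (b i)" for i
  show ?thesis
  proof (rule not_dev_le_if_commuting[of "card B" v])
    show "v i \<in> Zn n" if "i < card B" for i using bB[OF that] B(1) by (auto simp: v_def Zn_def)
  next
    fix i j assume ij: "i < card B" "j < card B"
    have "lam (v i) (b j) = inverse (lam (b j) (b i) ^ m)"
      unfolding v_def lam_swap[of "zs (int m) (b i)"] lam_zs by simp
    then have "lam (v i) (b j) = 1" using lam_m bB ij by simp
    moreover have "lam (v i) (v j) = lam (v i) (b j) ^ m" unfolding v_def[of j] by (rule lam_zs)
    ultimately show "lam (v i) (v j) = 1" by (simp only: power_one)
  next
    show "inj_on (\<lambda>a. \<Sum>i<card B. zs (a i) (v i)) (Zn (card B))"
    proof (rule inj_onI)
      fix a a' assume a: "a \<in> Zn (card B)" "a' \<in> Zn (card B)"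
        and eq: "(\<Sum>i<card B. zs (a i) (v i)) = (\<Sum>i<card B. zs (a' i) (v i))"
      have injb: "inj_on (\<lambda>i. vec (b i)) {..<card B}"
        using b by (auto simp: inj_on_def bij_betw_def vec_inj)
      have img: "(\<lambda>i. vec (b i)) ` {..<card B} = vec ` B"
        using b by (auto simp: bij_betw_def lessThan_atLeast0 image_image[symmetric])
      define u where "u w = of_int (a (inv_into {..<card B} (\<lambda>i. vec (b i)) w)) - (of_int (a' (inv_into {..<card B} (\<lambda>i. vec (b i)) w)) :: rat)" for w
      have u: "u (vec (b i)) = of_int (a i) - of_int (a' i)" if "i < card B" for i
        unfolding u_def using inv_into_f_f[OF injb, of i] that by simp
      have "(\<Sum>w\<in>vec ` B. smul (u w) w) = (\<Sum>i<card B. smul (of_int (a i) - of_int (a' i)) (vec (b i)))"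
        unfolding img[symmetric] sum.reindex[OF injb] o_def by (rule sum.cong) (simp_all add: u)
      also have "\<dots> = 0"
      proof
        fix j
        have "(\<Sum>i<card B. a i * (int m * b i j)) = (\<Sum>i<card B. a' i * (int m * b i j))"
          using fun_cong[OF eq, of j] by (simp add: sum_apply v_def)
        then have "int m * (\<Sum>i<card B. a i * b i j) = int m * (\<Sum>i<card B. a' i * b i j)"
          by (simp add: sum_distrib_left mult.left_commute)
        then have "(\<Sum>i<card B. a i * b i j) = (\<Sum>i<card B. a' i * b i j)" using m by simp
        then have "(\<Sum>i<card B. rat_of_int (a i) * rat_of_int (b i j)) = (\<Sum>i<card B. rat_of_int (a' i) * rat_of_int (b i j))"
          by (metis (mono_tags, lifting) of_int_mult of_int_sum sum.cong)
        then show "(\<Sum>i<card B. smul (of_int (a i) - of_int (a' i)) (vec (b i))) j = 0 j"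
          by (simp add: sum_apply left_diff_distrib sum_subtractf)
      qed
      finally have 0: "(\<Sum>w\<in>vec ` B. smul (u w) w) = 0" .
      show "a = a'"
      proof
        fix i
        show "a i = a' i"
        proof (cases "i < card B")
          case True
          have "u (vec (b i)) = 0"
            by (rule fs.independentD[OF B(3) _ subset_refl 0]) (use B(2) bB[OF True] in auto)
          then show ?thesis using u[OF True] by simp
        next
          case False
          then show ?thesis using a by (simp add: Zn_def)
        qed
      qed
    qed
  qed
qed

definition kdim :: "nat \<Rightarrow> nat" where
  "kdim n = (LEAST k. dev_le {I. rideal (Zn n) I} {0} (Alg (Zn n)) (Suc k))"

lemma supp_in_lat_zero:
  assumes "rideal (Zn n) S" "S \<noteq> Alg (Zn n)" "x \<in> S" "supp x \<subseteq> lat {0}"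
  shows "x = 0"
proof -
  have "lat {0} = {0}" using vec_inj[of _ 0] by (auto simp: lat_def)
  then have x0: "x = smul (x 0) (ind 0)" using eq_sum_ind[of "{0}" x] assms(4) by simp
  have "x 0 = 0"
  proof (rule ccontr)
    assume "x 0 \<noteq> 0"
    then have "ind 0 \<in> S" using x0 assms(3) rideal_smul_iff[OF assms(1)] by metis
    then show False using rideal_eq_Alg[OF sub_Zn assms(1)] assms(2) by blast
  qed
  then have "smul (x 0) (ind 0) = 0" by (simp only: fs.scale_zero_left)
  with x0 show ?thesis by (rule trans)
qed

text \<open>\<open>LEAST\<close> has meaning only once some bound exists. The value \<open>n\<close>
  works with \<open>C = {0}\<close>, since a proper right ideal contains no nonzero multiple of
  \<open>ind 0\<close>.\<close>

lemma dev_le_kdim: "dev_le {I. rideal (Zn n) I} {0} (Alg (Zn n)) (Suc (kdim n))"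
  unfolding kdim_def
proof (rule LeastI)
  show "dev_le {I. rideal (Zn n) I} {0} (Alg (Zn n)) (Suc n)"
  proof (rule dev_le_upper)
    fix S assume S: "rideal (Zn n) S" "S \<noteq> Alg (Zn n)"
    have "card ((ind :: nat \<Rightarrow> nat \<Rightarrow> rat) ` {..<n}) \<le> n" using card_image_le[of "{..<n}"] by fastforce
    moreover have "Qn n \<subseteq> fs.span ({0} \<union> ind ` {..<n})" using Qn_span by simp
    moreover have "{0} \<subseteq> Qn n" by (simp add: Qn_def)
    ultimately show "\<exists>C T. fs.subspace C \<and> C \<subseteq> Qn n \<and> finite T \<and> card T \<le> n \<and>
        Qn n \<subseteq> fs.span (C \<union> T) \<and> (\<forall>x\<in>S. supp x \<subseteq> lat C \<longrightarrow> x = 0)"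
      using supp_in_lat_zero[OF S] fs.subspace_single_0
      by (intro exI[of _ "{0}"] exI[of _ "ind ` {..<n}"]) simp
  qed simp
qed

text \<open>The lower and upper bounds on the deviation are compared at a single level, so a larger
  \<open>B\<close> is first cut down to exactly \<open>Suc (kdim n)\<close> elements.\<close>

lemma card_le_kdim:
  assumes B: "B \<subseteq> Zn n" "fs.independent (vec ` B)"
    and t: "\<And>a b. a \<in> B \<Longrightarrow> b \<in> B \<Longrightarrow> tors a b" and fin: "finite B"
  shows "card B \<le> kdim n"
proof (rule ccontr)
  assume "\<not> card B \<le> kdim n"
  then obtain C where C: "C \<subseteq> B" "card C = Suc (kdim n)"
    by (meson not_less_eq_eq obtain_subset_with_card_n)
  have "\<not> dev_le {I. rideal (Zn n) I} {0} (Alg (Zn n)) (card C)"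
  proof (rule not_dev_le_if_tors)
    show "C \<subseteq> Zn n" using C B by blast
    show "finite C" using C fin finite_subset by blast
    show "fs.independent (vec ` C)" by (rule fs.independent_mono[OF B(2)]) (use C in blast)
    show "tors a b" if "a \<in> C" "b \<in> C" for a b using that C t by blast
  qed
  then show False unfolding C(2) using dev_le_kdim by blast
qed

text \<open>If the criterion for the upper bound fails, one proper right ideal meets
  \<open>F * C\<close> for all \<open>C\<close> of codimension at most \<open>k\<close>, and
  \<open>degeneration\<close> with \<open>r = Suc k\<close> yields a torsion subspace that is too
  large.\<close>

lemma kdim_le:
  assumes k: "k \<le> n" and W: "\<And>W. fs.subspace W \<Longrightarrow> W \<subseteq> Qn n \<Longrightarrow> torsub W \<Longrightarrow> fs.dim W \<le> k"
  shows "kdim n \<le> k"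
  unfolding kdim_def
proof (rule Least_le, rule dev_le_upper[OF k], rule ccontr)
  fix S assume S: "rideal (Zn n) S" "S \<noteq> Alg (Zn n)"
    and no: "\<not> (\<exists>C T. fs.subspace C \<and> C \<subseteq> Qn n \<and> finite T \<and> card T \<le> k \<and>
        Qn n \<subseteq> fs.span (C \<union> T) \<and> (\<forall>x\<in>S. supp x \<subseteq> lat C \<longrightarrow> x = 0))"
  have "\<exists>W. fs.subspace W \<and> W \<subseteq> Qn n \<and> Suc k \<le> fs.dim W \<and> torsub W"
  proof (rule degeneration[OF subspace_Qn subset_refl])
    show "rideal (lat (Qn n)) S" "S \<noteq> Alg (lat (Qn n))" using S by (simp_all add: lat_Qn)
    show "\<exists>x\<in>S. x \<noteq> 0 \<and> supp x \<subseteq> lat C"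
      if C: "fs.subspace C" "C \<subseteq> Qn n" "finite T" "card T < Suc k" "Qn n \<subseteq> fs.span (C \<union> T)" for C T
    proof (rule ccontr)
      assume "\<not> ?thesis"
      then have "\<forall>x\<in>S. supp x \<subseteq> lat C \<longrightarrow> x = 0" by blast
      moreover have "card T \<le> k" using C(4) by simp
      ultimately have "fs.subspace C \<and> C \<subseteq> Qn n \<and> finite T \<and> card T \<le> k \<and>
        Qn n \<subseteq> fs.span (C \<union> T) \<and> (\<forall>x\<in>S. supp x \<subseteq> lat C \<longrightarrow> x = 0)" using C by simp
      then show False using no by blast
    qed
  qed
  then show False using W by force
qed

text \<open>An arbitrary coordinate set \<open>A\<close> lets the statement serve both factors, with
  \<open>A\<close> and with its complement. Strictness comes from \<open>dY\<close>; the weak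
  inequality is a projection.\<close>

lemma dim_torsub_le:
  assumes co: "\<And>a b. a \<in> Zn n \<Longrightarrow> b \<in> Zn n \<Longrightarrow> (\<And>i. i \<notin> A \<Longrightarrow> a i = 0) \<Longrightarrow> (\<And>i. i \<in> A \<Longrightarrow> b i = 0) \<Longrightarrow> tors a b"
    and dX: "\<And>W. fs.subspace W \<Longrightarrow> W \<subseteq> co A n \<Longrightarrow> torsub W \<Longrightarrow> fs.dim W \<le> d"
    and dY: "\<And>W. fs.subspace W \<Longrightarrow> W \<subseteq> co (- A) n \<Longrightarrow> torsub W \<Longrightarrow> fs.dim W < card ({..<n} - A)"
    and W: "fs.subspace W" "W \<subseteq> Qn n" "torsub W"
  shows "fs.dim W < d + card ({..<n} - A)"
proof (rule ccontr)
  assume ge: "\<not> ?thesis"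
  have Wspan: "W \<subseteq> fs.span (ind ` {..<n})" using W(2) Qn_span by blast
  define C where "C = W \<inter> co A n"
  define D where "D = W \<inter> co (- A) n"
  have sC: "fs.subspace C" unfolding C_def by (rule fs.subspace_inter[OF W(1) subspace_co])
  have sD: "fs.subspace D" unfolding D_def by (rule fs.subspace_inter[OF W(1) subspace_co])
  have CW: "C \<subseteq> W" and CX: "C \<subseteq> co A n" by (auto simp: C_def)
  have dC: "fs.dim C \<le> d" by (rule dX[OF sC CX torsub_mono[OF W(3) CW]])
  have dD: "fs.dim D < card ({..<n} - A)"
    by (rule dY[OF sD _ torsub_mono[OF W(3)]]) (auto simp: D_def)
  obtain BC where BC: "finite BC" "C \<subseteq> fs.span BC" "card BC = fs.dim C"
    using basis_in_finite_span[OF order_trans[OF CW Wspan]] by auto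
  \<comment> \<open>Deleting the coordinates in \<open>A\<close> maps a complement of
    \<open>C\<close> in \<open>W\<close> injectively into the remaining coordinate space.\<close>
  have "fs.dim W \<le> fs.dim C + card ({..<n} - A)"
  proof -
    obtain Q where Q: "fs.subspace Q" "Q \<subseteq> W" "C \<inter> Q = {0}" "\<And>v. v \<in> W \<Longrightarrow> \<exists>b\<in>C. \<exists>q\<in>Q. v = b + q"
      using complement_fin[OF CW sC W(1)] by blast
    obtain BQ where BQ: "BQ \<subseteq> Q" "finite BQ" "fs.independent BQ" "Q \<subseteq> fs.span BQ"
      using basis_in_finite_span[OF order_trans[OF Q(2) Wspan]] by auto
    define \<pi> where "\<pi> u = (\<lambda>i. if i \<in> A then 0 else u i)" for u :: "nat \<Rightarrow> rat"
    have ker: "x = 0" if x: "x \<in> fs.span BQ" "\<pi> x = 0" for x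
    proof -
      have xQ: "x \<in> Q" using x(1) fs.span_minimal[OF BQ(1) Q(1)] by blast
      have "x i = 0" if "i \<notin> A" for i using fun_cong[OF x(2), of i] that by (simp add: \<pi>_def)
      then have "x \<in> C" using xQ Q(2) W(2) by (auto simp: C_def co_def)
      then show ?thesis using xQ Q(3) by blast
    qed
    have pi: "fs.independent (\<pi> ` BQ) \<and> inj_on \<pi> BQ"
      by (rule independent_linear_image[OF _ _ BQ(3) ker]) (auto simp: \<pi>_def fun_eq_iff)
    have "\<pi> ` BQ \<subseteq> co (- A) n" 
    proof (rule image_subsetI)
      fix u assume "u \<in> BQ"
      then have "u \<in> Qn n" using BQ(1) Q(2) W(2) by blast
      then show "\<pi> u \<in> co (- A) n" by (simp add: \<pi>_def co_def Qn_def)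
    qed
    then have "\<pi> ` BQ \<subseteq> fs.span (ind ` ({..<n} \<inter> - A))" using co_span by blast
    then have "card (\<pi> ` BQ) \<le> card ((ind :: nat \<Rightarrow> nat \<Rightarrow> rat) ` ({..<n} \<inter> - A))"
      using fs.independent_span_bound[of "ind ` ({..<n} \<inter> - A)" "\<pi> ` BQ"] pi by simp
    also have "\<dots> \<le> card ({..<n} - A)" using card_image_le[of "{..<n} \<inter> - A"] by (simp add: Diff_eq)
    finally have cBQ: "card BQ \<le> card ({..<n} - A)" using card_image[of \<pi> BQ] pi by simp
    have "W \<subseteq> fs.span (BC \<union> BQ)"
    proof
      fix w assume "w \<in> W"
      from Q(4)[OF this] obtain b q where bq: "b \<in> C" "q \<in> Q" "w = b + q" by blast
      have "b \<in> fs.span (BC \<union> BQ)" using bq(1) BC(2) fs.span_mono[of BC "BC \<union> BQ"] by blast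
      moreover have "q \<in> fs.span (BC \<union> BQ)" using bq(2) BQ(4) fs.span_mono[of BQ "BC \<union> BQ"] by blast
      ultimately show "w \<in> fs.span (BC \<union> BQ)" unfolding bq(3) by (rule fs.span_add)
    qed
    then have "fs.dim W \<le> card (BC \<union> BQ)" using BC(1) BQ(2) by (intro fs.dim_le_card) auto
    also have "\<dots> \<le> card BC + card BQ" by (rule card_Un_le)
    finally show ?thesis using cBQ BC(3) by simp
  qed
  then have dCd: "fs.dim C = d" using ge dC by simp
  define p where "p a = (\<lambda>i. if i \<in> A then a i else 0)" for a :: "nat \<Rightarrow> int"
  \<comment> \<open>Elements of \<open>C\<close> commute up to torsion with \<open>a\<close> and,
    across the factors, with \<open>a - p a\<close>, hence with \<open>p a\<close>. Adjoining
    \<open>p a\<close> keeps the space torsion, so \<open>dim C = d\<close> leaves no room for it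
    outside \<open>C\<close>.\<close>
  have pC: "vec (p a) \<in> C" if a: "a \<in> lat W" for a
  proof (rule ccontr)
    assume nC: "vec (p a) \<notin> C"
    have aZ: "a \<in> Zn n" using a W(2) lat_mono lat_Qn by blast
    have pZ: "p a \<in> Zn n" "a - p a \<in> Zn n" using aZ by (auto simp: p_def Zn_def)
    have tc: "tors c (p a)" if c: "c \<in> lat C" for c
    proof -
      have cZ: "c \<in> Zn n" using c CW W(2) lat_mono lat_Qn by blast
      have "tors c a" using W(3) c a CW lat_mono unfolding torsub_def by blast
      moreover have "tors c (a - p a)"
      proof (rule co[OF cZ pZ(2)])
        show "c i = 0" if "i \<notin> A" for i using c CX that by (auto simp: lat_def co_def)
      qed (simp add: p_def)
      ultimately have "tors c (a + - (a - p a))" by (intro tors_add tors_neg)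
      then show ?thesis by simp
    qed
    define S where "S = insert (p a) (lat C)"
    define C1 where "C1 = fs.span (vec ` S)"
    have "tors s t" if "s \<in> S" "t \<in> S" for s t
    proof -
      have "tors s t" if "s \<in> lat C" "t \<in> lat C" for s t
        using that W(3) CW lat_mono unfolding torsub_def by blast
      then show ?thesis using that tc tors_self tors_sym[of "p a"] unfolding S_def by blast
    qed
    then have tC1: "torsub C1" unfolding C1_def by (rule torsub_span)
    have "vec ` S \<subseteq> co A n"
      using CX pZ(1) by (auto simp: S_def lat_def co_def Qn_def Zn_def p_def)
    then have C1X: "C1 \<subseteq> co A n" unfolding C1_def by (rule fs.span_minimal[OF _ subspace_co])
    have "fs.dim C1 \<le> d" by (rule dX[OF _ C1X tC1]) (simp add: C1_def)
    moreover have "C \<subset> C1"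
    proof
      have "fs.span (vec ` lat C) \<subseteq> C1" unfolding C1_def S_def by (intro fs.span_mono) blast
      then show "C \<subseteq> C1" using span_vec_lat[OF sC, of n] CW W(2) by auto
      have "vec (p a) \<in> C1" unfolding C1_def S_def by (intro fs.span_base) blast
      then show "C \<noteq> C1" using nC by blast
    qed
    then have "fs.dim C < fs.dim C1"
      by (rule dim_strict_mono_fin[OF _ sC order_trans[OF C1X co_span]]) simp
    ultimately show False using dCd by simp
  qed
  obtain BD where BD: "finite BD" "D \<subseteq> fs.span BD" "card BD = fs.dim D"
    using basis_in_finite_span[of D "ind ` {..<n}"] Wspan D_def by auto
  \<comment> \<open>Now \<open>W\<close> is the sum of \<open>C\<close> and \<open>D\<close>, and
    the strict bound on \<open>D\<close> contradicts the assumed size of \<open>W\<close>.\<close>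
  have "vec ` lat W \<subseteq> fs.span (BC \<union> BD)"
  proof (rule image_subsetI)
    fix a assume a: "a \<in> lat W"
    have "vec (a - p a) \<in> W"
      unfolding vec_diff using a pC[OF a] CW by (intro fs.subspace_diff[OF W(1)]) (auto simp: lat_def)
    moreover have "vec (a - p a) \<in> co (- A) n"
      using \<open>vec (a - p a) \<in> W\<close> W(2) by (auto simp: co_def p_def)
    ultimately have "vec (a - p a) \<in> fs.span (BC \<union> BD)"
      using BD(2) fs.span_mono[of BD "BC \<union> BD"] by (auto simp: D_def)
    moreover have "vec (p a) \<in> fs.span (BC \<union> BD)"
      using pC[OF a] BC(2) fs.span_mono[of BC "BC \<union> BD"] by blast
    ultimately have "vec (p a) + vec (a - p a) \<in> fs.span (BC \<union> BD)" by (intro fs.span_add)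
    then show "vec a \<in> fs.span (BC \<union> BD)" unfolding vec_add[symmetric] by simp
  qed
  then have "fs.span (vec ` lat W) \<subseteq> fs.span (BC \<union> BD)" by (rule fs.span_minimal) simp
  then have "W \<subseteq> fs.span (BC \<union> BD)" using span_vec_lat[OF W(1,2)] by simp
  then have "fs.dim W \<le> card (BC \<union> BD)" using BC(1) BD(1) by (intro fs.dim_le_card) auto
  also have "\<dots> \<le> card BC + card BD" by (rule card_Un_le)
  finally show False using BC(3) BD(3) dC dD ge by simp
qed

end

section \<open>Exponents as lists\<close>

definition ls :: "nat \<Rightarrow> (nat \<Rightarrow> int) \<Rightarrow> int list" where
  "ls n a = map a [0..<n]"

definition fnl :: "int list \<Rightarrow> nat \<Rightarrow> int" where
  "fnl l = (\<lambda>i. if i < length l then l ! i else 0)"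

lemma length_ls [simp]: "length (ls n a) = n"
  by (simp add: ls_def)

lemma ls_fnl: "length l = n \<Longrightarrow> ls n (fnl l) = l"
  by (auto simp: ls_def fnl_def intro: nth_equalityI)

lemma fnl_ls: "a \<in> Zn n \<Longrightarrow> fnl (ls n a) = a"
  by (auto simp: ls_def fnl_def Zn_def fun_eq_iff)

lemma fnl_Zn: "length l = n \<Longrightarrow> fnl l \<in> Zn n"
  by (auto simp: fnl_def Zn_def)

lemma gadd_ls: "gadd (ls n a) (ls n b) = ls n (a + b)"
  by (auto simp: gadd_def ls_def intro!: nth_equalityI)

lemma gneg_ls: "gneg (ls n a) = ls n (- a)"
  by (auto simp: gneg_def ls_def)

lemma ls_inj: "a \<in> Zn n \<Longrightarrow> b \<in> Zn n \<Longrightarrow> ls n a = ls n b \<longleftrightarrow> a = b"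
  by (metis fnl_ls)

text \<open>Truncation to \<open>n\<close> coordinates is a homomorphism, so a cocycle on \<open>\<int>\<^sup>n\<close> extends to the
  type \<open>nat \<Rightarrow> int\<close>, in which \<open>\<int>\<^sup>n\<close> is the subgroup \<open>Zn n\<close>.\<close>

lemma twistedZ_of_cocycle:
  assumes "cocycle n \<tau>"
  shows "twistedZ (\<lambda>a b. \<tau> (ls n a) (ls n b))"
proof unfold_locales
  fix a b c :: "nat \<Rightarrow> int"
  have grp: "ls n a \<in> grp n" for a by (simp add: grp_def)
  show "\<tau> (ls n a) (ls n b) \<noteq> 0" using assms grp by (simp add: cocycle_def)
  have "\<tau> (ls n a) (ls n b) * \<tau> (gadd (ls n a) (ls n b)) (ls n c)
      = \<tau> (ls n b) (ls n c) * \<tau> (ls n a) (gadd (ls n b) (ls n c))"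
    using assms grp unfolding cocycle_def by blast
  then show "\<tau> (ls n a) (ls n b) * \<tau> (ls n (a + b)) (ls n c)
      = \<tau> (ls n b) (ls n c) * \<tau> (ls n a) (ls n (b + c))"
    by (simp only: gadd_ls)
qed

definition hl :: "nat \<Rightarrow> ((nat \<Rightarrow> int) \<Rightarrow> 'a::field) \<Rightarrow> int list \<Rightarrow> 'a" where
  "hl n x = (\<lambda>l. if length l = n then x (fnl l) else 0)"

definition hf :: "nat \<Rightarrow> (int list \<Rightarrow> 'a::field) \<Rightarrow> (nat \<Rightarrow> int) \<Rightarrow> 'a" where
  "hf n y = (\<lambda>a. if a \<in> Zn n then y (ls n a) else 0)"

lemma hl_hf: "y \<in> tga_carrier n \<Longrightarrow> hl n (hf n y) = y"
  by (auto simp: hl_def hf_def fun_eq_iff tga_carrier_def grp_def fnl_Zn ls_fnl)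

lemma hf_hl: "x \<in> Alg (Zn n) \<Longrightarrow> hf n (hl n x) = x"
  by (auto simp: hl_def hf_def fun_eq_iff Alg_def supp_def fnl_ls)

lemma supp_hl: "{l. hl n x l \<noteq> 0} = ls n ` (supp x \<inter> Zn n)"
proof (intro set_eqI iffI)
  fix l assume "l \<in> {l. hl n x l \<noteq> 0}"
  then have "length l = n" "x (fnl l) \<noteq> 0" by (auto simp: hl_def split: if_splits)
  then show "l \<in> ls n ` (supp x \<inter> Zn n)"
    by (intro image_eqI[of _ _ "fnl l"]) (simp_all add: ls_fnl fnl_Zn supp_def)
next
  fix l assume "l \<in> ls n ` (supp x \<inter> Zn n)"
  then show "l \<in> {l. hl n x l \<noteq> 0}" by (auto simp: hl_def fnl_ls supp_def)
qed

lemma hl_carrier: "x \<in> Alg (Zn n) \<Longrightarrow> hl n x \<in> tga_carrier n"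
  unfolding tga_carrier_def using supp_hl[of n x] by (auto simp: Alg_def hl_def grp_def split: if_splits)

lemma hf_Alg:
  assumes "y \<in> tga_carrier n"
  shows "hf n y \<in> Alg (Zn n)"
proof -
  have "supp (hf n y) \<subseteq> fnl ` {l. y l \<noteq> 0}"
  proof
    fix a assume "a \<in> supp (hf n y)"
    then have "a \<in> Zn n" "y (ls n a) \<noteq> 0" by (auto simp: supp_def hf_def split: if_splits)
    then show "a \<in> fnl ` {l. y l \<noteq> 0}" by (intro image_eqI[of _ _ "ls n a"]) (simp_all add: fnl_ls)
  qed
  moreover have "finite {l. y l \<noteq> 0}" using assms by (simp add: tga_carrier_def)
  ultimately have "finite (supp (hf n y))" by (meson finite_imageI finite_subset)
  then show ?thesis by (auto simp: Alg_def supp_def hf_def)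
qed

lemma hl_add: "hl n (x + y) = (\<lambda>c. hl n x c + hl n y c)"
  and hl_neg: "hl n (- x) = (\<lambda>c. - hl n x c)"
  and hl_zero: "hl n 0 = (\<lambda>_. 0)"
  by (auto simp: hl_def fun_eq_iff)

lemma image_hl_hf: "K \<subseteq> tga_carrier n \<Longrightarrow> hl n ` hf n ` K = K"
  using hl_hf by (force simp: image_image)

lemma image_hf_hl: "I \<subseteq> Alg (Zn n) \<Longrightarrow> hf n ` hl n ` I = I"
  using hf_hl by (force simp: image_image)

context
  fixes n :: nat and \<tau> :: "int list \<Rightarrow> int list \<Rightarrow> 'a::field" and \<sigma>
  assumes coc: "cocycle n \<tau>"
  defines "\<sigma> \<equiv> \<lambda>a b. \<tau> (ls n a) (ls n b)"
begin

interpretation T: twistedZ \<sigma>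
  unfolding \<sigma>_def by (rule twistedZ_of_cocycle[OF coc])

lemma tga_mult_hl:
  assumes x: "x \<in> Alg (Zn n)" and y: "y \<in> Alg (Zn n)"
  shows "tga_mult n \<tau> (hl n x) (hl n y) = hl n (T.mul x y)"
proof
  fix l
  show "tga_mult n \<tau> (hl n x) (hl n y) l = hl n (T.mul x y) l"
  proof (cases "length l = n")
    case False
    then show ?thesis by (simp add: tga_mult_def hl_def grp_def)
  next
    case True
    define g where "g = fnl l"
    have g: "g \<in> Zn n" "l = ls n g" using True by (simp_all add: g_def fnl_Zn ls_fnl)
    have fin: "finite (supp x)" "finite (supp y)" and xZ: "supp x \<subseteq> Zn n" and yZ: "supp y \<subseteq> Zn n"
      using x y by (auto simp: Alg_def)
    have hll: "hl n z (ls n a) = z a" if "a \<in> Zn n" for a and z :: "(nat \<Rightarrow> int) \<Rightarrow> 'a"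
      using that by (simp add: hl_def fnl_ls)
    have "tga_mult n \<tau> (hl n x) (hl n y) l
        = (\<Sum>a\<in>ls n ` supp x. hl n x a * hl n y (gadd l (gneg a)) * \<tau> a (gadd l (gneg a)))"
      using True xZ by (simp add: tga_mult_def grp_def supp_hl Int_absorb2)
    also have "\<dots> = (\<Sum>a\<in>supp x. x a * y (g - a) * \<sigma> a (g - a))"
    proof (subst sum.reindex)
      show "inj_on (ls n) (supp x)" using xZ ls_inj by (blast intro: inj_onI)
      show "(\<Sum>a\<in>supp x. ((\<lambda>a. hl n x a * hl n y (gadd l (gneg a)) * \<tau> a (gadd l (gneg a))) \<circ> ls n) a)
          = (\<Sum>a\<in>supp x. x a * y (g - a) * \<sigma> a (g - a))"
      proof (rule sum.cong)
        fix a assume "a \<in> supp x"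
        then have a: "a \<in> Zn n" using xZ by blast
        have "gadd l (gneg (ls n a)) = ls n (g - a)" unfolding g(2) gneg_ls gadd_ls by simp
        moreover have "g - a \<in> Zn n" by (rule sub_diff[OF sub_Zn g(1) a])
        ultimately show "((\<lambda>a. hl n x a * hl n y (gadd l (gneg a)) * \<tau> a (gadd l (gneg a))) \<circ> ls n) a
            = x a * y (g - a) * \<sigma> a (g - a)"
          using a by (simp add: hll \<sigma>_def)
      qed simp
    qed
    \<comment> \<open>One product formula sums over the left factor, the other over the right one.
      The substitution \<open>a = g - b\<close> matches them; indices without a partner contribute
      0.\<close>
    also have "\<dots> = (\<Sum>b\<in>supp y. y b * (x (g - b) * \<sigma> (g - b) b))"
      by (rule sum.reindex_bij_witness_not_neutral[where i = "\<lambda>b. g - b" and j = "\<lambda>a. g - a"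
            and S' = "supp x - (\<lambda>b. g - b) ` supp y" and T' = "supp y - (\<lambda>a. g - a) ` supp x"])
        (use fin in \<open>auto simp: supp_def image_iff ac_simps\<close>)
    also have "\<dots> = hl n (T.mul x y) l"
      unfolding g(2) hll[OF g(1)] by (simp add: T.mul_def sum_apply T.rm_def)
    finally show ?thesis .
  qed
qed

lemma tga_right_ideal_hl:
  assumes I: "T.rideal (Zn n) I"
  shows "hl n ` I \<in> tga_right_ideals n \<tau>"
  unfolding tga_right_ideals_def
proof (intro CollectI conjI ballI)
  have IA: "x \<in> Alg (Zn n)" if "x \<in> I" for x using T.rideal_Alg[OF I that] .
  show "hl n ` I \<subseteq> tga_carrier n" using IA hl_carrier by blast
  show "(\<lambda>_. 0) \<in> hl n ` I" by (rule image_eqI[where f = "hl n" and x = 0]) (simp_all add: hl_zero T.rideal_0[OF I])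
  fix x assume "x \<in> hl n ` I"
  then obtain x' where x': "x' \<in> I" "x = hl n x'" by blast
  show "(\<lambda>c. - x c) \<in> hl n ` I"
  proof -
    have "0 - x' \<in> I" by (rule T.rideal_diff[OF I T.rideal_0[OF I] x'(1)])
    then have "- x' \<in> I" by simp
    then show ?thesis unfolding x'(2) hl_neg[symmetric] by (rule imageI)
  qed
  show "(\<lambda>c. x c + y c) \<in> hl n ` I" if y: "y \<in> hl n ` I" for y
  proof -
    obtain y' where y': "y' \<in> I" "y = hl n y'" using y by blast
    show ?thesis unfolding x'(2) y'(2) hl_add[symmetric] by (rule imageI[OF T.rideal_add[OF I x'(1) y'(1)]])
  qed
  show "tga_mult n \<tau> x r \<in> hl n ` I" if r: "r \<in> tga_carrier n" for r
  proof -
    have "tga_mult n \<tau> x r = hl n (T.mul x' (hf n r))"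
      using tga_mult_hl[OF IA[OF x'(1)] hf_Alg[OF r]] by (simp add: x'(2) hl_hf[OF r])
    then show ?thesis using T.mul_in_rideal[OF I x'(1) hf_Alg[OF r]] by blast
  qed
qed

lemma rideal_hf:
  assumes K: "K \<in> tga_right_ideals n \<tau>"
  shows "T.rideal (Zn n) (hf n ` K)"
proof -
  have KA: "K \<subseteq> tga_carrier n" and K0: "(\<lambda>_. 0) \<in> K"
    and Kadd: "\<And>x y. x \<in> K \<Longrightarrow> y \<in> K \<Longrightarrow> (\<lambda>c. x c + y c) \<in> K"
    and Kmul: "\<And>x r. x \<in> K \<Longrightarrow> r \<in> tga_carrier n \<Longrightarrow> tga_mult n \<tau> x r \<in> K"
    using K unfolding tga_right_ideals_def by blast+
  have mul: "T.mul x s \<in> hf n ` K" if x: "x \<in> hf n ` K" and s: "s \<in> Alg (Zn n)" for x s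
  proof -
    obtain k where k: "k \<in> K" "x = hf n k" using x by blast
    have xA: "x \<in> Alg (Zn n)" unfolding k(2) using k(1) KA by (intro hf_Alg) blast
    have "hl n (T.mul x s) = tga_mult n \<tau> k (hl n s)"
      using tga_mult_hl[OF xA s] hl_hf[of k n] k KA by auto
    then have "hl n (T.mul x s) \<in> K" using Kmul[OF k(1) hl_carrier[OF s]] by simp
    moreover have "T.mul x s \<in> Alg (Zn n)" by (rule T.mul_in_rideal[OF T.rideal_whole[OF sub_Zn] xA s])
    ultimately show ?thesis by (intro image_eqI[where f = "hf n", OF hf_hl[symmetric]])
  qed
  have inA: "x \<in> Alg (Zn n)" if "x \<in> hf n ` K" for x using that KA hf_Alg by blast
  show ?thesis
    unfolding T.rideal_def
  proof (intro conjI ballI allI)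
    show "hf n ` K \<subseteq> Alg (Zn n)" using inA by blast
    have "hf n (\<lambda>_. 0) = (0 :: _ \<Rightarrow> 'a)" by (simp add: hf_def fun_eq_iff)
    then show "0 \<in> hf n ` K" by (intro image_eqI[where f = "hf n", OF _ K0]) simp
  next
    fix x y assume "x \<in> hf n ` K" "y \<in> hf n ` K"
    then obtain k k' where k: "k \<in> K" "x = hf n k" "k' \<in> K" "y = hf n k'" by blast
    have "x + y = hf n (\<lambda>c. k c + k' c)" unfolding k by (auto simp: hf_def fun_eq_iff)
    then show "x + y \<in> hf n ` K" using Kadd[OF k(1,3)] by blast
  next
    fix x k assume x: "x \<in> hf n ` K"
    \<comment> \<open>Closure under scalars comes from multiplying by \<open>k\<close> times the
      identity of the algebra.\<close>
    have "T.mul x (smul (k / \<sigma> 0 0) (ind 0)) = smul k x"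
      unfolding T.mul_smul[OF Alg_ind[OF sub_0[OF sub_Zn]]] T.mul_ind T.rm_0 by (simp add: fs.scale_scale)
    then show "smul k x \<in> hf n ` K"
      using mul[OF x Alg_smul[OF Alg_ind[OF sub_0[OF sub_Zn]]], of "k / \<sigma> 0 0"] by simp
  next
    fix x a assume "x \<in> hf n ` K" "a \<in> Zn n"
    then show "T.rm x a \<in> hf n ` K" using mul[of x "ind a"] Alg_ind[of a "Zn n"] by (simp add: T.mul_ind)
  qed
qed

text \<open>Images under \<open>hl\<close> and \<open>hf\<close> are mutually inverse and preserve
  inclusions between the two lattices of right ideals, so both have the same deviation.\<close>

lemma tga_dim_eq_kdim: "tga_dim n \<tau> = T.kdim n"
proof -
  let ?L = "{I. T.rideal (Zn n) I}" and ?L' = "tga_right_ideals n \<tau>"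
  have R0: "{0} \<in> ?L" and R1: "Alg (Zn n) \<in> ?L" using T.rideal_zero T.rideal_whole[OF sub_Zn] by auto
  have LA: "I \<subseteq> Alg (Zn n)" if "I \<in> ?L" for I using that T.rideal_Alg by blast
  have LA': "K \<subseteq> tga_carrier n" if "K \<in> ?L'" for K using that by (simp add: tga_right_ideals_def)
  have h0: "hl n ` {0} = {\<lambda>_. 0 :: 'a}" by (simp add: hl_zero)
  have h1: "hl n ` Alg (Zn n) = (tga_carrier n :: (int list \<Rightarrow> 'a) set)"
  proof
    show "hl n ` Alg (Zn n) \<subseteq> (tga_carrier n :: (int list \<Rightarrow> 'a) set)" using hl_carrier by blast
    show "tga_carrier n \<subseteq> hl n ` (Alg (Zn n) :: ((nat \<Rightarrow> int) \<Rightarrow> 'a) set)"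
    proof
      fix y :: "int list \<Rightarrow> 'a" assume y: "y \<in> tga_carrier n"
      show "y \<in> hl n ` Alg (Zn n)"
        by (rule image_eqI[where f = "hl n", OF hl_hf[OF y, symmetric] hf_Alg[OF y]])
    qed
  qed
  have C0: "{\<lambda>_. 0} \<in> ?L'" using tga_right_ideal_hl[of "{0}"] R0 unfolding h0 by blast
  have C1: "tga_carrier n \<in> ?L'" using tga_right_ideal_hl[of "Alg (Zn n)"] R1 unfolding h1 by blast
  have "dev_le ?L' {\<lambda>_. 0} (tga_carrier n) k \<longleftrightarrow> dev_le ?L {0} (Alg (Zn n)) k" for k
  proof
    assume "dev_le ?L' {\<lambda>_. 0} (tga_carrier n) k"
    then have "dev_le ?L' (hl n ` {0}) (hl n ` Alg (Zn n)) k" by (simp only: h0 h1)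
    then show "dev_le ?L {0} (Alg (Zn n)) k"
    proof (rule dev_le_strict_mono)
      show "hl n ` I \<in> ?L'" if "I \<in> ?L" for I using tga_right_ideal_hl that by blast
      show "inj_on ((`) (hl n)) ?L" using LA image_hf_hl by (metis (no_types, lifting) inj_onI)
    qed (use R0 R1 in auto)
  next
    assume "dev_le ?L {0} (Alg (Zn n)) k"
    moreover have "hf n ` {\<lambda>_. 0} = {0 :: _ \<Rightarrow> 'a}" by (simp add: hf_def fun_eq_iff)
    moreover have "hf n ` tga_carrier n = (Alg (Zn n) :: ((nat \<Rightarrow> int) \<Rightarrow> 'a) set)" unfolding h1[symmetric] by (rule image_hf_hl) simp
    ultimately have "dev_le ?L (hf n ` {\<lambda>_. 0}) (hf n ` tga_carrier n) k" by (simp only:)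
    then show "dev_le ?L' {\<lambda>_. 0} (tga_carrier n) k"
    proof (rule dev_le_strict_mono)
      show "hf n ` K \<in> ?L" if "K \<in> ?L'" for K using rideal_hf that by blast
      show "inj_on ((`) (hf n)) ?L'" using LA' image_hl_hf by (metis (no_types, lifting) inj_onI)
    qed (use C0 C1 in auto)
  qed
  then show ?thesis by (simp only: tga_dim_def T.kdim_def)
qed

end

theorem theorem5p7:
  fixes \<tau>1 \<tau>2 :: "int list \<Rightarrow> int list \<Rightarrow> 'a::field"
    and n1 n2 :: nat
  assumes "cocycle n1 \<tau>1" and "cocycle n2 \<tau>2"
    and "tga_dim n1 \<tau>1 < n1" and "tga_dim n2 \<tau>2 < n2"
  shows "int (tga_dim (n1 + n2) (tensor_cocycle n1 \<tau>1 \<tau>2))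
           \<le> min (int (tga_dim n1 \<tau>1) + int n2) (int (tga_dim n2 \<tau>2) + int n1) - 1"
proof -
  define n where "n = n1 + n2"
  \<comment> \<open>Truncation alone lets \<open>\<sigma>1\<close> read the first block of a
    concatenated exponent; the second block has to be moved down to index 0 for
    \<open>\<sigma>2\<close>.\<close>
  define sh where "sh a = (\<lambda>i. a (i + n1))" for a :: "nat \<Rightarrow> int"
  define \<sigma>1 where "\<sigma>1 = (\<lambda>a b. \<tau>1 (ls n1 a) (ls n1 b))"
  define \<sigma>2 where "\<sigma>2 = (\<lambda>a b. \<tau>2 (ls n2 a) (ls n2 b))"
  interpret T1: twistedZ \<sigma>1 unfolding \<sigma>1_def by (rule twistedZ_of_cocycle[OF assms(1)])
  interpret T2: twistedZ \<sigma>2 unfolding \<sigma>2_def by (rule twistedZ_of_cocycle[OF assms(2)])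
  have d1: "tga_dim n1 \<tau>1 = T1.kdim n1" unfolding \<sigma>1_def by (rule tga_dim_eq_kdim[OF assms(1)])
  have d2: "tga_dim n2 \<tau>2 = T2.kdim n2" unfolding \<sigma>2_def by (rule tga_dim_eq_kdim[OF assms(2)])
  define \<sigma> where "\<sigma> = (\<lambda>a b. tensor_cocycle n1 \<tau>1 \<tau>2 (ls n a) (ls n b))"
  have sh_add: "sh (a + b) = sh a + sh b" for a b by (simp add: sh_def fun_eq_iff)
  have \<sigma>: "\<sigma> a b = \<sigma>1 a b * \<sigma>2 (sh a) (sh b)" for a b
  proof -
    have "take n1 (ls n a) = ls n1 a" for a by (simp add: ls_def n_def take_map)
    moreover have "drop n1 (ls n a) = ls n2 (sh a)" for a
      by (auto simp: ls_def n_def sh_def drop_map add.commute intro!: nth_equalityI)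
    ultimately show ?thesis by (simp add: \<sigma>_def tensor_cocycle_def \<sigma>1_def \<sigma>2_def)
  qed
  have coc: "cocycle n (tensor_cocycle n1 \<tau>1 \<tau>2)"
  proof -
    have ex: "\<exists>f. a = ls n f" if "a \<in> grp n" for a
      using that ls_fnl[of a n] by (auto simp: grp_def intro: exI[of _ "fnl a"])
    have 1: "\<sigma> a b \<noteq> 0" for a b by (simp add: \<sigma>)
    have 2: "\<sigma> a b * \<sigma> (a + b) c = \<sigma> b c * \<sigma> a (b + c)" for a b c
    proof -
      have "\<sigma> a b * \<sigma> (a + b) c = (\<sigma>1 a b * \<sigma>1 (a + b) c) * (\<sigma>2 (sh a) (sh b) * \<sigma>2 (sh a + sh b) (sh c))"
        by (simp only: \<sigma> sh_add ac_simps)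
      also have "\<dots> = \<sigma> b c * \<sigma> a (b + c)"
        unfolding T1.coc T2.coc by (simp only: \<sigma> sh_add ac_simps)
      finally show ?thesis .
    qed
    show ?thesis
      unfolding cocycle_def
    proof (intro conjI ballI)
      fix a b assume "a \<in> grp n" "b \<in> grp n"
      then obtain f g where "a = ls n f" "b = ls n g" using ex by blast
      then show "tensor_cocycle n1 \<tau>1 \<tau>2 a b \<noteq> 0" using 1[of f g] by (simp add: \<sigma>_def)
    next
      fix a b c assume "a \<in> grp n" "b \<in> grp n" "c \<in> grp n"
      then obtain f g h where abc: "a = ls n f" "b = ls n g" "c = ls n h" using ex by blast
      show "tensor_cocycle n1 \<tau>1 \<tau>2 a b * tensor_cocycle n1 \<tau>1 \<tau>2 (gadd a b) c
          = tensor_cocycle n1 \<tau>1 \<tau>2 b c * tensor_cocycle n1 \<tau>1 \<tau>2 a (gadd b c)"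
        unfolding abc gadd_ls using 2[of f g h] unfolding \<sigma>_def .
    qed
  qed
  interpret T: twistedZ \<sigma> unfolding \<sigma>_def by (rule twistedZ_of_cocycle[OF coc])
  have d: "tga_dim n (tensor_cocycle n1 \<tau>1 \<tau>2) = T.kdim n" unfolding \<sigma>_def by (rule tga_dim_eq_kdim[OF coc])
  have lam: "T.lam a b = T1.lam a b * T2.lam (sh a) (sh b)" for a b
    by (simp add: T.lam_def T1.lam_def T2.lam_def \<sigma>)
  have cut: "\<sigma>1 a b = \<sigma>1 0 b" if "\<And>i. i < n1 \<Longrightarrow> a i = 0" for a b
  proof -
    have "ls n1 a = ls n1 0" using that by (simp add: ls_def)
    then show ?thesis by (simp only: \<sigma>1_def)
  qed
  have cut': "\<sigma>1 b a = \<sigma>1 b 0" if "\<And>i. i < n1 \<Longrightarrow> a i = 0" for a b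
  proof -
    have "ls n1 a = ls n1 0" using that by (simp add: ls_def)
    then show ?thesis by (simp only: \<sigma>1_def)
  qed
  have lam1: "T1.lam b a = 1" if "\<And>i. i < n1 \<Longrightarrow> a i = 0" for a b
  proof -
    have "T1.lam b a = T1.lam b 0" by (simp only: T1.lam_def cut[OF that] cut'[OF that])
    then show ?thesis by simp
  qed
  have sh0: "sh a = 0" if "\<And>i. i \<ge> n1 \<Longrightarrow> a i = 0" for a using that by (simp add: sh_def fun_eq_iff)
  let ?A = "{..<n1}"
  have cross: "T.tors a b" if "\<And>i. i \<notin> ?A \<Longrightarrow> a i = 0" "\<And>i. i \<in> ?A \<Longrightarrow> b i = 0" for a b
  proof -
    have "T1.lam a b = 1" by (rule lam1) (use that(2) in simp)
    moreover have "sh a = 0" by (rule sh0) (use that(1) in simp)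
    moreover have "T2.lam 0 (sh b) = 1" unfolding T2.lam_swap[of 0 "sh b"] by simp
    ultimately have "T.lam a b = 1" using lam[of a b] by simp
    then show ?thesis unfolding T.tors_def by (intro exI[of _ 1]) simp
  qed
  \<comment> \<open>The lower bound on the dimension of a factor enters here: an integral basis of
    \<open>W\<close> is a torsion family for \<open>\<sigma>1\<close>.\<close>
  have b1: "fs.dim W \<le> T1.kdim n1" if W: "fs.subspace W" "W \<subseteq> co ?A n" "T.torsub W" for W
  proof -
    have WQ: "W \<subseteq> Qn n" using W(2) by (auto simp: co_def)
    obtain B where B: "B \<subseteq> lat W" "finite B" "fs.independent (vec ` B)" "card B = fs.dim W"
      using integral_basis[OF W(1) WQ] by metis
    have B0: "b i = 0" if "b \<in> B" "i \<ge> n1" for b i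
      using that B(1) W(2) by (auto simp: lat_def co_def)
    have "card B \<le> T1.kdim n1"
    proof (rule T1.card_le_kdim[OF _ B(3) _ B(2)])
      show "B \<subseteq> Zn n1" using B0 by (auto simp: Zn_def)
      fix a b assume ab: "a \<in> B" "b \<in> B"
      have "sh a = 0" "sh b = 0" using B0 ab sh0 by blast+
      then have "T.lam a b = T1.lam a b" using lam[of a b] by simp
      moreover have "T.tors a b" using W(3) ab B(1) unfolding T.torsub_def by blast
      ultimately show "T1.tors a b" by (simp add: T.tors_def T1.tors_def)
    qed
    then show ?thesis using B(4) by simp
  qed
  have b2: "fs.dim W \<le> T2.kdim n2" if W: "fs.subspace W" "W \<subseteq> co (- ?A) n" "T.torsub W" for W
  proof -
    have WQ: "W \<subseteq> Qn n" using W(2) by (auto simp: co_def)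
    obtain B where B: "B \<subseteq> lat W" "finite B" "fs.independent (vec ` B)" "card B = fs.dim W" "W = fs.span (vec ` B)"
      using integral_basis[OF W(1) WQ] by metis
    \<comment> \<open>The shift is injective on \<open>W\<close>, whose first \<open>n1\<close>
      coordinates vanish, so independence is kept.\<close>
    define shq where "shq u = (\<lambda>i. u (i + n1))" for u :: "nat \<Rightarrow> rat"
    have B0: "b i = 0" if "b \<in> B" "i < n1" for b i
      using that B(1) W(2) by (auto simp: lat_def co_def)
    have ker: "u = 0" if u: "u \<in> fs.span (vec ` B)" "shq u = 0" for u
    proof
      fix i
      have "u i = 0" if "i < n1" using u(1) W(2) B(5) that by (auto simp: co_def)
      moreover have "u i = 0" if "i \<ge> n1" using fun_cong[OF u(2), of "i - n1"] that by (simp add: shq_def)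
      ultimately show "u i = 0 i" by (cases "i < n1") auto
    qed
    have shq: "fs.independent (shq ` vec ` B) \<and> inj_on shq (vec ` B)"
      by (rule independent_linear_image[OF _ _ B(3) ker]) (auto simp: shq_def fun_eq_iff)
    have img: "shq ` vec ` B = vec ` sh ` B"
    proof -
      have "shq (vec b) = vec (sh b)" for b by (simp add: shq_def sh_def fun_eq_iff)
      then show ?thesis by (simp add: image_image)
    qed
    have "card (sh ` B) = card B"
    proof -
      have "card (vec ` sh ` B) = card (vec ` B)" using shq card_image unfolding img[symmetric] by blast
      moreover have "inj_on vec X" for X by (simp add: inj_on_def vec_inj)
      ultimately show ?thesis using card_image by metis
    qed
    moreover have "card (sh ` B) \<le> T2.kdim n2"
    proof (rule T2.card_le_kdim)
      show "sh ` B \<subseteq> Zn n2"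
      proof (rule image_subsetI)
        fix b assume "b \<in> B"
        then have "b \<in> Zn n" using B(1) WQ lat_mono lat_Qn by blast
        then show "sh b \<in> Zn n2" by (auto simp: Zn_def sh_def n_def)
      qed
      show "fs.independent (vec ` sh ` B)" using shq img by simp
      show "finite (sh ` B)" using B(2) by simp
      fix a b assume "a \<in> sh ` B" "b \<in> sh ` B"
      then obtain a' b' where ab: "a' \<in> B" "b' \<in> B" "a = sh a'" "b = sh b'" by blast
      have "T1.lam a' b' = 1" by (rule lam1) (use B0 ab in blast)
      then have "T.lam a' b' = T2.lam a b" using lam[of a' b'] ab by simp
      moreover have "T.tors a' b'" using W(3) ab B(1) unfolding T.torsub_def by blast
      ultimately show "T2.tors a b" by (simp add: T.tors_def T2.tors_def)
    qed
    ultimately show ?thesis using B(4) by simp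
  qed
  have card1: "card ({..<n} - ?A) = n2" by (simp add: n_def card_Diff_subset lessThan_subset_iff)
  have "{..<n} - (- ?A) = ?A" by (auto simp: n_def)
  then have card2: "card ({..<n} - (- ?A)) = n1" by simp
  note less = assms(3,4)[unfolded d1 d2]
  have dim1: "fs.dim W < T1.kdim n1 + n2" if W: "fs.subspace W" "W \<subseteq> Qn n" "T.torsub W" for W
    unfolding card1[symmetric]
  proof (rule T.dim_torsub_le[OF _ b1 _ W])
    show "fs.dim W < card ({..<n} - ?A)" if "fs.subspace W" "W \<subseteq> co (- ?A) n" "T.torsub W" for W
      using b2[OF that] less(2) card1 by simp
  qed (use cross in blast)+
  have dim2: "fs.dim W < T2.kdim n2 + n1" if W: "fs.subspace W" "W \<subseteq> Qn n" "T.torsub W" for W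
  proof -
    have "fs.dim W < T2.kdim n2 + card ({..<n} - (- ?A))"
    proof (rule T.dim_torsub_le[OF _ b2 _ W])
      show "fs.dim W < card ({..<n} - (- ?A))" if "fs.subspace W" "W \<subseteq> co (- (- ?A)) n" "T.torsub W" for W
      proof -
        have "W \<subseteq> co ?A n" using that(2) by simp
        from b1[OF that(1) this that(3)] show ?thesis unfolding card2 using less(1) by linarith
      qed
      show "T.tors a b" if "\<And>i. i \<notin> - ?A \<Longrightarrow> a i = 0" "\<And>i. i \<in> - ?A \<Longrightarrow> b i = 0" for a b
        using cross[of b a] that T.tors_sym[of a b] by simp
    qed
    then show ?thesis by (simp only: card2)
  qed
  \<comment> \<open>The natural subtraction does not truncate, since both ranks are positive by the
    strict hypotheses.\<close>
  have "T.kdim n \<le> T1.kdim n1 + n2 - 1"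
  proof (rule T.kdim_le)
    show "T1.kdim n1 + n2 - 1 \<le> n" using less by (simp add: n_def)
    show "fs.dim W \<le> T1.kdim n1 + n2 - 1" if "fs.subspace W" "W \<subseteq> Qn n" "T.torsub W" for W
      using dim1[OF that] by simp
  qed
  moreover have "T.kdim n \<le> T2.kdim n2 + n1 - 1"
  proof (rule T.kdim_le)
    show "T2.kdim n2 + n1 - 1 \<le> n" using less by (simp add: n_def)
    show "fs.dim W \<le> T2.kdim n2 + n1 - 1" if "fs.subspace W" "W \<subseteq> Qn n" "T.torsub W" for W
      using dim2[OF that] by simp
  qed
  ultimately show ?thesis
    using less d d1 d2 unfolding n_def by linarith
qed

end
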